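(* Let $d\ge 1$ be an integer. Every $d(d+1)$-connected graph is globally rigid in $\mathbb{R}^d$.
   Context: A $d$-dimensional framework is a pair $(G,p)$ with $G=(V,E)$ a graph and $p:V\to\mathbb{R}^d$. Frameworks $(G,p)$ and $(G,q)$ are equivalent if $\|p(u)-p(v)\|=\|q(u)-q(v)\|$ for all $uv\in E$, and congruent if this holds for all $u,v\in V$. $(G,p)$ is globally rigid if every equivalent $d$-dimensional framework $(G,q)$ is congruent to $(G,p)$. A framework is generic if its $d|V|$ coordinates are algebraically independent over $\mathbb{Q}$. A graph is globally rigid in $\mathbb{R}^d$ if some (equivalently, every) generic $d$-dimensional framework of it is globally rigid. *)

theory Defs
  imports
    "HOL-Analysis.Analysis"
    "HOL-Library.Poly_Mapping"
    "Graph_Theory.Digraph_Component"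
begin

text \<open>
  Finite simple graphs are the \<open>pair_graph\<close>s of the \<open>Graph_Theory\<close> library: finite, loop-free,
  symmetric sets of arcs, an edge \<open>uv\<close> being the two arcs \<open>(u, v)\<close> and \<open>(v, u)\<close>.
  Note that \<open>HOL-Analysis\<close> has a topological \<open>connected\<close> as well.
\<close>

definition k_connected :: "nat \<Rightarrow> 'v pair_pre_digraph \<Rightarrow> bool" where
  "k_connected k G \<longleftrightarrow>
     k < card (pverts G) \<and>
     (\<forall>S \<subseteq> pverts G. card S < k \<longrightarrow>
        Digraph_Component.connected (induce_subgraph (with_proj G) (pverts G - S)))"

text \<open>
  A polynomial over \<open>\<rat>\<close> with variables indexed by \<open>'i\<close> is a finitely supported map from
  monomials to coefficients, a monomial being a finitely supported map from variables to exponents.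
\<close>

definition mpoly_eval :: "('i \<Rightarrow> real) \<Rightarrow> (('i \<Rightarrow>\<^sub>0 nat) \<Rightarrow>\<^sub>0 rat) \<Rightarrow> real" where
  "mpoly_eval x f =
     (\<Sum>m\<in>Poly_Mapping.keys f. of_rat (Poly_Mapping.lookup f m) * (\<Prod>i\<in>Poly_Mapping.keys m. x i ^ Poly_Mapping.lookup m i))"

definition alg_independent_over_rat :: "'i set \<Rightarrow> ('i \<Rightarrow> real) \<Rightarrow> bool" where
  "alg_independent_over_rat I x \<longleftrightarrow>
     (\<forall>f :: ('i \<Rightarrow>\<^sub>0 nat) \<Rightarrow>\<^sub>0 rat.
        (\<forall>m\<in>Poly_Mapping.keys f. Poly_Mapping.keys m \<subseteq> I) \<longrightarrow> mpoly_eval x f = 0 \<longrightarrow> f = 0)"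

text \<open>
  A \<open>d\<close>-dimensional framework on \<open>G\<close> is given by \<open>p :: 'v \<Rightarrow> real ^ 'd\<close> with \<open>CARD('d) = d\<close>;
  only the values of \<open>p\<close> on the vertices of \<open>G\<close> matter.
\<close>

definition equivalent_frameworks ::
    "'v pair_pre_digraph \<Rightarrow> ('v \<Rightarrow> real ^ 'd) \<Rightarrow> ('v \<Rightarrow> real ^ 'd) \<Rightarrow> bool" where
  "equivalent_frameworks G p q \<longleftrightarrow>
     (\<forall>(u, v) \<in> parcs G. norm (p u - p v) = norm (q u - q v))"

definition congruent_frameworks ::
    "'v pair_pre_digraph \<Rightarrow> ('v \<Rightarrow> real ^ 'd) \<Rightarrow> ('v \<Rightarrow> real ^ 'd) \<Rightarrow> bool" where
  "congruent_frameworks G p q \<longleftrightarrow>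
     (\<forall>u \<in> pverts G. \<forall>v \<in> pverts G. norm (p u - p v) = norm (q u - q v))"

definition globally_rigid_framework ::
    "'v pair_pre_digraph \<Rightarrow> ('v \<Rightarrow> real ^ 'd) \<Rightarrow> bool" where
  "globally_rigid_framework G p \<longleftrightarrow>
     (\<forall>q. equivalent_frameworks G p q \<longrightarrow> congruent_frameworks G p q)"

definition generic_framework :: "'v pair_pre_digraph \<Rightarrow> ('v \<Rightarrow> real ^ 'd) \<Rightarrow> bool" where
  "generic_framework G p \<longleftrightarrow>
     alg_independent_over_rat (pverts G \<times> (UNIV :: 'd set)) (\<lambda>(v, i). p v $ i)"

definition globally_rigid_graph :: "'d::finite itself \<Rightarrow> 'v pair_pre_digraph \<Rightarrow> bool" where
  "globally_rigid_graph (_ :: 'd itself) G \<longleftrightarrow>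
     (\<exists>p :: 'v \<Rightarrow> real ^ 'd. generic_framework G p \<and> globally_rigid_framework G p)"

end

theory Submission
  imports Defs
begin

text \<open>
  Fix a generic framework \<open>p\<close> and enlarge the graph by all pairs whose distance is preserved by every
  equivalent framework; the aim is to reach the complete graph. A vertex whose neighbourhood is a clique
  can be deleted without destroying connectivity, so by induction it suffices to find one.

  Measure an induced subgraph by the transcendence degree of its squared edge lengths, at most
  \<open>d (|V| - 1)\<close> by translation invariance. When a vertex \<open>v\<close> is added next to the set \<open>A\<close> of its earlier
  neighbours, the degree grows by at least \<open>min d |A|\<close>, and by at least \<open>d + 1\<close> if \<open>|A| > d\<close> and \<open>A\<close> is
  not a clique. Indeed, the squared distances from \<open>v\<close> to \<open>d + 1\<close> points lie on a quadric from which the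
  distances between these points can be read off. If these are algebraic over the lengths present before
  \<open>v\<close>, every equivalent framework yields a quadric with coefficients independent of the generic point
  \<open>p v\<close>, hence the same quadric, and the pairs in \<open>A\<close> are globally linked. Otherwise the \<open>d + 1\<close> new
  lengths satisfy no relation over the old ones.

  Averaging over all orderings of \<open>V\<close>, a vertex of degree at least \<open>d (d + 1)\<close> whose neighbourhood is not
  a clique contributes at least \<open>d\<close>, because cliques in the neighbourhood sharing \<open>d\<close> vertices merge and
  are therefore rare. If no neighbourhood were a clique, the degree would be at least \<open>d |V|\<close>.
\<close>

subsection \<open>Algebraic closure inside the reals\<close>

text \<open>The difficulty is asymmetric: \<open>p\<close> is generic, but the competing framework
  \<open>q\<close> is arbitrary and possibly degenerate. Genericity reaches \<open>q\<close> only
  because a rational polynomial relation between squared distances that holds at \<open>p\<close>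
  holds identically, hence also at \<open>q\<close>. So algebraic dependence over the edge lengths
  passes from \<open>p\<close> to \<open>q\<close>, and the independence of the shared lengths keeps
  the frames of \<open>q\<close> from collapsing. The constant d (d + 1) comes from one inequality.
  A vertex with D neighbours has D + 1 equally likely positions among them. Capping the gain at d
  loses d (d + 1) / 2 in total against a gain of d in each position. The extra unit for a non-clique
  wins at least j / D in every position j > d, in total (D (D + 1) - d (d + 1)) / (2 D). This covers
  the loss exactly when D >= d (d + 1). The same number ends the induction: on d (d + 1) + 1
  vertices the connectivity forces a complete graph.\<close>

inductive_set rat_ring :: "real set \<Rightarrow> real set" for S where
  rat_ring_rat: "of_rat r \<in> rat_ring S"
| rat_ring_base: "s \<in> S \<Longrightarrow> s \<in> rat_ring S"
| rat_ring_add: "a \<in> rat_ring S \<Longrightarrow> b \<in> rat_ring S \<Longrightarrow> a + b \<in> rat_ring S"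
| rat_ring_mult: "a \<in> rat_ring S \<Longrightarrow> b \<in> rat_ring S \<Longrightarrow> a * b \<in> rat_ring S"

definition poly_over :: "real set \<Rightarrow> real poly \<Rightarrow> bool" where
  "poly_over R P \<longleftrightarrow> (\<forall>i. coeff P i \<in> R)"

text \<open>The relative algebraic closure, inside the reals, of the field generated by
  \<open>S\<close>. Coefficients come from the ring instead of the field, which gives the same
  elements because denominators can be cleared; hence the pseudo-division and the nonzero
  multipliers below.\<close>

definition acl :: "real set \<Rightarrow> real set" where
  "acl S = {x. \<exists>P. P \<noteq> 0 \<and> poly_over (rat_ring S) P \<and> poly P x = 0}"

lemma rat_ring_0 [simp]: "0 \<in> rat_ring S"
  using rat_ring_rat[of 0 S] by simp

lemma rat_ring_1 [simp]: "1 \<in> rat_ring S"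
  using rat_ring_rat[of 1 S] by simp

lemma rat_ring_uminus: "a \<in> rat_ring S \<Longrightarrow> - a \<in> rat_ring S"
  using rat_ring_mult[OF rat_ring_rat[of "-1" S], of a] by (simp add: of_rat_minus)

lemma rat_ring_diff: "a \<in> rat_ring S \<Longrightarrow> b \<in> rat_ring S \<Longrightarrow> a - b \<in> rat_ring S"
  using rat_ring_add[OF _ rat_ring_uminus, of a S b] by simp

lemma rat_ring_sum: "(\<And>i. i \<in> I \<Longrightarrow> f i \<in> rat_ring S) \<Longrightarrow> sum f I \<in> rat_ring S"
  by (induction I rule: infinite_finite_induct) (auto intro: rat_ring_add)

lemma rat_ring_power: "a \<in> rat_ring S \<Longrightarrow> a ^ n \<in> rat_ring S"
  by (induction n) (auto intro: rat_ring_mult)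

lemma rat_ring_mono: "S \<subseteq> T \<Longrightarrow> rat_ring S \<subseteq> rat_ring T"
proof
  fix x assume "S \<subseteq> T" "x \<in> rat_ring S"
  from this(2,1) show "x \<in> rat_ring T" by induction (auto intro: rat_ring.intros)
qed

lemma rat_ring_idem: "rat_ring (rat_ring S) = rat_ring S"
proof
  show "rat_ring (rat_ring S) \<subseteq> rat_ring S"
  proof
    fix x assume "x \<in> rat_ring (rat_ring S)"
    then show "x \<in> rat_ring S" by induction (auto intro: rat_ring.intros)
  qed
qed (auto intro: rat_ring.intros)

lemma poly_over_mono: "R \<subseteq> R' \<Longrightarrow> poly_over R P \<Longrightarrow> poly_over R' P"
  unfolding poly_over_def by blast

lemma poly_over_0 [simp]: "poly_over (rat_ring S) 0"
  by (simp add: poly_over_def)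

lemma poly_over_diff:
  "poly_over (rat_ring S) P \<Longrightarrow> poly_over (rat_ring S) Q \<Longrightarrow> poly_over (rat_ring S) (P - Q)"
  by (simp add: poly_over_def rat_ring_diff)

lemma poly_over_add:
  "poly_over (rat_ring S) P \<Longrightarrow> poly_over (rat_ring S) Q \<Longrightarrow> poly_over (rat_ring S) (P + Q)"
  by (simp add: poly_over_def rat_ring_add)

lemma poly_over_mult:
  "poly_over (rat_ring S) P \<Longrightarrow> poly_over (rat_ring S) Q \<Longrightarrow> poly_over (rat_ring S) (P * Q)"
  by (auto simp: poly_over_def coeff_mult intro!: rat_ring_sum rat_ring_mult)

lemma poly_over_smult:
  "a \<in> rat_ring S \<Longrightarrow> poly_over (rat_ring S) Q \<Longrightarrow> poly_over (rat_ring S) (smult a Q)"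
  by (simp add: poly_over_def rat_ring_mult)

lemma poly_over_monom: "a \<in> rat_ring S \<Longrightarrow> poly_over (rat_ring S) (monom a n)"
  by (simp add: poly_over_def)

lemma poly_over_pCons:
  "a \<in> rat_ring S \<Longrightarrow> poly_over (rat_ring S) P \<Longrightarrow> poly_over (rat_ring S) (pCons a P)"
  by (auto simp: poly_over_def coeff_pCons split: nat.split)

lemma poly_over_sum:
  "(\<And>i. i \<in> I \<Longrightarrow> poly_over (rat_ring S) (f i)) \<Longrightarrow> poly_over (rat_ring S) (sum f I)"
  by (induction I rule: infinite_finite_induct) (auto intro: poly_over_add)

lemma poly_in_rat_ring:
  "poly_over (rat_ring S) P \<Longrightarrow> x \<in> rat_ring S \<Longrightarrow> poly P x \<in> rat_ring S"
  by (auto simp: poly_altdef poly_over_def intro!: rat_ring_sum rat_ring_mult rat_ring_power)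

lemma rat_ring_insert_poly:
  assumes "x \<in> rat_ring (insert c S)"
  obtains P where "poly_over (rat_ring S) P" "x = poly P c"
proof -
  from assms have "\<exists>P. poly_over (rat_ring S) P \<and> x = poly P c"
  proof induction
    case (rat_ring_rat r)
    have "poly_over (rat_ring S) [:of_rat r:] \<and> of_rat r = poly [:of_rat r:] c"
      by (auto intro: poly_over_pCons rat_ring.intros)
    then show ?case by blast
  next
    case (rat_ring_base s)
    show ?case
    proof (cases "s = c")
      case True
      have "poly_over (rat_ring S) [:0, 1:] \<and> s = poly [:0, 1:] c"
        using True by (intro conjI poly_over_pCons) simp_all
      then show ?thesis by blast
    next
      case False
      with rat_ring_base have "poly_over (rat_ring S) [:s:] \<and> s = poly [:s:] c"
        by (auto intro: poly_over_pCons rat_ring.intros)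
      then show ?thesis by blast
    qed
  next
    case (rat_ring_add a b)
    then show ?case by (metis poly_add poly_over_add)
  next
    case (rat_ring_mult a b)
    then show ?case by (metis poly_mult poly_over_mult)
  qed
  then show thesis using that by blast
qed

text \<open>Gaussian elimination without division: cross-multiplication with the pivot keeps the
  solution in the ring. It serves for dependencies between coefficient vectors and later, with
  \<open>acl L\<close> for \<open>S\<close>, for the Gram matrix of a degenerate frame.\<close>

lemma homogeneous_system_solution:
  fixes A :: "'e \<Rightarrow> 'i \<Rightarrow> real"
  assumes "finite E" "finite I" "card E < card I"
    and "\<And>e i. e \<in> E \<Longrightarrow> i \<in> I \<Longrightarrow> A e i \<in> rat_ring S"
  shows "\<exists>t. (\<forall>i\<in>I. t i \<in> rat_ring S) \<and> (\<exists>i\<in>I. t i \<noteq> 0) \<and> (\<forall>e\<in>E. (\<Sum>i\<in>I. A e i * t i) = 0)"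
  using assms
proof (induction E arbitrary: I A rule: finite_induct)
  case empty
  then have "I \<noteq> {}" by auto
  then show ?case by (intro exI[of _ "\<lambda>_. 1"]) auto
next
  case (insert e E)
  show ?case
  proof (cases "\<forall>i\<in>I. A e i = 0")
    case True
    obtain t where "\<forall>i\<in>I. t i \<in> rat_ring S" "\<exists>i\<in>I. t i \<noteq> 0" "\<forall>e\<in>E. (\<Sum>i\<in>I. A e i * t i) = 0"
      using insert.IH[of I A] insert.prems insert.hyps by auto
    with True show ?thesis by (intro exI[of _ t]) auto
  next
    case False
    then obtain k where k: "k \<in> I" "A e k \<noteq> 0" by blast
    define J where "J = I - {k}"
    have J: "finite J" "k \<notin> J" "I = insert k J" using insert.prems k by (auto simp: J_def)
    define B where "B f i = A e k * A f i - A f k * A e i" for f i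
    have "card E < card J" using insert.prems insert.hyps J by simp
    moreover have "B f i \<in> rat_ring S" if "f \<in> E" "i \<in> J" for f i
      unfolding B_def using that insert.prems k J by (intro rat_ring_diff rat_ring_mult) auto
    ultimately obtain t where t: "\<forall>i\<in>J. t i \<in> rat_ring S" "\<exists>i\<in>J. t i \<noteq> 0"
        "\<forall>f\<in>E. (\<Sum>i\<in>J. B f i * t i) = 0"
      using insert.IH[of J B] J by auto
    \<comment> \<open>Back substitution scaled by the pivot: \<open>t\<close> solves the reduced
      system, and equation \<open>e\<close> forces the value at \<open>k\<close>.\<close>
    define u where "u i = (if i = k then - (\<Sum>j\<in>J. A e j * t j) else A e k * t i)" for i
    have sum_u: "(\<Sum>i\<in>I. A f i * u i) = A e k * (\<Sum>i\<in>J. A f i * t i) - A f k * (\<Sum>j\<in>J. A e j * t j)"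
      for f
    proof -
      have "(\<Sum>i\<in>I. A f i * u i) = A f k * u k + (\<Sum>i\<in>J. A f i * u i)"
        using J by simp
      also have "(\<Sum>i\<in>J. A f i * u i) = (\<Sum>i\<in>J. A e k * (A f i * t i))"
        using J by (intro sum.cong) (auto simp: u_def)
      finally show ?thesis by (simp add: u_def sum_distrib_left)
    qed
    have "(\<Sum>i\<in>I. A f i * u i) = 0" if "f \<in> insert e E" for f
    proof (cases "f = e")
      case False
      then have "(\<Sum>i\<in>J. B f i * t i) = 0" using t(3) that by auto
      then show ?thesis unfolding sum_u B_def
        by (simp add: sum_distrib_left sum_subtractf algebra_simps)
    qed (simp add: sum_u)
    moreover have "\<forall>i\<in>I. u i \<in> rat_ring S"
    proof
      fix i assume "i \<in> I"
      show "u i \<in> rat_ring S"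
      proof (cases "i = k")
        case True
        then show ?thesis unfolding u_def
          using insert.prems(3) J t(1)
          by (auto intro!: rat_ring_uminus rat_ring_sum rat_ring_mult)
      next
        case False
        then show ?thesis unfolding u_def
          using insert.prems(3) J t(1) k \<open>i \<in> I\<close> by (auto intro!: rat_ring_mult)
      qed
    qed
    moreover have "\<exists>i\<in>I. u i \<noteq> 0" using t(2) J k by (auto simp: u_def)
    ultimately show ?thesis by blast
  qed
qed

text \<open>Pseudo-division: multiplying by the leading coefficient of \<open>Q\<close> replaces
  dividing by it, and the factors collect in \<open>s\<close>.\<close>

lemma pseudo_reduce:
  assumes Q: "poly_over (rat_ring S) Q" "Q \<noteq> 0" "poly Q c = 0"
    and P: "poly_over (rat_ring S) P"
  shows "\<exists>s R. s \<in> rat_ring S \<and> s \<noteq> 0 \<and> poly_over (rat_ring S) R \<and> degree R < degree Q \<and>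
    s * poly P c = poly R c"
  using P
proof (induction "degree P" arbitrary: P rule: less_induct)
  case less
  have deg_pos: "degree Q > 0"
  proof (rule ccontr)
    assume "\<not> degree Q > 0"
    then obtain q where "Q = [:q:]" using degree_eq_zeroE by blast
    with Q(2,3) show False by simp
  qed
  show ?case
  proof (cases "degree P < degree Q")
    case True
    then show ?thesis using less.prems by (intro exI[of _ 1] exI[of _ P]) auto
  next
    case False
    define P' where "P' = smult (lead_coeff Q) P - monom (lead_coeff P) (degree P - degree Q) * Q"
    have over: "poly_over (rat_ring S) P'"
      unfolding P'_def using less.prems Q(1)
      by (intro poly_over_diff poly_over_smult poly_over_mult poly_over_monom)
        (auto simp: poly_over_def)
    have "degree P' < degree P"
    proof (rule degree_lessI)
      show "P' \<noteq> 0 \<or> 0 < degree P" using False deg_pos by auto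
      have "degree P' \<le> degree P"
        unfolding P'_def using False Q(2)
        by (intro degree_diff_le) (auto intro!: order.trans[OF degree_mult_le] order.trans[OF add_mono[OF degree_monom_le order.refl]])
      moreover have "coeff P' (degree P) = 0"
        using False by (simp add: P'_def coeff_monom_mult)
      ultimately show "\<forall>k\<ge>degree P. coeff P' k = 0"
        by (metis coeff_eq_0 le_neq_implies_less order.strict_trans1)
    qed
    from less.hyps[OF this over] obtain s R where s: "s \<in> rat_ring S" "s \<noteq> 0"
      "poly_over (rat_ring S) R" "degree R < degree Q" "s * poly P' c = poly R c" by blast
    have "poly P' c = lead_coeff Q * poly P c" by (simp add: P'_def Q(3))
    with s have "s * lead_coeff Q * poly P c = poly R c" by simp
    moreover have "s * lead_coeff Q \<in> rat_ring S"
      using s Q(1) by (auto simp: poly_over_def intro: rat_ring_mult)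
    ultimately show ?thesis
      using s Q(2) by (intro exI[of _ "s * lead_coeff Q"] exI[of _ R]) auto
  qed
qed

text \<open>The coefficient vectors of \<open>card E + 1\<close> powers are linearly dependent, and
  the dependency is a polynomial with root \<open>x\<close>; the nonzero multipliers keep it
  nonzero. The family \<open>w\<close> must not depend on the exponent.\<close>

lemma acl_finite_span:
  fixes w :: "'e \<Rightarrow> real"
  assumes "finite E" and "\<And>i::nat. \<exists>s c. s \<in> rat_ring S \<and> s \<noteq> 0 \<and> (\<forall>e\<in>E. c e \<in> rat_ring S) \<and>
      s * x ^ i = (\<Sum>e\<in>E. c e * w e)"
  shows "x \<in> acl S"
proof -
  obtain s c where s: "\<And>i. s i \<in> rat_ring S" "\<And>i. s i \<noteq> 0"
    and c: "\<And>i e. e \<in> E \<Longrightarrow> c i e \<in> rat_ring S"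
    and sc: "\<And>i. s i * x ^ i = (\<Sum>e\<in>E. c i e * w e)"
    using assms(2) by metis
  obtain t where t: "\<forall>i\<in>{..card E}. t i \<in> rat_ring S" "\<exists>i\<in>{..card E}. t i \<noteq> 0"
      "\<forall>e\<in>E. (\<Sum>i\<le>card E. c i e * t i) = 0"
    using homogeneous_system_solution[of E "{..card E}" "\<lambda>e i. c i e" S] assms(1) c by auto
  define P where "P = (\<Sum>i\<le>card E. monom (t i * s i) i)"
  have "coeff P i = (if i \<le> card E then t i * s i else 0)" for i
    by (simp add: P_def coeff_sum sum.delta)
  then have "P \<noteq> 0" using t(2) s(2) by (metis atMost_iff coeff_0 mult_eq_0_iff)
  moreover have "poly_over (rat_ring S) P"
    unfolding P_def using t(1) s(1) by (auto intro!: poly_over_sum poly_over_monom rat_ring_mult)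
  moreover have "poly P x = 0"
  proof -
    have "poly P x = (\<Sum>i\<le>card E. t i * (s i * x ^ i))"
      by (simp add: P_def poly_sum poly_monom mult.assoc)
    also have "\<dots> = (\<Sum>i\<le>card E. \<Sum>e\<in>E. w e * (c i e * t i))"
      by (simp add: sc sum_distrib_left mult_ac)
    also have "\<dots> = (\<Sum>e\<in>E. w e * (\<Sum>i\<le>card E. c i e * t i))"
      by (subst sum.swap) (simp add: sum_distrib_left)
    also have "\<dots> = 0" using t(3) by simp
    finally show ?thesis .
  qed
  ultimately show ?thesis unfolding acl_def by blast
qed

lemma rat_ring_span_powers:
  assumes "c \<in> acl S"
  obtains n where "\<And>y. y \<in> rat_ring (insert c S) \<Longrightarrow>
    \<exists>s b. s \<in> rat_ring S \<and> s \<noteq> 0 \<and> (\<forall>i<n. b i \<in> rat_ring S) \<and> s * y = (\<Sum>i<n. b i * c ^ i)"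
proof -
  from assms obtain Q where Q: "poly_over (rat_ring S) Q" "Q \<noteq> 0" "poly Q c = 0"
    unfolding acl_def by blast
  show thesis
  proof (rule that)
    fix y assume "y \<in> rat_ring (insert c S)"
    then obtain P where P: "poly_over (rat_ring S) P" "y = poly P c"
      by (rule rat_ring_insert_poly)
    from pseudo_reduce[OF Q P(1)] obtain s R where sR: "s \<in> rat_ring S" "s \<noteq> 0"
      "poly_over (rat_ring S) R" "degree R < degree Q" "s * poly P c = poly R c" by blast
    have "poly R c = (\<Sum>i<degree Q. coeff R i * c ^ i)"
      unfolding poly_altdef using sR(4) by (intro sum.mono_neutral_left) (auto intro: le_degree coeff_eq_0)
    with sR P(2) show "\<exists>s b. s \<in> rat_ring S \<and> s \<noteq> 0 \<and> (\<forall>i<degree Q. b i \<in> rat_ring S) \<and>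
        s * y = (\<Sum>i<degree Q. b i * c ^ i)"
      by (intro exI[of _ s] exI[of _ "coeff R"]) (auto simp: poly_over_def)
  qed
qed

lemma rat_ring_insert_subset_acl:
  assumes "c \<in> acl S" "y \<in> rat_ring (insert c S)"
  shows "y \<in> acl S"
proof -
  obtain n where n: "\<And>y. y \<in> rat_ring (insert c S) \<Longrightarrow>
    \<exists>s b. s \<in> rat_ring S \<and> s \<noteq> 0 \<and> (\<forall>i<n. b i \<in> rat_ring S) \<and> s * y = (\<Sum>i<n. b i * c ^ i)"
    using rat_ring_span_powers[OF assms(1)] by blast
  show ?thesis
    by (rule acl_finite_span[of "{..<n}" _ _ "\<lambda>i. c ^ i"])
      (use n[OF rat_ring_power[OF assms(2)]] in \<open>simp_all add: Ball_def\<close>)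
qed

text \<open>After powers of the variable are stripped from an annihilating polynomial, its constant
  term is nonzero and a multiple of \<open>y\<close>. This moves denominators from an extension into
  the base ring.\<close>

lemma acl_nonzero_multiple:
  assumes "y \<in> acl S" "y \<noteq> 0"
  obtains z where "z \<in> rat_ring (insert y S)" "z * y \<in> rat_ring S" "z * y \<noteq> 0"
proof -
  from assms(1) obtain P where "P \<noteq> 0 \<and> poly_over (rat_ring S) P \<and> poly P y = 0"
    unfolding acl_def by blast
  then have "\<exists>z. z \<in> rat_ring (insert y S) \<and> z * y \<in> rat_ring S \<and> z * y \<noteq> 0"
  proof (induction P rule: pCons_induct)
    case (pCons a P)
    have over: "a \<in> rat_ring S" "poly_over (rat_ring S) P"
      using pCons.prems unfolding poly_over_def
      by (metis coeff_pCons_0, metis coeff_pCons_Suc)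
    show ?case
    proof (cases "a = 0")
      case True
      with pCons.prems assms(2) over show ?thesis by (intro pCons.IH) auto
    next
      case False
      have eq: "- poly P y * y = a" using pCons.prems by (simp add: algebra_simps)
      have "poly P y \<in> rat_ring (insert y S)"
        by (intro poly_in_rat_ring poly_over_mono[OF rat_ring_mono over(2)]) (auto intro: rat_ring_base)
      with eq False over(1) show ?thesis
        by (intro exI[of _ "- poly P y"]) (auto intro: rat_ring_uminus)
    qed
  qed simp
  then show thesis using that by blast
qed

text \<open>The degree argument for towers: up to nonzero multipliers, every power of
  \<open>x\<close> is a combination over \<open>rat_ring S\<close> of the products of a power of
  \<open>x\<close> below \<open>m\<close> and a power of \<open>c\<close> below
  \<open>n\<close>.\<close>

lemma acl_insert_subset:
  assumes c: "c \<in> acl S" and x: "x \<in> acl (insert c S)"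
  shows "x \<in> acl S"
proof -
  let ?R = "rat_ring (insert c S)"
  obtain n where n: "\<And>y. y \<in> ?R \<Longrightarrow>
    \<exists>s b. s \<in> rat_ring S \<and> s \<noteq> 0 \<and> (\<forall>i<n. b i \<in> rat_ring S) \<and> s * y = (\<Sum>i<n. b i * c ^ i)"
    using rat_ring_span_powers[OF c] by blast
  obtain m where m: "\<And>y. y \<in> rat_ring (insert x (insert c S)) \<Longrightarrow>
    \<exists>s b. s \<in> ?R \<and> s \<noteq> 0 \<and> (\<forall>i<m. b i \<in> ?R) \<and> s * y = (\<Sum>i<m. b i * x ^ i)"
    using rat_ring_span_powers[OF x] by blast
  show ?thesis
  proof (rule acl_finite_span[of "{..<m} \<times> {..<n}" _ _ "\<lambda>(i, j). x ^ i * c ^ j"])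
    fix k :: nat
    have "x ^ k \<in> rat_ring (insert x (insert c S))"
      by (intro rat_ring_power rat_ring_base) auto
    from m[OF this] obtain s b where sb: "s \<in> ?R" "s \<noteq> 0" "\<forall>i<m. b i \<in> ?R"
      "s * x ^ k = (\<Sum>i<m. b i * x ^ i)" by blast
    have "s \<in> acl S" using rat_ring_insert_subset_acl[OF c sb(1)] .
    \<comment> \<open>The multiplier \<open>s\<close> may still involve \<open>c\<close>;
      \<open>z\<close> turns it into a nonzero element of \<open>rat_ring S\<close>.\<close>
    from acl_nonzero_multiple[OF this sb(2)] obtain z where z: "z \<in> rat_ring (insert s S)"
      "z * s \<in> rat_ring S" "z * s \<noteq> 0" by blast
    have "rat_ring (insert s S) \<subseteq> rat_ring ?R"
      using sb(1) by (intro rat_ring_mono) (auto intro: rat_ring_base)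
    then have zR: "z \<in> ?R" using z(1) rat_ring_idem by auto
    have "\<forall>i\<in>{..<m}. \<exists>t a. t \<in> rat_ring S \<and> t \<noteq> 0 \<and> (\<forall>j<n. a j \<in> rat_ring S) \<and>
        t * (z * b i) = (\<Sum>j<n. a j * c ^ j)"
      using n rat_ring_mult[OF zR] sb(3) by auto
    then obtain t a where "\<forall>i\<in>{..<m}. t i \<in> rat_ring S \<and> t i \<noteq> 0 \<and> (\<forall>j<n. a i j \<in> rat_ring S) \<and>
        t i * (z * b i) = (\<Sum>j<n. a i j * c ^ j)"
      unfolding bchoice_iff by blast
    then have t: "\<And>i. i < m \<Longrightarrow> t i \<in> rat_ring S" "\<And>i. i < m \<Longrightarrow> t i \<noteq> 0"
      and a: "\<And>i j. i < m \<Longrightarrow> j < n \<Longrightarrow> a i j \<in> rat_ring S"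
      and ta: "\<And>i. i < m \<Longrightarrow> t i * (z * b i) = (\<Sum>j<n. a i j * c ^ j)"
      by auto
    \<comment> \<open>A common denominator, with \<open>T' i\<close> as the cofactor of
      \<open>t i\<close>.\<close>
    define T where "T = (\<Prod>i<m. t i)"
    define T' where "T' i = (\<Prod>j\<in>{..<m} - {i}. t j)" for i
    have prod_in: "(\<Prod>i\<in>I. t i) \<in> rat_ring S" if "I \<subseteq> {..<m}" for I
      using that by (induction I rule: infinite_finite_induct) (auto intro!: rat_ring_mult t)
    have T: "T = t i * T' i" if "i < m" for i
      unfolding T_def T'_def using that by (subst prod.remove[of _ i]) auto
    have "T * (z * s) * x ^ k = (\<Sum>i<m. T * (z * b i) * x ^ i)"
      using sb(4) by (simp add: sum_distrib_left mult.assoc)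
    also have "\<dots> = (\<Sum>i<m. T' i * (\<Sum>j<n. a i j * c ^ j) * x ^ i)"
      by (intro sum.cong refl) (simp add: T ta[symmetric])
    also have "\<dots> = (\<Sum>i<m. \<Sum>j<n. T' i * a i j * (x ^ i * c ^ j))"
      by (simp add: sum_distrib_left sum_distrib_right mult_ac)
    also have "\<dots> = (\<Sum>(i, j)\<in>{..<m} \<times> {..<n}. T' i * a i j * (x ^ i * c ^ j))"
      by (simp add: sum.cartesian_product)
    finally have "T * (z * s) * x ^ k =
      (\<Sum>e\<in>{..<m} \<times> {..<n}. (T' (fst e) * a (fst e) (snd e)) * (case e of (i, j) \<Rightarrow> x ^ i * c ^ j))"
      by (simp add: case_prod_unfold)
    moreover have "T * (z * s) \<noteq> 0" using z t(2) by (auto simp: T_def)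
    moreover have "T * (z * s) \<in> rat_ring S"
      unfolding T_def by (intro rat_ring_mult z prod_in) auto
    moreover have "\<forall>e\<in>{..<m} \<times> {..<n}. T' (fst e) * a (fst e) (snd e) \<in> rat_ring S"
      unfolding T'_def by (auto intro!: rat_ring_mult a prod_in)
    ultimately show "\<exists>s c'. s \<in> rat_ring S \<and> s \<noteq> 0 \<and> (\<forall>e\<in>{..<m} \<times> {..<n}. c' e \<in> rat_ring S) \<and>
        s * x ^ k = (\<Sum>e\<in>{..<m} \<times> {..<n}. c' e * (case e of (i, j) \<Rightarrow> x ^ i * c ^ j))"
      by (intro exI[of _ "T * (z * s)"] exI[of _ "\<lambda>e. T' (fst e) * a (fst e) (snd e)"] conjI)
  qed simp
qed

section \<open>Algebraic closure as a closure operator with exchange\<close>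

lemma rat_ring_subset_acl: "rat_ring S \<subseteq> acl S"
proof
  fix a assume "a \<in> rat_ring S"
  then have "[:-a, 1:] \<noteq> 0 \<and> poly_over (rat_ring S) [:-a, 1:] \<and> poly [:-a, 1:] a = 0"
    by (auto intro!: poly_over_pCons rat_ring_uminus)
  then show "a \<in> acl S" unfolding acl_def by blast
qed

lemma subset_acl: "S \<subseteq> acl S"
  using rat_ring_subset_acl rat_ring_base by blast

lemma acl_base: "s \<in> S \<Longrightarrow> s \<in> acl S"
  using subset_acl by blast

lemma acl_mono: "S \<subseteq> T \<Longrightarrow> acl S \<subseteq> acl T"
  unfolding acl_def using poly_over_mono[OF rat_ring_mono] by blast

lemma rat_ring_finite:
  assumes "a \<in> rat_ring S"
  obtains F where "finite F" "F \<subseteq> S" "a \<in> rat_ring F"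
proof -
  from assms have "\<exists>F. finite F \<and> F \<subseteq> S \<and> a \<in> rat_ring F"
  proof induction
    case (rat_ring_rat r)
    then show ?case by (intro exI[of _ "{}"]) (auto intro: rat_ring.intros)
  next
    case (rat_ring_base s)
    then show ?case by (intro exI[of _ "{s}"]) (auto intro: rat_ring.intros)
  next
    case (rat_ring_add a b)
    then obtain F G where "finite F" "F \<subseteq> S" "a \<in> rat_ring F" "finite G" "G \<subseteq> S" "b \<in> rat_ring G"
      by blast
    then show ?case
      using rat_ring_mono[of F "F \<union> G"] rat_ring_mono[of G "F \<union> G"]
      by (intro exI[of _ "F \<union> G"]) (auto intro: rat_ring.intros)
  next
    case (rat_ring_mult a b)
    then obtain F G where "finite F" "F \<subseteq> S" "a \<in> rat_ring F" "finite G" "G \<subseteq> S" "b \<in> rat_ring G"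
      by blast
    then show ?case
      using rat_ring_mono[of F "F \<union> G"] rat_ring_mono[of G "F \<union> G"]
      by (intro exI[of _ "F \<union> G"]) (auto intro: rat_ring.intros)
  qed
  then show thesis using that by blast
qed

text \<open>Finite character: it reduces adjoining a set of algebraic elements to adjoining them one
  by one.\<close>

lemma acl_finite:
  assumes "x \<in> acl S"
  obtains F where "finite F" "F \<subseteq> S" "x \<in> acl F"
proof -
  from assms obtain P where P: "P \<noteq> 0" "poly_over (rat_ring S) P" "poly P x = 0"
    unfolding acl_def by blast
  have "\<exists>F. finite F \<and> F \<subseteq> S \<and> coeff P i \<in> rat_ring F" for i
    using P(2) rat_ring_finite unfolding poly_over_def by metis
  then obtain F where F: "\<And>i. finite (F i)" "\<And>i. F i \<subseteq> S" "\<And>i. coeff P i \<in> rat_ring (F i)"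
    by metis
  let ?F = "\<Union>i\<le>degree P. F i"
  have "poly_over (rat_ring ?F) P"
    unfolding poly_over_def
  proof
    fix i show "coeff P i \<in> rat_ring ?F"
    proof (cases "i \<le> degree P")
      case True
      then have "F i \<subseteq> ?F" by blast
      then show ?thesis using rat_ring_mono F(3) by blast
    qed (simp add: coeff_eq_0)
  qed
  with P F that[of ?F] show thesis unfolding acl_def by blast
qed

lemma acl_subset:
  assumes "T \<subseteq> acl S"
  shows "acl T \<subseteq> acl S"
proof
  fix x assume "x \<in> acl T"
  then obtain F where F: "finite F" "F \<subseteq> T" "x \<in> acl F" by (rule acl_finite)
  have "acl (F \<union> S) \<subseteq> acl S" using F(1) assms F(2)
  proof (induction F rule: finite_induct)
    case (insert c F)
    then have "c \<in> acl (F \<union> S)" using acl_mono[of S "F \<union> S"] by blast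
    with insert show ?case using acl_insert_subset[of c "F \<union> S"] by auto
  qed simp
  with F(3) acl_mono[of F "F \<union> S"] show "x \<in> acl S" by blast
qed

lemma acl_idem: "acl (acl S) = acl S"
  using acl_subset[of "acl S" S] subset_acl by blast

lemma rat_ring_acl: "rat_ring (acl S) = acl S"
  using rat_ring_subset_acl[of "acl S"] acl_idem rat_ring_base by blast

lemma acl_add: "a \<in> acl S \<Longrightarrow> b \<in> acl S \<Longrightarrow> a + b \<in> acl S"
  and acl_mult: "a \<in> acl S \<Longrightarrow> b \<in> acl S \<Longrightarrow> a * b \<in> acl S"
  and acl_diff: "a \<in> acl S \<Longrightarrow> b \<in> acl S \<Longrightarrow> a - b \<in> acl S"
  and acl_uminus: "a \<in> acl S \<Longrightarrow> - a \<in> acl S"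
  and acl_sum: "(\<And>i. i \<in> I \<Longrightarrow> f i \<in> acl S) \<Longrightarrow> sum f I \<in> acl S"
  and acl_rat: "of_rat r \<in> acl S"
  using rat_ring_add[of a "acl S" b] rat_ring_mult[of a "acl S" b] rat_ring_diff[of a "acl S" b]
    rat_ring_uminus[of a "acl S"] rat_ring_sum[of I f "acl S"]
    rat_ring_rat[of r "acl S"]
  by (simp_all add: rat_ring_acl)

lemma acl_prod: "(\<And>i. i \<in> I \<Longrightarrow> f i \<in> acl S) \<Longrightarrow> prod f I \<in> acl S"
  by (induction I rule: infinite_finite_induct) (use acl_rat[of 1] in \<open>auto intro: acl_mult\<close>)

lemma acl_Rats: "q \<in> \<rat> \<Longrightarrow> q \<in> acl S"
  by (metis Rats_cases acl_rat)

lemma acl_numeral [simp]: "numeral n \<in> acl S" "0 \<in> acl S" "1 \<in> acl S"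
  by (auto intro: acl_Rats)

lemma acl_root:
  assumes "P \<noteq> 0" "poly_over (acl S) P" "poly P x = 0"
  shows "x \<in> acl S"
proof -
  have "x \<in> acl (acl S)" using assms unfolding acl_def[of "acl S"] by (auto simp: rat_ring_acl)
  then show ?thesis by (simp add: acl_idem)
qed

lemma acl_inverse:
  assumes "a \<in> acl S"
  shows "inverse a \<in> acl S"
proof (cases "a = 0")
  case False
  show ?thesis
  proof (rule acl_root[of "[:-1, a:]"])
    show "poly_over (acl S) [:- 1, a:]"
      using assms poly_over_pCons[of _ "acl S"] by (metis acl_numeral(3) acl_uminus poly_over_0 rat_ring_acl)
  qed (use False in auto)
qed (use assms in simp)

lemma acl_divide: "a \<in> acl S \<Longrightarrow> b \<in> acl S \<Longrightarrow> a / b \<in> acl S"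
  by (simp add: divide_inverse acl_mult acl_inverse)

text \<open>The relation between \<open>x\<close> and \<open>y\<close> is reread as a polynomial in
  \<open>x\<close> whose coefficients are the polynomials \<open>C i\<close> evaluated at
  \<open>y\<close>. Some \<open>C i\<close> is nonzero over \<open>rat_ring S\<close>, and it does
  not vanish at \<open>y\<close> because \<open>y\<close> is transcendental over
  \<open>S\<close>.\<close>

lemma acl_exchange:
  assumes y: "y \<in> acl (insert x S)" and ny: "y \<notin> acl S"
  shows "x \<in> acl (insert y S)"
proof -
  from y obtain P where P: "P \<noteq> 0" "poly_over (rat_ring (insert x S)) P" "poly P y = 0"
    unfolding acl_def by blast
  have "\<exists>A. poly_over (rat_ring S) A \<and> coeff P k = poly A x" for k
    using P(2) rat_ring_insert_poly unfolding poly_over_def by metis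
  then obtain A where A: "\<And>k. poly_over (rat_ring S) (A k)" "\<And>k. coeff P k = poly (A k) x"
    by metis
  define n where "n = degree P"
  define M where "M = (\<Sum>k\<le>n. degree (A k))"
  have degM: "degree (A k) \<le> M" if "k \<le> n" for k
    unfolding M_def using that by (intro member_le_sum) auto
  define C where "C i = (\<Sum>k\<le>n. monom (coeff (A k) i) k)" for i
  have coeffC: "coeff (C i) k = (if k \<le> n then coeff (A k) i else 0)" for i k
    by (simp add: C_def coeff_sum sum.delta)
  define B where "B = (\<Sum>i\<le>M. monom (poly (C i) y) i)"
  have coeffB: "coeff B i = (if i \<le> M then poly (C i) y else 0)" for i
    by (simp add: B_def coeff_sum sum.delta)
  have "poly B x = (\<Sum>i\<le>M. \<Sum>k\<le>n. coeff (A k) i * y ^ k * x ^ i)"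
    by (simp add: B_def C_def poly_sum poly_monom sum_distrib_right)
  also have "\<dots> = (\<Sum>k\<le>n. (\<Sum>i\<le>M. coeff (A k) i * x ^ i) * y ^ k)"
    by (subst sum.swap) (simp add: sum_distrib_right sum_distrib_left mult_ac)
  also have "\<dots> = (\<Sum>k\<le>n. poly (A k) x * y ^ k)"
  proof (intro sum.cong refl, goal_cases)
    case (1 k)
    have "poly (A k) x = (\<Sum>i\<le>M. coeff (A k) i * x ^ i)"
      unfolding poly_altdef using degM 1
      by (intro sum.mono_neutral_left) (auto intro: coeff_eq_0)
    then show ?case by simp
  qed
  also have "\<dots> = poly P y" by (simp add: poly_altdef A(2) n_def)
  finally have "poly B x = 0" using P(3) by simp
  moreover have "poly_over (rat_ring (insert y S)) B"
  proof -
    have "poly_over (rat_ring S) (C i)" for i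
      unfolding C_def using A(1) by (intro poly_over_sum poly_over_monom) (simp add: poly_over_def)
    then have "poly_over (rat_ring (insert y S)) (C i)" for i
      using poly_over_mono[OF rat_ring_mono] by blast
    then show ?thesis unfolding B_def
      by (intro poly_over_sum poly_over_monom poly_in_rat_ring) (auto intro: rat_ring_base)
  qed
  moreover have "B \<noteq> 0"
  proof -
    obtain k where k: "coeff P k \<noteq> 0" using P(1) by (metis leading_coeff_0_iff)
    then have "k \<le> n" by (simp add: n_def le_degree)
    have "A k \<noteq> 0" using k A(2) by auto
    then obtain i where i: "coeff (A k) i \<noteq> 0" by (metis leading_coeff_0_iff)
    then have "i \<le> M" using degM[OF \<open>k \<le> n\<close>] le_degree order.trans by blast
    have "C i \<noteq> 0" using coeffC[of i k] i \<open>k \<le> n\<close> by auto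
    moreover have "poly_over (rat_ring S) (C i)"
      unfolding C_def using A(1) by (intro poly_over_sum poly_over_monom) (simp add: poly_over_def)
    ultimately have "poly (C i) y \<noteq> 0" using ny unfolding acl_def by blast
    then show ?thesis using coeffB[of i] \<open>i \<le> M\<close> by auto
  qed
  ultimately show ?thesis unfolding acl_def by blast
qed

subsection \<open>Algebraically independent families and rank\<close>

text \<open>Algebraic independence over \<open>L\<close> in matroid form. It concerns an indexed
  family, so a repeated value counts as a dependence.\<close>

definition alg_ind :: "real set \<Rightarrow> ('i \<Rightarrow> real) \<Rightarrow> 'i set \<Rightarrow> bool" where
  "alg_ind L f I \<longleftrightarrow> (\<forall>i\<in>I. f i \<notin> acl (L \<union> f ` (I - {i})))"

text \<open>For finite \<open>T\<close>, the transcendence degree over the rationals.\<close>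

definition rk :: "real set \<Rightarrow> nat" where
  "rk T = Max (card ` {B. B \<subseteq> T \<and> alg_ind {} (\<lambda>x. x) B})"

lemma alg_ind_subset:
  assumes "alg_ind L f I" "J \<subseteq> I"
  shows "alg_ind L f J"
  unfolding alg_ind_def
proof
  fix j assume "j \<in> J"
  have "L \<union> f ` (J - {j}) \<subseteq> L \<union> f ` (I - {j})" using assms(2) by blast
  then show "f j \<notin> acl (L \<union> f ` (J - {j}))"
    using assms \<open>j \<in> J\<close> acl_mono unfolding alg_ind_def by blast
qed

lemma acl_Un_subset: "S \<subseteq> acl T \<Longrightarrow> acl (S \<union> U) \<subseteq> acl (T \<union> U)"
  using acl_mono[of T "T \<union> U"] by (intro acl_subset) (auto intro: acl_base)

lemma alg_ind_base_mono:
  assumes "alg_ind L f I" "L' \<subseteq> acl L"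
  shows "alg_ind L' f I"
  using assms acl_Un_subset unfolding alg_ind_def by blast

text \<open>Steinitz exchange: an \<open>f i\<close> outside the closure without \<open>c\<close>
  takes the place of \<open>c\<close> and moves into the base \<open>L\<close>, so one index and one
  generator disappear together.\<close>

lemma alg_ind_card_le:
  assumes "finite C" "finite I" "alg_ind L f I" "f ` I \<subseteq> acl (L \<union> C)"
  shows "card I \<le> card C"
  using assms
proof (induction C arbitrary: L I rule: finite_induct)
  case empty
  have "I = {}"
  proof (rule ccontr)
    assume "I \<noteq> {}"
    then obtain i where "i \<in> I" by blast
    then have "f i \<notin> acl (L \<union> f ` (I - {i}))" "f i \<in> acl L"
      using empty by (auto simp: alg_ind_def)
    then show False using acl_mono[of L "L \<union> f ` (I - {i})"] by blast
  qed
  then show ?case by simp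
next
  case (insert c C)
  show ?case
  proof (cases "f ` I \<subseteq> acl (L \<union> C)")
    case True
    then show ?thesis using insert.IH[of I L] insert.prems insert.hyps by auto
  next
    case False
    then obtain i where i: "i \<in> I" "f i \<notin> acl (L \<union> C)" by blast
    then have "f i \<in> acl (insert c (L \<union> C))" using insert.prems by auto
    from acl_exchange[OF this i(2)] have "c \<in> acl (insert (f i) (L \<union> C))" .
    then have "insert c (L \<union> C) \<subseteq> acl (insert (f i) (L \<union> C))"
      by (auto intro: acl_base)
    then have "acl (L \<union> insert c C) \<subseteq> acl (insert (f i) L \<union> C)"
      using acl_subset by simp
    then have "f ` (I - {i}) \<subseteq> acl (insert (f i) L \<union> C)" using insert.prems(3) by blast
    moreover have "alg_ind (insert (f i) L) f (I - {i})"
      unfolding alg_ind_def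
    proof
      fix j assume j: "j \<in> I - {i}"
      have "insert (f i) L \<union> f ` (I - {i} - {j}) \<subseteq> L \<union> f ` (I - {j})" using i j by blast
      then show "f j \<notin> acl (insert (f i) L \<union> f ` (I - {i} - {j}))"
        using insert.prems(2) j acl_mono unfolding alg_ind_def by blast
    qed
    ultimately have "card (I - {i}) \<le> card C"
      using insert.IH[of "I - {i}" "insert (f i) L"] insert.prems(1) by blast
    then show ?thesis using insert.hyps insert.prems(1) i(1) by (simp add: card_Diff_singleton)
  qed
qed

text \<open>A redundant member of \<open>g\<close> would leave fewer than \<open>card I\<close>
  generators. This carries independence from coordinates to inner products to squared distances,
  where only the old quantities have to be recovered algebraically from the new ones.\<close>

lemma alg_ind_swap:
  assumes "alg_ind L f I" "finite I" "finite J" "card J \<le> card I" "f ` I \<subseteq> acl (L \<union> g ` J)"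
  shows "alg_ind L g J"
  unfolding alg_ind_def
proof (intro ballI notI)
  fix j assume j: "j \<in> J" "g j \<in> acl (L \<union> g ` (J - {j}))"
  then have "L \<union> g ` J \<subseteq> acl (L \<union> g ` (J - {j}))"
    by (auto intro: acl_base)
  then have "f ` I \<subseteq> acl (L \<union> g ` (J - {j}))" using assms(5) acl_subset by blast
  then have "card I \<le> card (g ` (J - {j}))"
    using assms(3) by (intro alg_ind_card_le[OF _ assms(2,1)]) auto
  also have "\<dots> \<le> card (J - {j})" using assms(3) by (intro card_image_le) auto
  also have "\<dots> < card J" using j assms(3) by (intro psubset_card_mono) auto
  finally show False using assms(4) by simp
qed

lemma alg_ind_insert:
  assumes "alg_ind {} (\<lambda>x. x) B" "t \<notin> acl B"
  shows "alg_ind {} (\<lambda>x. x) (insert t B)"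
  unfolding alg_ind_def
proof
  have tB: "t \<notin> B" using assms acl_base by blast
  fix b assume b: "b \<in> insert t B"
  show "b \<notin> acl ({} \<union> (\<lambda>x. x) ` (insert t B - {b}))"
  proof (cases "b = t")
    case True
    then show ?thesis using assms(2) tB by simp
  next
    case False
    then have "insert t B - {b} = insert t (B - {b})" by blast
    moreover have "b \<notin> acl (B - {b})" using assms(1) b False by (auto simp: alg_ind_def)
    moreover have "insert b (B - {b}) = B" using b False by blast
    ultimately show ?thesis using acl_exchange[of b t "B - {b}"] assms(2) by auto
  qed
qed

lemma rk_basis:
  assumes "finite T"
  obtains B where "B \<subseteq> T" "alg_ind {} (\<lambda>x. x) B" "card B = rk T" "T \<subseteq> acl B"
proof -
  let ?F = "{B. B \<subseteq> T \<and> alg_ind {} (\<lambda>x. x) B}"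
  have fin: "finite (card ` ?F)" using assms by simp
  have "{} \<in> ?F" by (simp add: alg_ind_def)
  then have "rk T \<in> card ` ?F" unfolding rk_def using fin by (intro Max_in) auto
  then obtain B where B: "B \<subseteq> T" "alg_ind {} (\<lambda>x. x) B" "card B = rk T" by auto
  have "t \<in> acl B" if t: "t \<in> T" for t
  proof (rule ccontr)
    assume nt: "t \<notin> acl B"
    then have "insert t B \<in> ?F" using B t alg_ind_insert by auto
    then have "card (insert t B) \<le> rk T" unfolding rk_def using fin by (intro Max_ge) auto
    moreover have "t \<notin> B" using nt acl_base by blast
    ultimately show False using B assms finite_subset[OF B(1)] by simp
  qed
  with B that show thesis by blast
qed

lemma rk_le_card:
  assumes "finite T" "finite C" "T \<subseteq> acl C"
  shows "rk T \<le> card C"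
proof -
  obtain B where B: "B \<subseteq> T" "alg_ind {} (\<lambda>x. x) B" "card B = rk T" "T \<subseteq> acl B"
    by (rule rk_basis[OF assms(1)])
  have "card B \<le> card C"
    by (rule alg_ind_card_le[OF assms(2) _ B(2)]) (use B assms finite_subset in auto)
  then show ?thesis using B by simp
qed

lemma rk_mono:
  assumes "finite S" "finite T" "S \<subseteq> acl T"
  shows "rk S \<le> rk T"
proof -
  obtain B where B: "B \<subseteq> T" "alg_ind {} (\<lambda>x. x) B" "card B = rk T" "T \<subseteq> acl B"
    by (rule rk_basis[OF assms(2)])
  have "S \<subseteq> acl B" using acl_subset[OF B(4)] assms(3) by blast
  then show ?thesis using rk_le_card[of S B] assms B finite_subset[OF B(1) assms(2)] by simp
qed

lemma rk_insert:
  assumes "finite T" "t \<notin> acl T"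
  shows "rk T + 1 \<le> rk (insert t T)"
proof -
  obtain B where B: "B \<subseteq> T" "alg_ind {} (\<lambda>x. x) B" "card B = rk T" "T \<subseteq> acl B"
    by (rule rk_basis[OF assms(1)])
  have t: "t \<notin> acl B" "t \<notin> B" using assms acl_mono[OF B(1)] acl_base[of t B] by blast+
  have "card (insert t B) \<le> rk (insert t T)"
    unfolding rk_def using assms(1) B t alg_ind_insert by (intro Max_ge) auto
  then show ?thesis using B t finite_subset[OF B(1) assms(1)] by simp
qed

lemma rk_alg_ind:
  assumes "finite I" "finite T" "alg_ind T f I"
  shows "rk T + card I \<le> rk (T \<union> f ` I)"
  using assms(1,3)
proof (induction I rule: finite_induct)
  case (insert i I)
  have "f i \<notin> acl (T \<union> f ` I)"
    using insert.prems insert.hyps by (auto simp: alg_ind_def)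
  then have "rk (T \<union> f ` I) + 1 \<le> rk (insert (f i) (T \<union> f ` I))"
    using assms(2) insert.hyps by (intro rk_insert) auto
  moreover have "rk T + card I \<le> rk (T \<union> f ` I)"
    using insert.IH alg_ind_subset[OF insert.prems] by blast
  ultimately show ?case using insert.hyps by simp
qed simp

subsection \<open>Polynomial functions\<close>

text \<open>Polynomials are treated as functions; formal polynomials in several variables occur only
  where genericity is translated.\<close>

inductive_set poly_fun :: "real set \<Rightarrow> 'i set \<Rightarrow> (('i \<Rightarrow> real) \<Rightarrow> real) set" for S I where
  poly_fun_const: "c \<in> rat_ring S \<Longrightarrow> (\<lambda>x. c) \<in> poly_fun S I"
| poly_fun_var: "i \<in> I \<Longrightarrow> (\<lambda>x. x i) \<in> poly_fun S I"
| poly_fun_add: "F \<in> poly_fun S I \<Longrightarrow> G \<in> poly_fun S I \<Longrightarrow> (\<lambda>x. F x + G x) \<in> poly_fun S I"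
| poly_fun_mult: "F \<in> poly_fun S I \<Longrightarrow> G \<in> poly_fun S I \<Longrightarrow> (\<lambda>x. F x * G x) \<in> poly_fun S I"

lemma poly_fun_diff:
  assumes "F \<in> poly_fun S I" "G \<in> poly_fun S I"
  shows "(\<lambda>x. F x - G x) \<in> poly_fun S I"
  using poly_fun_add[OF assms(1) poly_fun_mult[OF poly_fun_const[OF rat_ring_uminus[OF rat_ring_1]] assms(2)]]
  by simp

lemma poly_fun_sum:
  "(\<And>j. j \<in> J \<Longrightarrow> F j \<in> poly_fun S I) \<Longrightarrow> (\<lambda>x. \<Sum>j\<in>J. F j x) \<in> poly_fun S I"
  by (induction J rule: infinite_finite_induct) (auto intro: poly_fun.intros)

lemma poly_fun_prod:
  "(\<And>j. j \<in> J \<Longrightarrow> F j \<in> poly_fun S I) \<Longrightarrow> (\<lambda>x. \<Prod>j\<in>J. F j x) \<in> poly_fun S I"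
  by (induction J rule: infinite_finite_induct) (auto intro: poly_fun.intros)

lemma poly_fun_power: "F \<in> poly_fun S I \<Longrightarrow> (\<lambda>x. F x ^ n) \<in> poly_fun S I"
  by (induction n) (auto intro: poly_fun.intros)

lemma poly_fun_mono:
  assumes "F \<in> poly_fun S I" "rat_ring S \<subseteq> rat_ring S'" "I \<subseteq> I'"
  shows "F \<in> poly_fun S' I'"
  using assms by (induction rule: poly_fun.induct) (auto intro: poly_fun.intros)

lemma poly_fun_cong: "F \<in> poly_fun S I \<Longrightarrow> (\<And>i. i \<in> I \<Longrightarrow> x i = y i) \<Longrightarrow> F x = F y"
  by (induction rule: poly_fun.induct) auto

lemma poly_fun_shift:
  assumes "F \<in> poly_fun S I" "\<And>i. i \<in> I \<Longrightarrow> c i \<in> rat_ring S"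
  shows "(\<lambda>x. F (\<lambda>i. x i + c i)) \<in> poly_fun S I"
  using assms
proof (induction rule: poly_fun.induct)
  case (poly_fun_var i)
  then show ?case by (intro poly_fun_add poly_fun.poly_fun_var poly_fun_const) auto
qed (auto intro: poly_fun.intros)

lemma poly_fun_value:
  assumes "F \<in> poly_fun S I" "\<And>i. i \<in> I \<Longrightarrow> x i \<in> rat_ring S"
  shows "F x \<in> rat_ring S"
  using assms by (induction rule: poly_fun.induct) (auto intro: rat_ring.intros)

lemma poly_fun_univariate:
  assumes "F \<in> poly_fun S I"
  shows "\<exists>Q. poly_over (rat_ring (S \<union> x ` (I - {i}))) Q \<and> (\<forall>t. F (x(i := t)) = poly Q t)"
  using assms
proof induction
  case (poly_fun_const c)
  let ?S = "S \<union> x ` (I - {i})"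
  have "c \<in> rat_ring ?S" using poly_fun_const rat_ring_mono[of S ?S] by blast
  then show ?case by (intro exI[of _ "[:c:]"] conjI poly_over_pCons) auto
next
  case (poly_fun_var k)
  let ?S = "S \<union> x ` (I - {i})"
  show ?case
  proof (cases "k = i")
    case True
    then show ?thesis by (intro exI[of _ "[:0, 1:]"] conjI poly_over_pCons) auto
  next
    case False
    with poly_fun_var have "x k \<in> rat_ring ?S" by (intro rat_ring_base) auto
    then show ?thesis using False by (intro exI[of _ "[:x k:]"] conjI poly_over_pCons) auto
  qed
next
  case (poly_fun_add F G)
  then show ?case by (metis poly_add poly_over_add)
next
  case (poly_fun_mult F G)
  then show ?case by (metis poly_mult poly_over_mult)
qed

text \<open>Coordinates are made rational one at a time: the univariate restriction is nonzero at
  the current value, so it has finitely many roots and some rational avoids them.\<close>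

lemma poly_fun_nonzero_rat:
  assumes "F \<in> poly_fun S I" "finite I" "F x \<noteq> 0"
  obtains y where "\<And>i. y i \<in> \<rat>" "F y \<noteq> 0"
proof -
  have "\<exists>y. (\<forall>i\<in>J. y i \<in> \<rat>) \<and> F y \<noteq> 0" if "finite J" for J
    using that
  proof (induction J rule: finite_induct)
    case empty
    then show ?case using assms(3) by blast
  next
    case (insert j J)
    then obtain y where y: "\<forall>i\<in>J. y i \<in> \<rat>" "F y \<noteq> 0" by blast
    obtain Q where Q: "\<And>t. F (y(j := t)) = poly Q t"
      using poly_fun_univariate[OF assms(1), of y j] by blast
    have "poly Q (y j) \<noteq> 0" using Q[of "y j"] y(2) by simp
    then have "Q \<noteq> 0" by auto
    then have "finite {t. poly Q t = 0}" by (rule poly_roots_finite)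
    moreover have "infinite (\<rat> :: real set)" by (rule Rats_infinite)
    ultimately obtain t where "t \<in> \<rat>" "poly Q t \<noteq> 0"
      by (metis (mono_tags, lifting) finite_subset mem_Collect_eq subsetI)
    then show ?case using y(1) Q[of t] insert.hyps
      by (intro exI[of _ "y(j := t)"]) (auto simp del: fun_upd_apply simp: fun_upd_def)
  qed
  from this[OF assms(2)] obtain y where y: "\<forall>i\<in>I. y i \<in> \<rat>" "F y \<noteq> 0" by blast
  have "F (\<lambda>i. if i \<in> I then y i else 0) = F y" by (intro poly_fun_cong[OF assms(1)]) auto
  then show thesis using y by (intro that[of "\<lambda>i. if i \<in> I then y i else 0"]) auto
qed

text \<open>Coordinates are exchanged one at a time. At each stage \<open>x j\<close> is a root of a
  univariate polynomial over \<open>acl L\<close> and the other coordinates, old or exchanged; being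
  transcendental over these, it forces that polynomial to be zero.\<close>

lemma poly_fun_specialize:
  assumes F: "F \<in> poly_fun (acl L) I" and I: "finite I" "alg_ind L x I" and "F x = 0"
    and y: "\<And>i. i \<in> I \<Longrightarrow> y i \<in> acl L"
  shows "F y = 0"
proof -
  have "F (\<lambda>i. if i \<in> J then y i else x i) = 0" if "finite J" "J \<subseteq> I" for J
    using that
  proof (induction J rule: finite_induct)
    case empty
    then show ?case using assms(4) by simp
  next
    case (insert j J)
    let ?z = "\<lambda>i. if i \<in> J then y i else x i"
    obtain Q where Q: "poly_over (rat_ring (acl L \<union> ?z ` (I - {j}))) Q" "\<And>t. F (?z(j := t)) = poly Q t"
      using poly_fun_univariate[OF F] by blast
    have z: "F ?z = 0" "?z(j := x j) = ?z" using insert by auto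
    then have root: "poly Q (x j) = 0" using Q(2)[of "x j"] by simp
    have "Q = 0"
    proof (rule ccontr)
      assume "Q \<noteq> 0"
      with Q root have "x j \<in> acl (acl L \<union> ?z ` (I - {j}))" unfolding acl_def by blast
      moreover have "acl L \<union> ?z ` (I - {j}) \<subseteq> acl (L \<union> x ` (I - {j}))"
        using y acl_mono[of L "L \<union> x ` (I - {j})"] subset_acl[of "L \<union> x ` (I - {j})"] by auto
      ultimately have "x j \<in> acl (L \<union> x ` (I - {j}))" using acl_subset by blast
      then show False using I(2) insert.prems by (auto simp: alg_ind_def)
    qed
    then have "F (?z(j := y j)) = 0" using Q(2) by simp
    moreover have "?z(j := y j) = (\<lambda>i. if i \<in> insert j J then y i else x i)" by auto
    ultimately show ?case by simp
  qed
  from this[OF I(1) order.refl] show ?thesis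
    using poly_fun_cong[OF F, of y "\<lambda>i. if i \<in> I then y i else x i"] by simp
qed

lemma rat_ring_poly_fun:
  assumes "r \<in> rat_ring (S \<union> x ` I)"
  obtains F where "F \<in> poly_fun S I" "F x = r"
proof -
  from assms have "\<exists>F\<in>poly_fun S I. F x = r"
  proof induction
    case (rat_ring_rat q)
    then show ?case by (intro bexI[of _ "\<lambda>_. of_rat q"]) (auto intro: poly_fun.intros rat_ring.intros)
  next
    case (rat_ring_base s)
    then show ?case
    proof
      assume "s \<in> S"
      then show ?thesis by (intro bexI[of _ "\<lambda>_. s"]) (auto intro: poly_fun.intros rat_ring.intros)
    next
      assume "s \<in> x ` I"
      then obtain i where "i \<in> I" "s = x i" by blast
      then show ?thesis by (intro bexI[of _ "\<lambda>x. x i"]) (auto intro: poly_fun.intros)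
    qed
  next
    case (rat_ring_add a b)
    then obtain F G where "F \<in> poly_fun S I" "F x = a" "G \<in> poly_fun S I" "G x = b" by blast
    then show ?case by (intro bexI[of _ "\<lambda>x. F x + G x"]) (auto intro: poly_fun.intros)
  next
    case (rat_ring_mult a b)
    then obtain F G where "F \<in> poly_fun S I" "F x = a" "G \<in> poly_fun S I" "G x = b" by blast
    then show ?case by (intro bexI[of _ "\<lambda>x. F x * G x"]) (auto intro: poly_fun.intros)
  qed
  then show thesis using that by blast
qed

subsection \<open>Generic points\<close>

definition monom_eval :: "('i \<Rightarrow> real) \<Rightarrow> ('i \<Rightarrow>\<^sub>0 nat) \<Rightarrow> real" where
  "monom_eval x m = (\<Prod>i\<in>Poly_Mapping.keys m. x i ^ Poly_Mapping.lookup m i)"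

lemma mpoly_eval_monom_eval:
  "mpoly_eval x f = (\<Sum>m\<in>Poly_Mapping.keys f. of_rat (Poly_Mapping.lookup f m) * monom_eval x m)"
  by (simp add: mpoly_eval_def monom_eval_def)

lemma monom_eval_superset:
  assumes "finite A" "Poly_Mapping.keys m \<subseteq> A"
  shows "monom_eval x m = (\<Prod>i\<in>A. x i ^ Poly_Mapping.lookup m i)"
  unfolding monom_eval_def using assms
  by (intro prod.mono_neutral_left) (auto simp: in_keys_iff)

lemma monom_eval_add: "monom_eval x (m + n) = monom_eval x m * monom_eval x n"
proof -
  let ?A = "Poly_Mapping.keys m \<union> Poly_Mapping.keys n"
  have "Poly_Mapping.keys (m + n) \<subseteq> ?A" by (rule Poly_Mapping.keys_add)
  then show ?thesis
    by (simp add: monom_eval_superset[of ?A] lookup_add power_add prod.distrib)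
qed

lemma mpoly_eval_add: "mpoly_eval x (f + g) = mpoly_eval x f + mpoly_eval x g"
  unfolding mpoly_eval_monom_eval
  by (rule setsum_keys_plus_distrib) (auto simp: of_rat_add distrib_right)

lemma mpoly_eval_single: "mpoly_eval x (Poly_Mapping.single m c) = of_rat c * monom_eval x m"
  by (simp add: mpoly_eval_monom_eval)

lemma mpoly_eval_zero [simp]: "mpoly_eval x 0 = 0"
  by (simp add: mpoly_eval_def)

lemma mpoly_eval_sum: "mpoly_eval x (sum f A) = (\<Sum>a\<in>A. mpoly_eval x (f a))"
  by (induction A rule: infinite_finite_induct) (auto simp: mpoly_eval_add)

lemma poly_mapping_sum_single:
  "f = (\<Sum>m\<in>Poly_Mapping.keys f. Poly_Mapping.single m (Poly_Mapping.lookup f m))"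
  by (rule poly_mapping_eqI) (auto simp: lookup_sum lookup_single when_def in_keys_iff)

lemma mpoly_eval_mult:
  fixes f g :: "('i \<Rightarrow>\<^sub>0 nat) \<Rightarrow>\<^sub>0 rat"
  shows "mpoly_eval x (f * g) = mpoly_eval x f * mpoly_eval x g"
proof -
  let ?s = "\<lambda>f m. Poly_Mapping.single m (Poly_Mapping.lookup f m)"
  have "f * g = (\<Sum>m\<in>Poly_Mapping.keys f. ?s f m) * (\<Sum>n\<in>Poly_Mapping.keys g. ?s g n)"
    by (simp flip: poly_mapping_sum_single)
  also have "\<dots> = (\<Sum>m\<in>Poly_Mapping.keys f. \<Sum>n\<in>Poly_Mapping.keys g.
      Poly_Mapping.single (m + n) (Poly_Mapping.lookup f m * Poly_Mapping.lookup g n))"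
    by (simp add: sum_product mult_single)
  finally show ?thesis
    by (simp add: mpoly_eval_sum mpoly_eval_single)
      (simp add: mpoly_eval_monom_eval sum_product monom_eval_add of_rat_mult mult_ac)
qed

lemma poly_fun_mpoly:
  fixes F :: "('i \<Rightarrow> real) \<Rightarrow> real"
  assumes "F \<in> poly_fun {} I"
  obtains f :: "('i \<Rightarrow>\<^sub>0 nat) \<Rightarrow>\<^sub>0 rat"
  where "\<And>m. m \<in> Poly_Mapping.keys f \<Longrightarrow> Poly_Mapping.keys m \<subseteq> I" "\<And>x. mpoly_eval x f = F x"
proof -
  from assms have "\<exists>f :: ('i \<Rightarrow>\<^sub>0 nat) \<Rightarrow>\<^sub>0 rat. (\<forall>m\<in>Poly_Mapping.keys f. Poly_Mapping.keys m \<subseteq> I) \<and>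
      (\<forall>x. mpoly_eval x f = F x)"
  proof induction
    case (poly_fun_const c)
    have "c \<in> \<rat>" using poly_fun_const by induction auto
    then obtain q where "c = of_rat q" by (rule Rats_cases)
    then show ?case
      by (intro exI[of _ "Poly_Mapping.single 0 q"]) (auto simp: mpoly_eval_single monom_eval_def)
  next
    case (poly_fun_var i)
    then show ?case
      by (intro exI[of _ "Poly_Mapping.single (Poly_Mapping.single i 1) 1"])
        (auto simp: mpoly_eval_single monom_eval_def)
  next
    case (poly_fun_add F G)
    then obtain f g :: "('i \<Rightarrow>\<^sub>0 nat) \<Rightarrow>\<^sub>0 rat" where
      "\<forall>m\<in>Poly_Mapping.keys f. Poly_Mapping.keys m \<subseteq> I" "\<forall>x. mpoly_eval x f = F x"
      "\<forall>m\<in>Poly_Mapping.keys g. Poly_Mapping.keys m \<subseteq> I" "\<forall>x. mpoly_eval x g = G x" by blast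
    then show ?case using Poly_Mapping.keys_add[of f g]
      by (intro exI[of _ "f + g"] conjI ballI) (blast, simp add: mpoly_eval_add)
  next
    case (poly_fun_mult F G)
    then obtain f g :: "('i \<Rightarrow>\<^sub>0 nat) \<Rightarrow>\<^sub>0 rat" where fg:
      "\<forall>m\<in>Poly_Mapping.keys f. Poly_Mapping.keys m \<subseteq> I" "\<forall>x. mpoly_eval x f = F x"
      "\<forall>m\<in>Poly_Mapping.keys g. Poly_Mapping.keys m \<subseteq> I" "\<forall>x. mpoly_eval x g = G x" by blast
    have "\<forall>m\<in>Poly_Mapping.keys (f * g). Poly_Mapping.keys m \<subseteq> I"
    proof
      fix m assume "m \<in> Poly_Mapping.keys (f * g)"
      then obtain a b where "m = a + b" "a \<in> Poly_Mapping.keys f" "b \<in> Poly_Mapping.keys g"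
        using Poly_Mapping.keys_mult[of f g] by blast
      then show "Poly_Mapping.keys m \<subseteq> I" using fg(1,3) Poly_Mapping.keys_add[of a b] by blast
    qed
    with fg show ?case by (intro exI[of _ "f * g"]) (auto simp: mpoly_eval_mult)
  qed
  then show thesis using that by blast
qed

lemma alg_independent_poly_fun:
  assumes "alg_independent_over_rat I x" "F \<in> poly_fun {} I" "F x = 0"
  shows "F y = 0"
proof -
  obtain f where "\<And>m. m \<in> Poly_Mapping.keys f \<Longrightarrow> Poly_Mapping.keys m \<subseteq> I" "\<And>x. mpoly_eval x f = F x"
    using poly_fun_mpoly[OF assms(2)] by blast
  with assms show ?thesis unfolding alg_independent_over_rat_def by (metis mpoly_eval_zero)
qed

lemma alg_independent_alg_ind:
  assumes "alg_independent_over_rat I x"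
  shows "alg_ind {} x I"
  unfolding alg_ind_def
proof (intro ballI notI)
  fix i assume i: "i \<in> I" "x i \<in> acl ({} \<union> x ` (I - {i}))"
  then obtain P where P: "P \<noteq> 0" "poly_over (rat_ring ({} \<union> x ` (I - {i}))) P" "poly P (x i) = 0"
    unfolding acl_def by blast
  have "\<exists>F\<in>poly_fun {} (I - {i}). F x = coeff P k" for k
    using P(2) rat_ring_poly_fun unfolding poly_over_def by metis
  then obtain F where F: "\<And>k. F k \<in> poly_fun {} (I - {i})" "\<And>k. F k x = coeff P k" by metis
  define G where "G y = (\<Sum>k\<le>degree P. F k y * y i ^ k)" for y
  have "G \<in> poly_fun {} I"
    unfolding G_def using i(1)
    by (intro poly_fun_sum poly_fun_mult poly_fun_power poly_fun_var poly_fun_mono[OF F(1)]) auto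
  moreover have "G x = 0" using P(3) by (simp add: G_def F(2) poly_altdef)
  ultimately have "G (x(i := t)) = 0" for t
    using alg_independent_poly_fun[OF assms] by blast
  moreover have "F k (x(i := t)) = coeff P k" for k t
    using poly_fun_cong[OF F(1), of "x(i := t)" x k] F(2) by auto
  ultimately have "poly P t = 0" for t by (simp add: G_def poly_altdef)
  then show False using P(1) poly_all_0_iff_0 by blast
qed

text \<open>Expanding a nonzero \<open>f\<close> in powers of the new variable \<open>i\<close>
  gives coefficients \<open>g k\<close> in the old variables. The induction hypothesis keeps one of
  their values nonzero, so a vanishing \<open>f\<close> would make \<open>x i\<close> algebraic over
  the others.\<close>

lemma alg_ind_alg_independent:
  fixes x :: "'i \<Rightarrow> real"
  assumes "finite I" "alg_ind {} x I"
  shows "alg_independent_over_rat I x"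
  using assms
proof (induction I rule: finite_induct)
  case empty
  show ?case unfolding alg_independent_over_rat_def
  proof (intro allI impI)
    fix f :: "('i \<Rightarrow>\<^sub>0 nat) \<Rightarrow>\<^sub>0 rat"
    assume keys: "\<forall>m\<in>Poly_Mapping.keys f. Poly_Mapping.keys m \<subseteq> {}" and ev: "mpoly_eval x f = 0"
    then have sub: "Poly_Mapping.keys f \<subseteq> {0}" by auto
    then have "mpoly_eval x f = of_rat (Poly_Mapping.lookup f 0)"
      unfolding mpoly_eval_monom_eval
      by (subst sum.mono_neutral_left[of "{0}"]) (auto simp: in_keys_iff monom_eval_def)
    with ev have "Poly_Mapping.lookup f 0 = 0" by simp
    with sub show "f = 0" by (metis in_keys_iff keys_eq_empty subset_singletonD singletonI)
  qed
next
  case (insert i I)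
  have IH: "alg_independent_over_rat I x"
    using insert.IH alg_ind_subset[OF insert.prems] by blast
  have xi: "x i \<notin> acl (x ` I)"
    using insert.prems insert.hyps by (simp add: alg_ind_def)
  show ?case unfolding alg_independent_over_rat_def
  proof (intro allI impI, rule ccontr)
    fix f :: "('i \<Rightarrow>\<^sub>0 nat) \<Rightarrow>\<^sub>0 rat"
    assume keys: "\<forall>m\<in>Poly_Mapping.keys f. Poly_Mapping.keys m \<subseteq> insert i I"
      and ev: "mpoly_eval x f = 0" and "f \<noteq> 0"
    let ?K = "Poly_Mapping.keys f"
    define red where "red m = Poly_Mapping.update i 0 m" for m :: "'i \<Rightarrow>\<^sub>0 nat"
    define g where "g k = (\<Sum>m\<in>{m\<in>?K. Poly_Mapping.lookup m i = k}.
        Poly_Mapping.single (red m) (Poly_Mapping.lookup f m))" for k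
    have keys_red: "Poly_Mapping.keys (red m) = Poly_Mapping.keys m - {i}" for m
      by (simp add: red_def keys_update)
    \<comment> \<open>Monomials with equal exponent of \<open>i\<close> stay distinct when
      \<open>i\<close> is dropped, so nothing cancels inside \<open>g k\<close>.\<close>
    have red_inj: "m = n" if "red m = red n" "Poly_Mapping.lookup m i = Poly_Mapping.lookup n i" for m n
    proof (rule poly_mapping_eqI)
      fix k
      have "Poly_Mapping.lookup (red m) k = Poly_Mapping.lookup (red n) k" using that(1) by simp
      then show "Poly_Mapping.lookup m k = Poly_Mapping.lookup n k"
        using that(2) by (cases "k = i") (auto simp: red_def lookup_update)
    qed
    have eval_red: "monom_eval x m = monom_eval x (red m) * x i ^ Poly_Mapping.lookup m i" for m
    proof -
      have "monom_eval x (red m) = (\<Prod>j\<in>Poly_Mapping.keys m - {i}. x j ^ Poly_Mapping.lookup m j)"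
        unfolding monom_eval_def keys_red by (intro prod.cong) (auto simp: red_def lookup_update)
      moreover have "monom_eval x m = (\<Prod>j\<in>insert i (Poly_Mapping.keys m - {i}). x j ^ Poly_Mapping.lookup m j)"
        by (intro monom_eval_superset) auto
      ultimately show ?thesis by (simp add: prod.insert_remove mult.commute)
    qed
    have g_keys: "\<forall>n\<in>Poly_Mapping.keys (g k). Poly_Mapping.keys n \<subseteq> I" for k
    proof
      fix n assume "n \<in> Poly_Mapping.keys (g k)"
      then obtain m where "m \<in> ?K" "n \<in> Poly_Mapping.keys (Poly_Mapping.single (red m) (Poly_Mapping.lookup f m))"
        using keys_sum[of "\<lambda>m. Poly_Mapping.single (red m) (Poly_Mapping.lookup f m)"
            "{m\<in>?K. Poly_Mapping.lookup m i = k}"] unfolding g_def by blast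
      then have "n = red m" by (auto split: if_splits)
      with keys \<open>m \<in> ?K\<close> show "Poly_Mapping.keys n \<subseteq> I" by (auto simp: keys_red)
    qed
    have g_lookup: "Poly_Mapping.lookup (g (Poly_Mapping.lookup m i)) (red m) = Poly_Mapping.lookup f m"
      if "m \<in> ?K" for m
    proof -
      have "Poly_Mapping.lookup (g (Poly_Mapping.lookup m i)) (red m) =
          (\<Sum>n\<in>{n\<in>?K. Poly_Mapping.lookup n i = Poly_Mapping.lookup m i}. if n = m then Poly_Mapping.lookup f n else 0)"
        unfolding g_def lookup_sum by (intro sum.cong refl) (auto simp: lookup_single when_def dest: red_inj)
      also have "\<dots> = Poly_Mapping.lookup f m" using that by (subst sum.delta) auto
      finally show ?thesis .
    qed
    define N where "N = Max ((\<lambda>m. Poly_Mapping.lookup m i) ` ?K)"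
    have N: "Poly_Mapping.lookup m i \<le> N" if "m \<in> ?K" for m
      unfolding N_def using that by (intro Max_ge) auto
    define P where "P = (\<Sum>k\<le>N. monom (mpoly_eval x (g k)) k)"
    have coeffP: "coeff P k = (if k \<le> N then mpoly_eval x (g k) else 0)" for k
      by (simp add: P_def coeff_sum)
    have "poly P (x i) = (\<Sum>k\<le>N. \<Sum>m\<in>{m\<in>?K. Poly_Mapping.lookup m i = k}.
        of_rat (Poly_Mapping.lookup f m) * monom_eval x m)"
      unfolding P_def poly_sum poly_monom g_def mpoly_eval_sum mpoly_eval_single sum_distrib_right
      by (intro sum.cong refl) (auto simp: eval_red[symmetric] mult.assoc)
    also have "\<dots> = mpoly_eval x f"
      unfolding mpoly_eval_monom_eval using N by (intro sum.group) auto
    finally have root: "poly P (x i) = 0" using ev by simp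
    obtain m where m: "m \<in> ?K" using \<open>f \<noteq> 0\<close> by (metis equals0I keys_eq_empty)
    have "g (Poly_Mapping.lookup m i) \<noteq> 0"
      using g_lookup[OF m] m by (auto simp: in_keys_iff)
    then have "mpoly_eval x (g (Poly_Mapping.lookup m i)) \<noteq> 0"
      using IH g_keys unfolding alg_independent_over_rat_def by blast
    then have "P \<noteq> 0" using coeffP[of "Poly_Mapping.lookup m i"] N[OF m] by auto
    moreover have "mpoly_eval x (g k) \<in> rat_ring (x ` I)" for k
      unfolding mpoly_eval_def
    proof (intro rat_ring_sum rat_ring_mult rat_ring_rat)
      fix n assume "n \<in> Poly_Mapping.keys (g k)"
      then have sub: "Poly_Mapping.keys n \<subseteq> I" using g_keys by blast
      have "(\<Prod>i\<in>J. x i ^ Poly_Mapping.lookup n i) \<in> rat_ring (x ` I)" if "J \<subseteq> I" for J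
        using that by (induction J rule: infinite_finite_induct)
          (auto intro!: rat_ring_mult rat_ring_power intro: rat_ring_base)
      then show "(\<Prod>i\<in>Poly_Mapping.keys n. x i ^ Poly_Mapping.lookup n i) \<in> rat_ring (x ` I)"
        using sub by blast
    qed
    then have "poly_over (rat_ring (x ` I)) P"
      unfolding P_def by (intro poly_over_sum poly_over_monom) auto
    ultimately have "x i \<in> acl (x ` I)" using root unfolding acl_def by blast
    with xi show False by blast
  qed
qed

section \<open>Existence of generic points by countability\<close>

lemma countable_rat_ring:
  assumes "countable S"
  shows "countable (rat_ring S)"
proof -
  define step where "step A = A \<union> (\<lambda>(a, b). a + b) ` (A \<times> A) \<union> (\<lambda>(a, b). a * b) ` (A \<times> A)"
    for A :: "real set"
  define lev where "lev n = (step ^^ n) (\<rat> \<union> S)" for n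
  have mono: "lev n \<subseteq> lev (n + k)" for n k
    by (induction k) (auto simp: lev_def step_def)
  have "countable (lev n)" for n
    using assms by (induction n) (auto simp: lev_def step_def countable_rat)
  then have "countable (\<Union>n. lev n)" by auto
  moreover have "rat_ring S \<subseteq> (\<Union>n. lev n)"
  proof
    fix x assume "x \<in> rat_ring S"
    then show "x \<in> (\<Union>n. lev n)"
    proof induction
      case (rat_ring_rat r)
      then show ?case by (intro UN_I[of 0]) (auto simp: lev_def)
    next
      case (rat_ring_base s)
      then show ?case by (intro UN_I[of 0]) (auto simp: lev_def)
    next
      case (rat_ring_add a b)
      then obtain m n where "a \<in> lev m" "b \<in> lev n" by blast
      then have "a \<in> lev (m + n)" "b \<in> lev (m + n)"
        using mono[of m n] mono[of n m] by (auto simp: add.commute)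
      then have "a + b \<in> lev (Suc (m + n))" by (force simp: lev_def step_def)
      then show ?case by blast
    next
      case (rat_ring_mult a b)
      then obtain m n where "a \<in> lev m" "b \<in> lev n" by blast
      then have "a \<in> lev (m + n)" "b \<in> lev (m + n)"
        using mono[of m n] mono[of n m] by (auto simp: add.commute)
      then have "a * b \<in> lev (Suc (m + n))" by (force simp: lev_def step_def)
      then show ?case by blast
    qed
  qed
  ultimately show ?thesis by (rule countable_subset[rotated])
qed

lemma countable_acl:
  assumes "countable S"
  shows "countable (acl S)"
proof -
  let ?polys = "Poly ` lists (rat_ring S)"
  have "countable ?polys" by (intro countable_image countable_lists countable_rat_ring assms)
  moreover have "acl S \<subseteq> (\<Union>P\<in>?polys - {0}. {x. poly P x = 0})"
  proof
    fix x assume "x \<in> acl S"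
    then obtain P where P: "P \<noteq> 0" "poly_over (rat_ring S) P" "poly P x = 0"
      unfolding acl_def by blast
    have "coeffs P \<in> lists (rat_ring S)"
      using P(2) by (auto simp: poly_over_def coeffs_def)
    then have "P \<in> ?polys" by (intro image_eqI[of _ _ "coeffs P"]) auto
    with P show "x \<in> (\<Union>P\<in>?polys - {0}. {x. poly P x = 0})" by blast
  qed
  moreover have "countable (\<Union>P\<in>?polys - {0}. {x. poly P x = 0})"
    using \<open>countable ?polys\<close> by (intro countable_UN) (auto intro!: countable_finite poly_roots_finite)
  ultimately show ?thesis using countable_subset by blast
qed

lemma exists_alg_ind:
  assumes "finite I"
  shows "\<exists>x :: 'i \<Rightarrow> real. alg_ind {} x I"
  using assms
proof (induction I rule: finite_induct)
  case empty
  then show ?case by (simp add: alg_ind_def)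
next
  case (insert i I)
  then obtain x where x: "alg_ind {} x I" by blast
  have "countable (acl (x ` I))" using insert.hyps by (intro countable_acl) (simp add: countable_finite)
  then obtain t where t: "t \<notin> acl (x ` I)"
    using uncountable_UNIV_real by (metis UNIV_eq_I)
  define y where "y = x(i := t)"
  have yI: "y ` J = x ` J" if "J \<subseteq> I" for J
    using that insert.hyps unfolding y_def by (intro image_cong) auto
  have "alg_ind {} y (insert i I)"
    unfolding alg_ind_def
  proof
    fix j assume j: "j \<in> insert i I"
    show "y j \<notin> acl ({} \<union> y ` (insert i I - {j}))"
    proof (cases "j = i")
      case True
      then show ?thesis using t yI[of I] insert.hyps by (simp add: y_def)
    next
      case False
      \<comment> \<open>If an old coordinate depended on \<open>t\<close> and the other old ones,
        exchange would make \<open>t\<close> algebraic over the old coordinates.\<close>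
      then have eq: "insert i I - {j} = insert i (I - {j})" by blast
      have "y ` (insert i I - {j}) = insert t (x ` (I - {j}))"
        unfolding eq image_insert by (subst yI) (auto simp: y_def)
      moreover have "x j \<notin> acl (x ` (I - {j}))" using x j False by (auto simp: alg_ind_def)
      moreover have "insert (x j) (x ` (I - {j})) = x ` I" using j False by blast
      ultimately show ?thesis
        using acl_exchange[of "x j" t "x ` (I - {j})"] t False by (auto simp: y_def)
    qed
  qed
  then show ?case by blast
qed

lemma exists_generic_framework:
  assumes "finite (pverts G)"
  shows "\<exists>p :: 'v \<Rightarrow> real ^ 'd. generic_framework G p"
proof -
  obtain x :: "'v \<times> 'd \<Rightarrow> real" where "alg_ind {} x (pverts G \<times> UNIV)"
    using exists_alg_ind[of "pverts G \<times> (UNIV :: 'd set)"] assms by auto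
  then have "alg_independent_over_rat (pverts G \<times> UNIV) x"
    using assms by (intro alg_ind_alg_independent) auto
  moreover have "(\<lambda>(v, i). (\<chi> i. x (v, i)) $ i) = x" by auto
  ultimately show ?thesis unfolding generic_framework_def
    by (intro exI[of _ "\<lambda>v. \<chi> i. x (v, i)"]) (simp only:)
qed

subsection \<open>Distances from a generic point to a frame\<close>

lemma acl_det:
  fixes A :: "real ^ 'n ^ 'n"
  assumes "\<And>i j. A $ i $ j \<in> acl S"
  shows "det A \<in> acl S"
  unfolding det_def using assms
  by (intro acl_sum acl_mult acl_prod acl_Rats[OF Rats_of_int]) auto

lemma acl_solve:
  fixes A :: "real ^ 'n ^ 'n"
  assumes "det A \<noteq> 0" "\<And>i j. A $ i $ j \<in> acl S" "\<And>i. (A *v x) $ i \<in> acl S"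
  shows "x $ k \<in> acl S"
proof -
  have "x = (\<chi> k. det (\<chi> i j. if j = k then (A *v x) $ i else A $ i $ j) / det A)"
    using cramer[OF assms(1), of x "A *v x"] by simp
  from arg_cong[OF this, of "\<lambda>y. y $ k"]
  have "x $ k = det (\<chi> i j. if j = k then (A *v x) $ i else A $ i $ j) / det A"
    by (simp only: vec_lambda_beta)
  also have "\<dots> \<in> acl S"
    using assms(2,3) by (intro acl_divide acl_det) auto
  finally show ?thesis .
qed

lemma acl_inner:
  "(\<And>i. x $ i \<in> acl S) \<Longrightarrow> (\<And>i. y $ i \<in> acl S) \<Longrightarrow> x \<bullet> y \<in> acl S"
  for x y :: "real ^ 'n"
  unfolding inner_vec_def by (auto intro!: acl_sum acl_mult)

lemma acl_matrix_vector_mult: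
  fixes A :: "real ^ 'n ^ 'm"
  shows "(\<And>i j. A $ i $ j \<in> acl S) \<Longrightarrow> (\<And>i. x $ i \<in> acl S) \<Longrightarrow> (A *v x) $ i \<in> acl S"
  unfolding matrix_vector_mult_def by (auto intro!: acl_sum acl_mult)

lemma matrix_inv_right:
  fixes A :: "'a::semiring_1 ^ 'n ^ 'm"
  assumes "invertible A"
  shows "A ** matrix_inv A = mat 1"
  using assms someI_ex[of "\<lambda>A'. A ** A' = mat 1 \<and> A' ** A = mat 1"]
  unfolding invertible_def matrix_inv_def by blast

lemma acl_matrix_inv:
  fixes A :: "real ^ 'n ^ 'n"
  assumes "det A \<noteq> 0" "\<And>i j. A $ i $ j \<in> acl S"
  shows "matrix_inv A $ i $ j \<in> acl S"
proof -
  have "A ** matrix_inv A = mat 1"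
    using assms(1) matrix_inv_right invertible_det_nz by blast
  then have "A *v (matrix_inv A *v axis j 1) = axis j 1"
    by (simp add: matrix_vector_mul_assoc)
  then have "(A *v (matrix_inv A *v axis j 1)) $ k \<in> acl S" for k
    by (simp add: axis_def)
  from acl_solve[OF assms this] have "(matrix_inv A *v axis j 1) $ i \<in> acl S" .
  then show ?thesis by (simp add: matrix_vector_mult_basis column_def)
qed

section \<open>Frames, Gram matrices and quadrics\<close>

definition frame_matrix :: "real ^ 'd \<Rightarrow> ('d \<Rightarrow> real ^ 'd) \<Rightarrow> real ^ 'd ^ 'd" where
  "frame_matrix x0 X = (\<chi> i. X i - x0)"

text \<open>Built from inner products alone, so it depends only on the distances within the frame
  and can be compared between two frameworks.\<close>

definition gram_inv :: "real ^ 'd \<Rightarrow> ('d \<Rightarrow> real ^ 'd) \<Rightarrow> real ^ 'd ^ 'd" where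
  "gram_inv x0 X = matrix_inv (\<chi> i j. (X i - x0) \<bullet> (X j - x0))"

definition sqdists :: "real ^ 'd \<Rightarrow> ('d \<Rightarrow> real ^ 'd) \<Rightarrow> real ^ 'd" where
  "sqdists a X = (\<chi> i. (a - X i) \<bullet> (a - X i))"

definition quad :: "real ^ 'd ^ 'd \<Rightarrow> real ^ 'd \<Rightarrow> real ^ 'd \<Rightarrow> real" where
  "quad N g u = (u - g) \<bullet> (N *v (u - g))"

lemma frame_matrix_mult: "(frame_matrix x0 X *v z) $ i = (X i - x0) \<bullet> z"
  by (simp add: frame_matrix_def matrix_vector_mult_def inner_vec_def)

lemma gram_eq: "(\<chi> i j. (X i - x0) \<bullet> (X j - x0)) = frame_matrix x0 X ** transpose (frame_matrix x0 X)"
  by (simp add: frame_matrix_def matrix_matrix_mult_def transpose_def inner_vec_def vec_eq_iff)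

lemma det_gram: "det (\<chi> i j. (X i - x0) \<bullet> (X j - x0)) = (det (frame_matrix x0 X))\<^sup>2"
  unfolding gram_eq by (simp add: det_mul det_transpose power2_eq_square)

text \<open>Let Y be the frame matrix. The vector \<open>c\<close> below satisfies Y (Y^T c) = Y w,
  and Y is injective, so w = Y^T c; pairing this with \<open>z\<close> gives the identity.\<close>

lemma gram_inv_inner:
  assumes "det (frame_matrix x0 X) \<noteq> 0"
  shows "z \<bullet> w = (frame_matrix x0 X *v z) \<bullet> (gram_inv x0 X *v (frame_matrix x0 X *v w))"
proof -
  let ?Y = "frame_matrix x0 X"
  define c where "c = gram_inv x0 X *v (?Y *v w)"
  have "invertible (?Y ** transpose ?Y)"
    using assms by (simp add: invertible_det_nz det_mul det_transpose)
  then have "(?Y ** transpose ?Y) ** gram_inv x0 X = mat 1"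
    unfolding gram_inv_def gram_eq by (rule matrix_inv_right)
  then have "(?Y ** transpose ?Y) *v c = ?Y *v w"
    by (simp add: c_def matrix_vector_mul_assoc matrix_mul_assoc)
  then have "?Y *v (transpose ?Y *v c) = ?Y *v w"
    by (simp only: matrix_vector_mul_assoc)
  moreover have "inj ((*v) ?Y)" using assms
    by (simp add: inj_matrix_vector_mult invertible_det_nz)
  ultimately have "transpose ?Y *v c = w" by (metis injD)
  then have "z \<bullet> w = z \<bullet> (transpose ?Y *v c)" by simp
  also have "\<dots> = (?Y *v z) \<bullet> c"
    by (metis dot_lmul_matrix inner_commute transpose_matrix_vector)
  finally show ?thesis by (simp add: c_def)
qed

text \<open>The \<open>z i\<close> form the basis dual to the frame vectors. They give the symmetry
  of the inverse Gram matrix and its nonzero diagonal, which later is the leading coefficient of a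
  quadratic equation.\<close>

lemma gram_inv_dual:
  fixes x0 :: "real ^ 'd"
  assumes "det (frame_matrix x0 X) \<noteq> 0"
  obtains z :: "'d \<Rightarrow> real ^ 'd" where "\<And>i j. gram_inv x0 X $ i $ j = z i \<bullet> z j" "\<And>i. z i \<noteq> 0"
proof -
  let ?Y = "frame_matrix x0 X"
  have "?Y ** matrix_inv ?Y = mat 1"
    using assms matrix_inv_right invertible_det_nz by blast
  then have dual: "?Y *v (matrix_inv ?Y *v axis i 1) = axis i 1" for i
    by (simp add: matrix_vector_mul_assoc)
  show thesis
  proof (rule that[of "\<lambda>i. matrix_inv ?Y *v axis i 1"])
    show "gram_inv x0 X $ i $ j = (matrix_inv ?Y *v axis i 1) \<bullet> (matrix_inv ?Y *v axis j 1)" for i j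
      using gram_inv_inner[OF assms, of "matrix_inv ?Y *v axis i 1" "matrix_inv ?Y *v axis j 1"]
      unfolding dual by (simp add: matrix_vector_mult_basis column_def inner_axis')
    show "matrix_inv ?Y *v axis i 1 \<noteq> 0" for i
      using dual[of i] by (metis axis_eq_0_iff matrix_vector_mult_0_right zero_neq_one)
  qed
qed

lemma gram_inv_sym:
  assumes "det (frame_matrix x0 X) \<noteq> 0"
  shows "gram_inv x0 X $ i $ j = gram_inv x0 X $ j $ i"
  using gram_inv_dual[OF assms] by (metis inner_commute)

lemma det_gram_inv:
  assumes "det (frame_matrix x0 X) \<noteq> 0"
  shows "det (gram_inv x0 X) \<noteq> 0"
proof -
  let ?M = "\<chi> i j. (X i - x0) \<bullet> (X j - x0)"
  have "?M ** gram_inv x0 X = mat 1"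
    unfolding gram_inv_def using assms det_gram[of X x0]
    by (intro matrix_inv_right) (simp add: invertible_det_nz)
  then have "det ?M * det (gram_inv x0 X) = 1" by (metis det_mul det_I)
  then show ?thesis by auto
qed

text \<open>The squared distances from a point to the \<open>d + 1\<close> points of a frame lie on a quadric whose
  coefficients are determined by the squared distances within the frame.\<close>

lemma sqdist_quad:
  assumes "det (frame_matrix x0 X) \<noteq> 0"
  shows "4 * ((a - x0) \<bullet> (a - x0)) =
    quad (gram_inv x0 X) (sqdists x0 X) (sqdists a X - (\<chi> i. (a - x0) \<bullet> (a - x0)))"
proof -
  let ?u = "sqdists a X - (\<chi> i. (a - x0) \<bullet> (a - x0)) - sqdists x0 X"
  have "?u = (-2) *\<^sub>R (frame_matrix x0 X *v (a - x0))"
    by (simp add: vec_eq_iff frame_matrix_mult sqdists_def algebra_simps inner_commute)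
  then show ?thesis
    unfolding quad_def using gram_inv_inner[OF assms, of "a - x0" "a - x0"]
    by (simp only: matrix_vector_mult_scaleR inner_scaleR_left inner_scaleR_right)
qed

lemma axis_bilinear: "axis i 1 \<bullet> (N *v axis j 1) = N $ i $ j"
  for N :: "real ^ 'd ^ 'd"
  by (simp add: matrix_vector_mult_basis column_def inner_axis')

lemma sym_bilinear:
  fixes N :: "real ^ 'd ^ 'd"
  assumes "\<And>i j. N $ i $ j = N $ j $ i"
  shows "x \<bullet> (N *v y) = y \<bullet> (N *v x)"
proof -
  have "transpose N = N" using assms by (simp add: transpose_def vec_eq_iff)
  then show ?thesis by (metis dot_lmul_matrix inner_commute transpose_matrix_vector)
qed

text \<open>Finite differences recover a quadric from its values: mixed second differences give the
  matrix, and first differences then give the centre if the matrix is invertible.\<close>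

lemma quad_mixed_difference:
  fixes N :: "real ^ 'd ^ 'd"
  assumes "\<And>i j. N $ i $ j = N $ j $ i"
  shows "quad N g (u + axis i 1 + axis j 1) - quad N g (u + axis i 1) - quad N g (u + axis j 1) + quad N g u
    = 2 * N $ i $ j"
proof -
  have 1: "u + axis i 1 + axis j 1 - g = (u - g) + axis i 1 + axis j 1"
    "u + axis i 1 - g = (u - g) + axis i 1" "u + axis j 1 - g = (u - g) + axis j 1"
    by simp_all
  show ?thesis
    unfolding quad_def 1
    by (simp add: matrix_vector_right_distrib inner_add_left inner_add_right axis_bilinear assms[of j i])
qed

lemma quad_difference:
  fixes N :: "real ^ 'd ^ 'd"
  assumes "\<And>i j. N $ i $ j = N $ j $ i"
  shows "quad N g (u + axis i 1) - quad N g u = N $ i $ i + 2 * (N *v (u - g)) $ i"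
proof -
  have 1: "u + axis i 1 - g = (u - g) + axis i 1" by simp
  have "(u - g) \<bullet> (N *v axis i 1) = axis i 1 \<bullet> (N *v (u - g))"
    by (rule sym_bilinear[OF assms])
  also have "\<dots> = (N *v (u - g)) $ i" by (simp add: inner_axis')
  finally show ?thesis
    unfolding quad_def 1 using sym_bilinear[OF assms, of "u - g" "axis i 1"]
    by (simp add: matrix_vector_right_distrib inner_add_left inner_add_right axis_bilinear)
qed

lemma poly_fun_quad:
  fixes N :: "real ^ 'd ^ 'd"
  assumes "\<And>i j. N $ i $ j \<in> acl L" "\<And>i. g $ i \<in> acl L"
  shows "(\<lambda>y. quad N g (\<chi> i. y i)) \<in> poly_fun (acl L) UNIV"
  unfolding quad_def inner_vec_def matrix_vector_mult_def
  using assms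
  by (auto intro!: poly_fun_sum poly_fun_mult poly_fun_diff poly_fun_var poly_fun_const simp: rat_ring_acl)

section \<open>A generic point seen from an affinely independent frame\<close>

context
  fixes L :: "real set" and a x0 :: "real ^ 'd" and X :: "'d \<Rightarrow> real ^ 'd"
  assumes a_ind: "alg_ind L (\<lambda>i. a $ i) UNIV"
    and x0_acl: "\<And>i. x0 $ i \<in> acl L" and X_acl: "\<And>i j. X i $ j \<in> acl L"
    and frame: "det (frame_matrix x0 X) \<noteq> 0"
begin

lemma sqdists_frame_acl: "sqdists x0 X $ i \<in> acl L"
  unfolding sqdists_def using x0_acl X_acl by (auto intro!: acl_inner acl_diff)

lemma gram_inv_acl: "gram_inv x0 X $ i $ j \<in> acl L"
  unfolding gram_inv_def using x0_acl X_acl frame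
  by (intro acl_matrix_inv) (auto simp: det_gram intro!: acl_inner acl_diff)

lemma frame_products_ind: "alg_ind L (\<lambda>i. (X i - x0) \<bullet> (a - x0)) UNIV" (is "alg_ind L ?b UNIV")
proof (rule alg_ind_swap[OF a_ind])
  let ?T = "L \<union> range ?b"
  have L: "acl L \<subseteq> acl ?T" by (intro acl_mono) auto
  have "(a - x0) $ i \<in> acl ?T" for i
  proof (rule acl_solve[OF frame])
    show "frame_matrix x0 X $ i $ j \<in> acl ?T" for i j
      using L x0_acl X_acl by (auto simp: frame_matrix_def intro!: acl_diff)
    show "(frame_matrix x0 X *v (a - x0)) $ i \<in> acl ?T" for i
      unfolding frame_matrix_mult by (intro acl_base) auto
  qed
  then have "(a - x0) $ i + x0 $ i \<in> acl ?T" for i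
    using L x0_acl by (intro acl_add) auto
  then show "range (\<lambda>i. a $ i) \<subseteq> acl ?T" by auto
qed auto

text \<open>In a difference the quadratic term in \<open>a\<close> cancels, so the differences are
  affine in the inner products with the frame vectors.\<close>

lemma sqdist_differences_ind:
  "alg_ind L (\<lambda>i. (a - X i) \<bullet> (a - X i) - (a - x0) \<bullet> (a - x0)) UNIV" (is "alg_ind L ?u UNIV")
proof (rule alg_ind_swap[OF frame_products_ind])
  let ?T = "L \<union> range ?u"
  have L: "acl L \<subseteq> acl ?T" by (intro acl_mono) auto
  have "(X i - x0) \<bullet> (a - x0) = (sqdists x0 X $ i - ?u i) / 2" for i
    by (simp add: sqdists_def algebra_simps inner_commute)
  moreover have "(sqdists x0 X $ i - ?u i) / 2 \<in> acl ?T" for i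
  proof -
    have u: "?u i \<in> acl ?T" by (intro acl_base) auto
    show ?thesis
      using L sqdists_frame_acl by (intro acl_divide[OF acl_diff[OF _ u] acl_numeral(1)]) blast
  qed
  ultimately have "(X i - x0) \<bullet> (a - x0) \<in> acl ?T" for i by (simp only:)
  then show "range (\<lambda>i. (X i - x0) \<bullet> (a - x0)) \<subseteq> acl ?T" by blast
qed auto

text \<open>Here \<open>x0\<close> takes the place of \<open>X k\<close>. The products with the
  other frame vectors are affine in the given squared distances; the product with
  \<open>X k - x0\<close> is then a root of the quadratic equation expressing |a - x0|^2 through the
  inverse Gram matrix.\<close>

lemma sqdists_ind:
  "alg_ind L (\<lambda>i. if i = k then (a - x0) \<bullet> (a - x0) else (a - X i) \<bullet> (a - X i)) UNIV"
    (is "alg_ind L ?t UNIV")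
proof (rule alg_ind_swap[OF frame_products_ind])
  let ?T = "L \<union> range ?t" and ?b = "\<lambda>i. (X i - x0) \<bullet> (a - x0)" and ?N = "gram_inv x0 X"
  have L: "acl L \<subseteq> acl ?T" by (intro acl_mono) auto
  have t: "?t i \<in> acl ?T" for i by (intro acl_base) auto
  have b: "?b i \<in> acl ?T" if "i \<noteq> k" for i
  proof -
    have "?b i = (?t k + sqdists x0 X $ i - ?t i) / 2"
      using that by (simp add: sqdists_def algebra_simps inner_commute)
    also have "\<dots> \<in> acl ?T"
      using L sqdists_frame_acl
      by (intro acl_divide[OF acl_diff[OF acl_add[OF t[of k]] t[of i]] acl_numeral(1)]) blast
    finally show ?thesis .
  qed
  define c where "c = (\<chi> i. if i = k then 0 else ?b i)"
  define e :: "real ^ 'd" where "e = axis k 1"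
  have ce: "frame_matrix x0 X *v (a - x0) = c + ?b k *\<^sub>R e"
    by (simp add: vec_eq_iff frame_matrix_mult c_def e_def axis_def)
  have c: "c $ i \<in> acl ?T" and e: "e $ i \<in> acl ?T" for i
    using b by (auto simp: c_def e_def axis_def)
  have N: "?N $ i $ j \<in> acl ?T" for i j using gram_inv_acl L by blast
  let ?P = "[:c \<bullet> (?N *v c) - ?t k, c \<bullet> (?N *v e) + e \<bullet> (?N *v c), e \<bullet> (?N *v e):]"
  have "?b k \<in> acl ?T"
  proof (rule acl_root)
    have "e \<bullet> (?N *v e) \<noteq> 0"
      using gram_inv_dual[OF frame] unfolding e_def axis_bilinear by (metis inner_eq_zero_iff)
    then show "?P \<noteq> 0" by simp
    have "poly_over (rat_ring (acl ?T)) ?P"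
      using c e N t[of k]
      by (intro poly_over_pCons poly_over_0)
        (auto simp: rat_ring_acl intro!: acl_diff acl_add acl_inner acl_matrix_vector_mult)
    then show "poly_over (acl ?T) ?P" by (simp add: rat_ring_acl)
    have "?t k = (c + ?b k *\<^sub>R e) \<bullet> (?N *v (c + ?b k *\<^sub>R e))"
      using gram_inv_inner[OF frame, of "a - x0" "a - x0"] by (simp add: ce)
    then show "poly ?P (?b k) = 0"
      by (simp add: matrix_vector_right_distrib matrix_vector_mult_scaleR inner_add_left inner_add_right
          algebra_simps)
  qed
  with b show "range ?b \<subseteq> acl ?T" by force
qed auto

text \<open>If \<open>d + 1\<close> distances to the generic point satisfy a relation over \<open>S\<close>, the quadric takes values
  in \<open>acl S\<close> at almost all rational points, and its coefficients are interpolated from these.\<close>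

lemma sqdists_frame_acl_of_relation:
  assumes S: "S \<subseteq> acl L"
    and rel: "(a - x0) \<bullet> (a - x0) \<in>
      acl (S \<union> range (\<lambda>i. (a - X i) \<bullet> (a - X i) - (a - x0) \<bullet> (a - x0)))"
  shows "sqdists x0 X $ i \<in> acl S"
proof -
  define U where "U = (\<lambda>i. (a - X i) \<bullet> (a - X i) - (a - x0) \<bullet> (a - x0))"
  define t where "t = (a - x0) \<bullet> (a - x0)"
  define N where "N = gram_inv x0 X"
  define g where "g = sqdists x0 X"
  \<comment> \<open>The quadric solved for the squared distance \<open>t\<close>, as a polynomial in
    the differences \<open>U\<close>.\<close>
  define \<rho> where "\<rho> y = quad N g (\<chi> i. y i) * (1 / 4)" for y
  have U_ind: "alg_ind L U UNIV" unfolding U_def by (rule sqdist_differences_ind)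
  have N_sym: "N $ i $ j = N $ j $ i" for i j unfolding N_def by (rule gram_inv_sym[OF frame])
  have N_det: "det N \<noteq> 0" unfolding N_def by (rule det_gram_inv[OF frame])
  have "(\<chi> i. U i) = sqdists a X - (\<chi> i. t)" by (simp add: U_def t_def sqdists_def vec_eq_iff)
  then have t: "t = \<rho> U" using sqdist_quad[OF frame, of a] by (simp add: \<rho>_def t_def N_def g_def)
  have rho_fun: "\<rho> \<in> poly_fun (acl L) UNIV"
    unfolding \<rho>_def N_def g_def using gram_inv_acl sqdists_frame_acl
    by (intro poly_fun_mult poly_fun_quad poly_fun_const)
      (auto simp: rat_ring_acl intro!: acl_divide acl_numeral)
  from rel obtain P where P: "P \<noteq> 0" "poly_over (rat_ring (S \<union> range U)) P" "poly P t = 0"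
    unfolding acl_def U_def t_def by blast
  have "\<exists>F\<in>poly_fun S UNIV. F U = coeff P k" for k
    using P(2) rat_ring_poly_fun unfolding poly_over_def by metis
  then obtain F where F: "\<And>k. F k \<in> poly_fun S UNIV" "\<And>k. F k U = coeff P k" by metis
  have F_L: "F k \<in> poly_fun (acl L) UNIV" for k
    using poly_fun_mono[OF F(1)] rat_ring_mono[OF S] by blast
  obtain m where m: "coeff P m \<noteq> 0" using P(1) by (metis leading_coeff_0_iff)
  \<comment> \<open>Where \<open>F m\<close> does not vanish, the relation specializes to a nonzero
    polynomial over \<open>S\<close> with root \<open>\<rho> y\<close>.\<close>
  have rho_acl: "\<rho> y \<in> acl S" if y: "\<And>i. y i \<in> \<rat>" "F m y \<noteq> 0" for y
  proof -
    define G where "G y = (\<Sum>k\<le>degree P. F k y * \<rho> y ^ k)" for y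
    have "G \<in> poly_fun (acl L) UNIV"
      unfolding G_def by (intro poly_fun_sum poly_fun_mult poly_fun_power F_L rho_fun)
    moreover have "G U = 0" using P(3) by (simp add: G_def F(2) poly_altdef t)
    ultimately have "G y = 0"
      by (rule poly_fun_specialize[OF _ finite U_ind]) (use acl_Rats y(1) in blast)
    define Q where "Q = (\<Sum>k\<le>degree P. monom (F k y) k)"
    have "coeff Q m = F m y" using m by (simp add: Q_def coeff_sum le_degree)
    then have "Q \<noteq> 0" using y(2) by auto
    moreover have "poly_over (rat_ring S) Q"
      unfolding Q_def
      by (intro poly_over_sum poly_over_monom poly_fun_value[OF F(1)])
        (metis Rats_cases rat_ring_rat y(1))
    moreover have "poly Q (\<rho> y) = 0"
      using \<open>G y = 0\<close> by (simp add: Q_def G_def poly_sum poly_monom)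
    ultimately show ?thesis unfolding acl_def by blast
  qed
  \<comment> \<open>Encodes the offsets 0, \<open>axis i 1\<close> and
    \<open>axis i 1 + axis j 1\<close> at which the finite differences evaluate the quadric.\<close>
  define sh where "sh = (\<lambda>((\<alpha>, \<beta>), i, j) (k :: 'd). \<alpha> * of_bool (k = i) + \<beta> * of_bool (k = j) :: real)"
  define E where "E = sh ` (({0, 1} \<times> {0, 1}) \<times> (UNIV :: ('d \<times> 'd) set))"
  have E_rat: "e k \<in> \<rat>" if "e \<in> E" for e k using that by (auto simp: E_def sh_def)
  have finE: "finite E" unfolding E_def by auto
  \<comment> \<open>The product over all offsets, so that a single rational base point serves every
    one of them.\<close>
  define H where "H y = (\<Prod>e\<in>E. F m (\<lambda>i. y i + e i))" for y
  have shift: "(\<lambda>y. F m (\<lambda>i. y i + e i)) \<in> poly_fun S UNIV" if "e \<in> E" for e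
    by (intro poly_fun_shift[OF F(1)]) (metis Rats_cases rat_ring_rat E_rat[OF that])
  have "H \<in> poly_fun S UNIV" unfolding H_def by (intro poly_fun_prod shift)
  \<comment> \<open>Vanishing at the shifted generic point would, after specialization to
    \<open>y - e\<close>, make \<open>F m\<close> vanish at the rational point
    \<open>y\<close>.\<close>
  moreover have "F m (\<lambda>i. U i + e i) \<noteq> 0" if e: "e \<in> E" for e
  proof
    assume zero: "F m (\<lambda>i. U i + e i) = 0"
    obtain y where y: "\<And>i. y i \<in> \<rat>" "F m y \<noteq> 0"
      using poly_fun_nonzero_rat[OF F(1), of m U] m F(2) by auto
    define K where "K = (\<lambda>y. F m (\<lambda>i. y i + e i))"
    have K: "K \<in> poly_fun (acl L) UNIV"
      unfolding K_def using poly_fun_mono[OF shift[OF e]] rat_ring_mono[OF S] by blast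
    have "K U = 0" using zero by (simp add: K_def)
    then have "K (\<lambda>i. y i - e i) = 0"
      by (rule poly_fun_specialize[OF K finite U_ind]) (intro acl_Rats Rats_diff y(1) E_rat[OF e])
    then have "F m y = 0" by (simp add: K_def)
    then show False using y(2) by simp
  qed
  then have "H U \<noteq> 0" using finE by (simp add: H_def)
  ultimately obtain y where y: "\<And>i. y i \<in> \<rat>" "H y \<noteq> 0"
    using poly_fun_nonzero_rat[of H S UNIV U] by auto
  define u where "u = (\<chi> i. y i)"
  have quad_acl: "quad N g (u + (\<chi> i. e i)) \<in> acl S" if e: "e \<in> E" for e
  proof -
    have "F m (\<lambda>i. y i + e i) \<noteq> 0" using y(2) finE e by (auto simp: H_def)
    then have "\<rho> (\<lambda>i. y i + e i) \<in> acl S"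
      using y(1) E_rat[OF e] by (intro rho_acl) auto
    then have "4 * \<rho> (\<lambda>i. y i + e i) \<in> acl S" by (intro acl_mult acl_numeral)
    moreover have "(\<chi> i. y i + e i) = u + (\<chi> i. e i)" by (simp add: u_def vec_eq_iff)
    ultimately show ?thesis by (simp add: \<rho>_def)
  qed
  have sh_E: "sh ((\<alpha>, \<beta>), i, j) \<in> E" if "\<alpha> \<in> {0, 1}" "\<beta> \<in> {0, 1}" for \<alpha> \<beta> i j
    unfolding E_def using that by blast
  have q2: "quad N g (u + axis i 1 + axis j 1) \<in> acl S" for i j
  proof -
    have "u + (\<chi> k. sh ((1, 1), i, j) k) = u + axis i 1 + axis j 1"
      by (simp add: sh_def vec_eq_iff axis_def)
    with quad_acl[OF sh_E[of 1 1 i j]] show ?thesis by simp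
  qed
  have q1: "quad N g (u + axis i 1) \<in> acl S" for i
  proof -
    have "u + (\<chi> k. sh ((1, 0), i, i) k) = u + axis i 1"
      by (simp add: sh_def vec_eq_iff axis_def)
    with quad_acl[OF sh_E[of 1 0 i i]] show ?thesis by simp
  qed
  have q0: "quad N g u \<in> acl S"
  proof -
    have "u + (\<chi> k. sh ((0, 0), i, i) k) = u"
      by (simp add: sh_def vec_eq_iff)
    with quad_acl[OF sh_E[of 0 0 i i]] show ?thesis by simp
  qed
  have N_acl: "N $ i $ j \<in> acl S" for i j
  proof -
    have "(quad N g (u + axis i 1 + axis j 1) - quad N g (u + axis i 1) - quad N g (u + axis j 1)
        + quad N g u) / 2 \<in> acl S"
      by (intro acl_divide acl_add acl_diff q0 q1 q2 acl_numeral)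
    then show ?thesis unfolding quad_mixed_difference[OF N_sym] by simp
  qed
  have "(N *v (u - g)) $ j \<in> acl S" for j
  proof -
    have "(quad N g (u + axis j 1) - quad N g u - N $ j $ j) / 2 \<in> acl S"
      by (intro acl_divide acl_diff q0 q1 N_acl acl_numeral)
    then show ?thesis unfolding quad_difference[OF N_sym] by simp
  qed
  from acl_solve[OF N_det N_acl this] have "(u - g) $ i \<in> acl S" .
  then have "u $ i - (u - g) $ i \<in> acl S"
    using y(1) by (intro acl_diff) (auto simp: u_def intro: acl_Rats)
  then show ?thesis by (simp add: g_def)
qed

end

text \<open>Agreement at one generic point spreads to all rational points by specialization; finite
  differences at the origin then compare the coefficients.\<close>

lemma quad_unique:
  fixes N N' :: "real ^ 'd ^ 'd"
  assumes U: "alg_ind L U UNIV" and eq: "quad N g (\<chi> i. U i) = quad N' g' (\<chi> i. U i)"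
    and acl: "\<And>i j. N $ i $ j \<in> acl L" "\<And>i j. N' $ i $ j \<in> acl L" "\<And>i. g $ i \<in> acl L" "\<And>i. g' $ i \<in> acl L"
    and sym: "\<And>i j. N $ i $ j = N $ j $ i" "\<And>i j. N' $ i $ j = N' $ j $ i"
    and det: "det N \<noteq> 0"
  shows "N = N'" "g = g'"
proof -
  have diff_fun: "(\<lambda>y. quad N g (\<chi> i. y i) - quad N' g' (\<chi> i. y i)) \<in> poly_fun (acl L) UNIV"
    by (intro poly_fun_diff poly_fun_quad acl)
  have q: "quad N g u = quad N' g' u" if "\<And>i. u $ i \<in> \<rat>" for u
  proof -
    have "quad N g (\<chi> i. u $ i) - quad N' g' (\<chi> i. u $ i) = 0"
      by (rule poly_fun_specialize[OF diff_fun finite U]) (use eq that in \<open>auto intro: acl_Rats\<close>)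
    then show ?thesis by simp
  qed
  have axis_rat: "axis i (1::real) $ j \<in> \<rat>" for i j :: 'd by (simp add: axis_def)
  show N: "N = N'"
  proof (simp add: vec_eq_iff, intro allI)
    fix i j
    have "2 * N $ i $ j = 2 * N' $ i $ j"
      unfolding quad_mixed_difference[OF sym(1), of g 0, symmetric]
        quad_mixed_difference[OF sym(2), of g' 0, symmetric]
      using axis_rat by (simp add: q)
    then show "N $ i $ j = N' $ i $ j" by simp
  qed
  have "(N *v (0 - g)) $ i = (N' *v (0 - g')) $ i" for i
  proof -
    have "quad N g (0 + axis i 1) = quad N' g' (0 + axis i 1)" "quad N g 0 = quad N' g' 0"
      using axis_rat by (auto intro!: q)
    then show ?thesis
      using quad_difference[OF sym(1), of g 0 i] quad_difference[OF sym(2), of g' 0 i] N by simp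
  qed
  then have "N *v (0 - g) = N *v (0 - g')" by (simp add: vec_eq_iff N)
  moreover have "inj ((*v) N)" using det by (simp add: inj_matrix_vector_mult invertible_det_nz)
  ultimately have "0 - g = 0 - g'" by (metis injD)
  then show "g = g'" by simp
qed

text \<open>Meant for an arbitrary equivalent framework, whose frame might be degenerate. In that
  case the frame vectors would have a linear dependency with coefficients in \<open>acl L\<close>,
  because their Gram matrix has its entries there, and it would turn into a relation between the
  independent differences.\<close>

lemma frame_det_nonzero_of_ind:
  fixes x0 :: "real ^ 'd"
  assumes U: "alg_ind L (\<lambda>i. (a - X i) \<bullet> (a - X i) - (a - x0) \<bullet> (a - x0)) UNIV"
    and gram: "\<And>i j. (X i - x0) \<bullet> (X j - x0) \<in> acl L"
  shows "det (frame_matrix x0 X) \<noteq> 0"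
proof
  let ?y = "\<lambda>i. X i - x0" and ?U = "\<lambda>i. (a - X i) \<bullet> (a - X i) - (a - x0) \<bullet> (a - x0)"
  assume "det (frame_matrix x0 X) = 0"
  then have "\<not> invertible (transpose (frame_matrix x0 X))"
    by (simp add: invertible_det_nz det_transpose)
  then obtain r where r: "transpose (frame_matrix x0 X) *v r = 0" "r \<noteq> 0"
    by (metis invertible_left_inverse matrix_left_invertible_ker)
  then obtain k where k: "r $ k \<noteq> 0" by (auto simp: vec_eq_iff)
  have "(\<Sum>i\<in>UNIV. r $ i *\<^sub>R ?y i) = transpose (frame_matrix x0 X) *v r"
    by (simp add: vec_eq_iff matrix_vector_mult_def transpose_def frame_matrix_def mult.commute)
  then have ry: "(\<Sum>i\<in>UNIV. r $ i *\<^sub>R ?y i) = 0" using r by simp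
  \<comment> \<open>The real dependency \<open>r\<close> need not have coefficients in
    \<open>acl L\<close>. Dropping the Gram equation of index \<open>k\<close> leaves fewer
    equations than unknowns, so a solution \<open>c\<close> over \<open>acl L\<close> exists;
    \<open>r $ k \<noteq> 0\<close> then supplies the dropped equation.\<close>
  obtain c where c: "\<And>i. c i \<in> acl L" "\<exists>i. c i \<noteq> 0"
      and c0: "\<And>e. e \<noteq> k \<Longrightarrow> (\<Sum>i\<in>UNIV. (?y e \<bullet> ?y i) * c i) = 0"
    using homogeneous_system_solution[of "UNIV - {k}" "UNIV :: 'd set" "\<lambda>e i. ?y e \<bullet> ?y i" "acl L"]
      gram by (simp add: rat_ring_acl card_Diff_singleton Ball_def) blast
  define z where "z = (\<Sum>i\<in>UNIV. c i *\<^sub>R ?y i)"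
  have yz: "?y e \<bullet> z = (\<Sum>i\<in>UNIV. (?y e \<bullet> ?y i) * c i)" for e
    by (simp add: z_def inner_sum_right mult.commute)
  have z0: "?y e \<bullet> z = 0" if "e \<noteq> k" for e using c0[OF that] yz by simp
  have "0 = (\<Sum>i\<in>UNIV. r $ i *\<^sub>R ?y i) \<bullet> z" using ry by simp
  also have "\<dots> = (\<Sum>i\<in>UNIV. r $ i * (?y i \<bullet> z))" by (simp add: inner_sum_left)
  also have "\<dots> = (\<Sum>i\<in>UNIV. if i = k then r $ k * (?y k \<bullet> z) else 0)"
    using z0 by (intro sum.cong) auto
  also have "\<dots> = r $ k * (?y k \<bullet> z)" by simp
  finally have "?y k \<bullet> z = 0" using k by simp
  with z0 have z1: "?y e \<bullet> z = 0" for e by (cases "e = k") auto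
  have "z \<bullet> z = (\<Sum>i\<in>UNIV. c i * (?y i \<bullet> z))"
    by (subst (1) z_def) (simp add: inner_sum_left)
  then have "z = 0" using z1 by simp
  then have "(\<Sum>i\<in>UNIV. c i * (?y i \<bullet> (a - x0))) = 0"
    by (simp add: z_def flip: inner_scaleR_left inner_sum_left)
  moreover have "?U i = ?y i \<bullet> ?y i - 2 * (?y i \<bullet> (a - x0))" for i
    by (simp add: algebra_simps inner_commute)
  ultimately have rel: "(\<Sum>i\<in>UNIV. c i * ?U i) = (\<Sum>i\<in>UNIV. c i * (?y i \<bullet> ?y i))"
    by (simp only: right_diff_distrib sum_subtractf mult.left_commute[of _ 2]
        flip: sum_distrib_left)
  obtain l where l: "c l \<noteq> 0" using c(2) by blast
  let ?T = "L \<union> ?U ` (UNIV - {l})"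
  have "(\<Sum>i\<in>UNIV. c i * ?U i) = c l * ?U l + (\<Sum>i\<in>UNIV - {l}. c i * ?U i)"
    by (rule sum.remove) auto
  with rel l have "?U l = ((\<Sum>i\<in>UNIV. c i * (?y i \<bullet> ?y i)) - (\<Sum>i\<in>UNIV - {l}. c i * ?U i)) / c l"
    by (simp add: field_simps)
  also have "\<dots> \<in> acl ?T"
  proof -
    have L: "acl L \<subseteq> acl ?T" by (intro acl_mono) auto
    have "?U i \<in> acl ?T" if "i \<noteq> l" for i using that by (intro acl_base) auto
    then show ?thesis
      using L c(1) gram by (intro acl_divide acl_diff[OF acl_sum acl_sum] acl_mult) blast+
  qed
  finally show False using U by (auto simp: alg_ind_def)
qed

subsection \<open>Generic frameworks\<close>

definition coord :: "('v \<Rightarrow> real ^ 'd) \<Rightarrow> 'v \<times> 'd \<Rightarrow> real" where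
  "coord p = (\<lambda>(v, i). p v $ i)"

definition coords :: "('v \<Rightarrow> real ^ 'd) \<Rightarrow> 'v set \<Rightarrow> real set" where
  "coords p W = coord p ` (W \<times> UNIV)"

definition sqd :: "('v \<Rightarrow> real ^ 'd) \<Rightarrow> 'v \<Rightarrow> 'v \<Rightarrow> real" where
  "sqd p u v = (p u - p v) \<bullet> (p u - p v)"

definition generic_on :: "'v set \<Rightarrow> ('v \<Rightarrow> real ^ 'd) \<Rightarrow> bool" where
  "generic_on V p \<longleftrightarrow> alg_independent_over_rat (V \<times> (UNIV :: 'd set)) (coord p)"

lemma sqd_commute: "sqd p u v = sqd p v u"
  unfolding sqd_def by (metis inner_minus_left inner_minus_right minus_diff_eq minus_minus)

lemma sqd_self [simp]: "sqd p u u = 0"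
  by (simp add: sqd_def)

lemma inner_sqd: "(p u - p x) \<bullet> (p w - p x) = (sqd p u x + sqd p w x - sqd p u w) / 2"
  by (simp add: sqd_def algebra_simps inner_commute)

lemma sqd_inner: "sqd p u w = sqd p u x + sqd p w x - 2 * ((p u - p x) \<bullet> (p w - p x))"
  by (simp add: inner_sqd field_simps)

lemma coords_acl: "v \<in> W \<Longrightarrow> p v $ i \<in> acl (coords p W)"
  by (intro acl_base) (force simp: coords_def coord_def)

lemma sqd_acl: "u \<in> W \<Longrightarrow> v \<in> W \<Longrightarrow> sqd p u v \<in> acl (coords p W)"
  unfolding sqd_def by (auto intro!: acl_inner acl_diff coords_acl)

lemma generic_on_subset:
  assumes "generic_on V p" "W \<subseteq> V"
  shows "generic_on W p"
  using assms unfolding generic_on_def alg_independent_over_rat_def by (meson Sigma_mono order.trans order.refl)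

lemma generic_on_poly_fun:
  assumes "generic_on V p" "F \<in> poly_fun {} (V \<times> UNIV)" "F (coord p) = 0"
  shows "F c = 0"
  using assms alg_independent_poly_fun unfolding generic_on_def by blast

lemma generic_on_vertex_ind:
  fixes p :: "'v \<Rightarrow> real ^ 'd"
  assumes "generic_on V p" "v \<in> V" "W \<subseteq> V - {v}"
  shows "alg_ind (coords p W) (\<lambda>i. p v $ i) UNIV"
  unfolding alg_ind_def
proof
  fix i :: 'd
  have "coord p (v, i) \<notin> acl ({} \<union> coord p ` (V \<times> UNIV - {(v, i)}))"
    using alg_independent_alg_ind[OF assms(1)[unfolded generic_on_def]] assms(2)
    unfolding alg_ind_def by blast
  moreover have "coords p W \<union> (\<lambda>i. p v $ i) ` (UNIV - {i}) \<subseteq> {} \<union> coord p ` (V \<times> UNIV - {(v, i)})"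
  proof
    fix c assume "c \<in> coords p W \<union> (\<lambda>i. p v $ i) ` (UNIV - {i})"
    then obtain w j where "c = coord p (w, j)" "w \<in> W \<or> w = v \<and> j \<noteq> i"
      by (auto simp: coords_def coord_def)
    with assms show "c \<in> {} \<union> coord p ` (V \<times> UNIV - {(v, i)})" by (intro UnI2 image_eqI[of _ _ "(w, j)"]) auto
  qed
  ultimately have "coord p (v, i) \<notin> acl (coords p W \<union> (\<lambda>i. p v $ i) ` (UNIV - {i}))"
    using acl_mono by blast
  then show "p v $ i \<notin> acl (coords p W \<union> (\<lambda>i. p v $ i) ` (UNIV - {i}))"
    by (simp add: coord_def)
qed

lemma poly_fun_det:
  fixes A :: "('i \<Rightarrow> real) \<Rightarrow> real ^ 'n ^ 'n"
  assumes "\<And>i j. (\<lambda>c. A c $ i $ j) \<in> poly_fun S I"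
  shows "(\<lambda>c. det (A c)) \<in> poly_fun S I"
proof -
  have "real_of_int k \<in> rat_ring S" for k
    using rat_ring_rat[of "of_int k" S] by simp
  then show ?thesis
    unfolding det_def by (intro poly_fun_sum poly_fun_mult poly_fun_prod poly_fun_const assms)
qed

text \<open>Completes the points of \<open>B\<close> to a full frame: slots not hit by
  \<open>\<iota>\<close> receive unit translates of \<open>p x0\<close>, whose coordinates are
  algebraic over those of \<open>p x0\<close>.\<close>

definition frame_points ::
    "('v \<Rightarrow> real ^ 'd) \<Rightarrow> 'v \<Rightarrow> 'v set \<Rightarrow> ('v \<Rightarrow> 'd) \<Rightarrow> 'd \<Rightarrow> real ^ 'd" where
  "frame_points p x0 B \<iota> i = (if i \<in> \<iota> ` B then p (inv_into B \<iota> i) else p x0 + axis i 1)"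

lemma frame_points_image: "inj_on \<iota> B \<Longrightarrow> x \<in> B \<Longrightarrow> frame_points p x0 B \<iota> (\<iota> x) = p x"
  by (simp add: frame_points_def)

text \<open>The determinant is a rational polynomial in the coordinates. Putting each point of
  \<open>B\<close> at the unit vector of its slot and \<open>x0\<close> at the origin gives the
  identity matrix, so it is not identically zero and cannot vanish at a generic point.\<close>

lemma generic_on_frame:
  fixes p :: "'v \<Rightarrow> real ^ 'd"
  assumes gen: "generic_on V p" and B: "B \<subseteq> V" "x0 \<in> V" "x0 \<notin> B" and inj: "inj_on \<iota> B"
  shows "det (frame_matrix (p x0) (frame_points p x0 B \<iota>)) \<noteq> 0"
proof
  define A :: "('v \<times> 'd \<Rightarrow> real) \<Rightarrow> real ^ 'd ^ 'd" where
    "A c = (\<chi> i j. if i \<in> \<iota> ` B then c (inv_into B \<iota> i, j) - c (x0, j) else axis i 1 $ j)" for c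
  have AB: "inv_into B \<iota> i \<in> V" if "i \<in> \<iota> ` B" for i
    using inv_into_into[OF that] B by blast
  have "(\<lambda>c. A c $ i $ j) \<in> poly_fun {} (V \<times> UNIV)" for i j
  proof (cases "i \<in> \<iota> ` B")
    case True
    then show ?thesis using AB B by (auto simp: A_def intro!: poly_fun_diff poly_fun_var)
  next
    case False
    then show ?thesis by (auto simp: A_def axis_def intro!: poly_fun_const)
  qed
  then have det_fun: "(\<lambda>c. det (A c)) \<in> poly_fun {} (V \<times> UNIV)" by (rule poly_fun_det)
  assume "det (frame_matrix (p x0) (frame_points p x0 B \<iota>)) = 0"
  moreover have "A (coord p) = frame_matrix (p x0) (frame_points p x0 B \<iota>)"
    by (auto simp: A_def frame_matrix_def frame_points_def coord_def vec_eq_iff)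
  ultimately have "det (A (coord p)) = 0" by simp
  then have zero: "det (A c) = 0" for c using generic_on_poly_fun[OF gen det_fun] by blast
  define c where "c = (\<lambda>(v, j). of_bool (v \<in> B \<and> j = \<iota> v) :: real)"
  have "A c $ i $ j = mat 1 $ i $ j" for i j
  proof (cases "i \<in> \<iota> ` B")
    case True
    then have "inv_into B \<iota> i \<in> B" "\<iota> (inv_into B \<iota> i) = i"
      by (auto simp: inv_into_into f_inv_into_f)
    then show ?thesis using True B by (auto simp: A_def c_def mat_def)
  qed (auto simp: A_def mat_def axis_def)
  then have "A c = mat 1" by (simp add: vec_eq_iff)
  then show False using zero[of c] by simp
qed

text \<open>The algebraic relation is a polynomial in the coordinates that vanishes at the generic
  \<open>p\<close>, hence at \<open>q\<close>. Its coefficients are polynomials in the lengths over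
  \<open>E\<close>, which agree, so both distances are roots of the same nonzero polynomial.\<close>

lemma linked_equivalent:
  fixes p q :: "'v \<Rightarrow> real ^ 'd"
  assumes gen: "generic_on V p" and E: "E \<subseteq> V \<times> V" and xy: "x \<in> V" "y \<in> V"
    and linked: "sqd p x y \<in> acl ((\<lambda>(u, v). sqd p u v) ` E)"
    and equiv: "\<And>u v. (u, v) \<in> E \<Longrightarrow> sqd q u v = sqd p u v"
  shows "sqd q x y \<in> acl ((\<lambda>(u, v). sqd p u v) ` E)"
proof -
  let ?m = "\<lambda>u v (c :: 'v \<times> 'd \<Rightarrow> real). \<Sum>i\<in>UNIV. (c (u, i) - c (v, i)) * (c (u, i) - c (v, i))"
  have m: "?m u v (coord r) = sqd r u v" for u v r
    by (simp add: sqd_def coord_def inner_vec_def)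
  have m_fun: "?m u v \<in> poly_fun {} (V \<times> UNIV)" if "u \<in> V" "v \<in> V" for u v
    using that by (intro poly_fun_sum poly_fun_mult poly_fun_diff poly_fun_var) auto
  obtain P where P: "P \<noteq> 0" "poly_over (rat_ring ((\<lambda>(u, v). sqd p u v) ` E)) P" "poly P (sqd p x y) = 0"
    using linked unfolding acl_def by blast
  have ex: "\<exists>F\<in>poly_fun {} (V \<times> UNIV). F (coord p) = r \<and> F (coord q) = r"
    if "r \<in> rat_ring ((\<lambda>(u, v). sqd p u v) ` E)" for r
    using that
  proof induction
    case (rat_ring_rat r)
    then show ?case by (intro bexI[of _ "\<lambda>_. of_rat r"]) (auto intro: poly_fun_const rat_ring.intros)
  next
    case (rat_ring_base s)
    then obtain u v where uv: "(u, v) \<in> E" "s = sqd p u v" by auto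
    then show ?case using E equiv by (intro bexI[of _ "?m u v"]) (auto simp: m intro: m_fun)
  next
    case (rat_ring_add a b)
    then obtain F G where "F \<in> poly_fun {} (V \<times> UNIV)" "F (coord p) = a" "F (coord q) = a"
      "G \<in> poly_fun {} (V \<times> UNIV)" "G (coord p) = b" "G (coord q) = b" by blast
    then show ?case by (intro bexI[of _ "\<lambda>c. F c + G c"]) (auto intro: poly_fun_add)
  next
    case (rat_ring_mult a b)
    then obtain F G where "F \<in> poly_fun {} (V \<times> UNIV)" "F (coord p) = a" "F (coord q) = a"
      "G \<in> poly_fun {} (V \<times> UNIV)" "G (coord p) = b" "G (coord q) = b" by blast
    then show ?case by (intro bexI[of _ "\<lambda>c. F c * G c"]) (auto intro: poly_fun_mult)
  qed
  have "\<exists>F. F \<in> poly_fun {} (V \<times> UNIV) \<and> F (coord p) = coeff P k \<and> F (coord q) = coeff P k" for k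
    using ex P(2) unfolding poly_over_def by blast
  then obtain F where F: "\<And>k. F k \<in> poly_fun {} (V \<times> UNIV)" "\<And>k. F k (coord p) = coeff P k"
    "\<And>k. F k (coord q) = coeff P k" by metis
  define G where "G c = (\<Sum>k\<le>degree P. F k c * ?m x y c ^ k)" for c
  have "G \<in> poly_fun {} (V \<times> UNIV)"
    unfolding G_def using xy by (intro poly_fun_sum poly_fun_mult poly_fun_power F(1) m_fun)
  moreover have "G (coord p) = 0" using P(3) by (simp add: G_def F m poly_altdef)
  ultimately have "G (coord q) = 0" using generic_on_poly_fun[OF gen] by blast
  then have "poly P (sqd q x y) = 0" by (simp add: G_def F m poly_altdef)
  with P show ?thesis unfolding acl_def by blast
qed

section \<open>Attaching one generic vertex\<close>

lemma alg_ind_reindex: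
  assumes "alg_ind L f J" "inj_on \<kappa> A" "\<kappa> ` A \<subseteq> J" "\<And>x. x \<in> A \<Longrightarrow> g x = f (\<kappa> x)"
  shows "alg_ind L g A"
  unfolding alg_ind_def
proof
  fix x assume x: "x \<in> A"
  have "g ` (A - {x}) \<subseteq> f ` (J - {\<kappa> x})"
  proof
    fix z assume "z \<in> g ` (A - {x})"
    then obtain y where "y \<in> A" "y \<noteq> x" "z = f (\<kappa> y)" using assms(4) by auto
    then show "z \<in> f ` (J - {\<kappa> x})"
      using assms(2,3) x by (intro image_eqI[of _ _ "\<kappa> y"]) (auto dest: inj_onD)
  qed
  then have "acl (L \<union> g ` (A - {x})) \<subseteq> acl (L \<union> f ` (J - {\<kappa> x}))"
    by (intro acl_mono) blast
  moreover have "f (\<kappa> x) \<notin> acl (L \<union> f ` (J - {\<kappa> x}))"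
    using assms(1,3) x unfolding alg_ind_def by blast
  ultimately show "g x \<notin> acl (L \<union> g ` (A - {x}))" using assms(4)[OF x] by auto
qed

lemma new_vertex_sqd_ind:
  fixes p :: "'v \<Rightarrow> real ^ 'd"
  assumes gen: "generic_on V p" and v: "v \<in> V" "W \<subseteq> V - {v}"
    and A: "A \<subseteq> W" "finite A" "card A \<le> CARD('d)"
  shows "alg_ind (coords p W) (\<lambda>x. sqd p v x) A"
proof (cases "A = {}")
  case True
  then show ?thesis by (simp add: alg_ind_def)
next
  case False
  then obtain x0 where x0: "x0 \<in> A" by blast
  define B where "B = A - {x0}"
  have B: "finite B" "x0 \<notin> B" "A = insert x0 B" using A x0 by (auto simp: B_def)
  \<comment> \<open>The slot \<open>k\<close> is reserved for \<open>x0\<close>, matching the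
    replacement made in \<open>sqdists_ind\<close>; the other slots have room for
    \<open>B\<close>.\<close>
  obtain k :: 'd where True by blast
  have "card B \<le> card (UNIV - {k})" using A B by (simp add: card_Diff_singleton)
  then obtain \<iota> where \<iota>: "\<iota> ` B \<subseteq> UNIV - {k}" "inj_on \<iota> B"
    using card_le_inj[OF B(1), of "UNIV - {k}"] by auto
  let ?X = "frame_points p x0 B \<iota>"
  have sub: "B \<subseteq> W" "x0 \<in> W" using A B by auto
  have "alg_ind (coords p W)
      (\<lambda>i. if i = k then (p v - p x0) \<bullet> (p v - p x0) else (p v - ?X i) \<bullet> (p v - ?X i)) UNIV"
  proof (rule sqdists_ind)
    show "alg_ind (coords p W) (\<lambda>i. p v $ i) UNIV" by (rule generic_on_vertex_ind[OF gen v])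
    show "p x0 $ i \<in> acl (coords p W)" for i using sub by (intro coords_acl)
    show "?X i $ j \<in> acl (coords p W)" for i j
    proof (cases "i \<in> \<iota> ` B")
      case True
      then have "inv_into B \<iota> i \<in> W" using inv_into_into[OF True] sub by blast
      then show ?thesis using True by (auto simp: frame_points_def intro: coords_acl)
    next
      case False
      then show ?thesis using sub by (auto simp: frame_points_def axis_def intro!: acl_add coords_acl)
    qed
    show "det (frame_matrix (p x0) ?X) \<noteq> 0"
      using sub v B \<iota> by (intro generic_on_frame[OF gen]) auto
  qed
  then show ?thesis
  proof (rule alg_ind_reindex[where \<kappa> = "\<lambda>x. if x = x0 then k else \<iota> x"])
    show "inj_on (\<lambda>x. if x = x0 then k else \<iota> x) A"
      using \<iota> B by (auto simp: inj_on_def)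
    show "sqd p v x = (if (if x = x0 then k else \<iota> x) = k then (p v - p x0) \<bullet> (p v - p x0)
        else (p v - ?X (if x = x0 then k else \<iota> x)) \<bullet> (p v - ?X (if x = x0 then k else \<iota> x)))"
      if "x \<in> A" for x
      using that \<iota> B frame_points_image[OF \<iota>(2), of x p x0] by (auto simp: sqd_def)
  qed auto
qed

lemma full_frame:
  fixes p :: "'v \<Rightarrow> real ^ 'd"
  assumes "generic_on V p" "A \<subseteq> V" "card A = CARD('d) + 1" "x0 \<in> A"
  obtains X :: "'d \<Rightarrow> 'v" where "bij_betw X UNIV (A - {x0})" "det (frame_matrix (p x0) (\<lambda>i. p (X i))) \<noteq> 0"
proof -
  have fin: "finite A" using assms(3) by (intro card_ge_0_finite) simp
  then have card: "card (A - {x0}) = CARD('d)" using assms by (simp add: card_Diff_singleton)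
  then obtain \<iota> where \<iota>: "bij_betw \<iota> (A - {x0}) (UNIV :: 'd set)"
    using finite_same_card_bij[of "A - {x0}" "UNIV :: 'd set"] fin by auto
  define X where "X = inv_into (A - {x0}) \<iota>"
  have "bij_betw X UNIV (A - {x0})" unfolding X_def by (rule bij_betw_inv_into[OF \<iota>])
  moreover have "frame_points p x0 (A - {x0}) \<iota> = (\<lambda>i. p (X i))"
    using \<iota> by (auto simp: frame_points_def X_def bij_betw_def)
  moreover have "det (frame_matrix (p x0) (frame_points p x0 (A - {x0}) \<iota>)) \<noteq> 0"
    using assms \<iota> by (intro generic_on_frame[OF assms(1)]) (auto simp: bij_betw_def)
  ultimately show thesis using that by simp
qed

text \<open>The differences of the new lengths are independent over \<open>coords p W\<close> and
  contribute d. One length more adds another unit: a relation would make the squared distances from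
  the base point to the frame algebraic over \<open>S\<close>. With \<open>x\<close> as base point,
  the excluded distance is one of these.\<close>

lemma new_vertex_rk:
  fixes p :: "'v \<Rightarrow> real ^ 'd"
  assumes gen: "generic_on V p" and v: "v \<in> V" "W \<subseteq> V - {v}"
    and A: "A \<subseteq> W" "card A = CARD('d) + 1" and xy: "x \<in> A" "y \<in> A" "x \<noteq> y"
    and S: "finite S" "S \<subseteq> acl (coords p W)" and nlinked: "sqd p x y \<notin> acl S"
  shows "rk S + CARD('d) + 1 \<le> rk (S \<union> sqd p v ` A)"
proof -
  have fin: "finite A" using A(2) by (intro card_ge_0_finite) simp
  obtain X where X: "bij_betw X UNIV (A - {x})" "det (frame_matrix (p x) (\<lambda>i. p (X i))) \<noteq> 0"
    by (rule full_frame[OF gen _ A(2) xy(1)]) (use A(1) v in auto)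
  have XA: "X i \<in> A" for i using X(1) by (auto simp: bij_betw_def)
  have "y \<in> range X" using bij_betw_imp_surj_on[OF X(1)] xy by simp
  then obtain j where j: "X j = y" by blast
  let ?U = "\<lambda>i. (p v - p (X i)) \<bullet> (p v - p (X i)) - (p v - p x) \<bullet> (p v - p x)"
  note frame = generic_on_vertex_ind[OF gen v] coords_acl[of _ W p] coords_acl[of _ W p] X(2)
  have in_W: "x \<in> W" "\<And>i. X i \<in> W" using A(1) xy XA by auto
  have "alg_ind (coords p W) ?U UNIV"
    by (rule sqdist_differences_ind[OF frame]) (use in_W in auto)
  then have "alg_ind S ?U UNIV" using S(2) by (rule alg_ind_base_mono)
  then have "rk S + CARD('d) \<le> rk (S \<union> range ?U)" using S(1) by (intro rk_alg_ind) auto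
  moreover have "(p v - p x) \<bullet> (p v - p x) \<notin> acl (S \<union> range ?U)"
  proof
    assume "(p v - p x) \<bullet> (p v - p x) \<in> acl (S \<union> range ?U)"
    then have "sqdists (p x) (\<lambda>i. p (X i)) $ j \<in> acl S"
      using in_W S(2) by (intro sqdists_frame_acl_of_relation[OF frame]) auto
    then show False using nlinked j by (simp add: sqdists_def sqd_def)
  qed
  then have "rk (S \<union> range ?U) + 1 \<le> rk (insert ((p v - p x) \<bullet> (p v - p x)) (S \<union> range ?U))"
    using S(1) by (intro rk_insert) auto
  moreover have "rk (insert ((p v - p x) \<bullet> (p v - p x)) (S \<union> range ?U)) \<le> rk (S \<union> sqd p v ` A)"
  proof (rule rk_mono)
    have "sqd p v a \<in> acl (S \<union> sqd p v ` A)" if "a \<in> A" for a using that by (intro acl_base) auto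
    then show "insert ((p v - p x) \<bullet> (p v - p x)) (S \<union> range ?U) \<subseteq> acl (S \<union> sqd p v ` A)"
      using XA xy by (auto simp: sqd_def[symmetric] intro!: acl_diff intro: acl_base)
  qed (use S fin in auto)
  ultimately show ?thesis by simp
qed

text \<open>The same generic vector of differences lies on the quadric of \<open>p\<close> and on
  that of \<open>q\<close>, at the same value, and both have coefficients in
  \<open>acl (coords p W)\<close>. So the quadrics coincide, and their common centre lists the
  squared distances from \<open>x\<close> to the other points of \<open>A\<close>.\<close>

lemma globally_linked_neighbours:
  fixes p q :: "'v \<Rightarrow> real ^ 'd"
  assumes gen: "generic_on V p" and v: "v \<in> V" "W \<subseteq> V - {v}"
    and A: "A \<subseteq> W" "card A = CARD('d) + 1" and xy: "x \<in> A" "y \<in> A"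
    and linked: "\<And>a b. a \<in> A \<Longrightarrow> b \<in> A \<Longrightarrow> sqd q a b \<in> acl (coords p W)"
    and equiv: "\<And>a. a \<in> A \<Longrightarrow> sqd q v a = sqd p v a"
  shows "sqd q x y = sqd p x y"
proof (cases "x = y")
  case False
  obtain X where X: "bij_betw X UNIV (A - {x})" "det (frame_matrix (p x) (\<lambda>i. p (X i))) \<noteq> 0"
    by (rule full_frame[OF gen _ A(2) xy(1)]) (use A(1) v in auto)
  have XA: "X i \<in> A" for i using X(1) by (auto simp: bij_betw_def)
  have "y \<in> range X" using bij_betw_imp_surj_on[OF X(1)] xy False by simp
  then obtain j where j: "X j = y" by blast
  let ?L = "coords p W"
  define U where "U r i = (r v - r (X i)) \<bullet> (r v - r (X i)) - (r v - r x) \<bullet> (r v - r x)"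
    for r :: "'v \<Rightarrow> real ^ 'd" and i
  note frame = generic_on_vertex_ind[OF gen v] coords_acl[of _ W p] coords_acl[of _ W p] X(2)
  have in_W: "x \<in> W" "\<And>i. X i \<in> W" using A(1) xy XA by auto
  have U_ind: "alg_ind ?L (U p) UNIV"
    unfolding U_def by (rule sqdist_differences_ind[OF frame]) (use in_W in auto)
  have U_eq: "U q = U p"
    using equiv XA xy by (auto simp: U_def sqd_def)
  have gram_q: "(q (X i) - q x) \<bullet> (q (X j) - q x) \<in> acl ?L" for i j
    unfolding inner_sqd using XA xy linked by (intro acl_divide acl_diff acl_add acl_numeral) auto
  have det_q: "det (frame_matrix (q x) (\<lambda>i. q (X i))) \<noteq> 0"
    using U_ind gram_q unfolding U_eq[symmetric] U_def[of q] by (intro frame_det_nonzero_of_ind)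
  have quad: "4 * sqd r v x = quad (gram_inv (r x) (\<lambda>i. r (X i))) (sqdists (r x) (\<lambda>i. r (X i))) (\<chi> i. U r i)"
    if "det (frame_matrix (r x) (\<lambda>i. r (X i))) \<noteq> 0" for r :: "'v \<Rightarrow> real ^ 'd"
  proof -
    have "(\<chi> i. U r i) = sqdists (r v) (\<lambda>i. r (X i)) - (\<chi> i. (r v - r x) \<bullet> (r v - r x))"
      by (simp add: U_def sqdists_def vec_eq_iff)
    then show ?thesis using sqdist_quad[OF that, of "r v"] by (simp add: sqd_def)
  qed
  have "sqdists (p x) (\<lambda>i. p (X i)) = sqdists (q x) (\<lambda>i. q (X i))"
  proof (rule quad_unique(2)[OF U_ind])
    show "quad (gram_inv (p x) (\<lambda>i. p (X i))) (sqdists (p x) (\<lambda>i. p (X i))) (\<chi> i. U p i) =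
        quad (gram_inv (q x) (\<lambda>i. q (X i))) (sqdists (q x) (\<lambda>i. q (X i))) (\<chi> i. U p i)"
      using quad[OF X(2)] quad[OF det_q] equiv[OF xy(1)] by (simp add: U_eq)
    show "gram_inv (p x) (\<lambda>i. p (X i)) $ i $ j \<in> acl ?L" for i j
      by (rule gram_inv_acl[OF frame]) (use in_W in auto)
    show "gram_inv (q x) (\<lambda>i. q (X i)) $ i $ j \<in> acl ?L" for i j
      unfolding gram_inv_def using det_q gram_q by (intro acl_matrix_inv) (auto simp: det_gram)
    show "sqdists (p x) (\<lambda>i. p (X i)) $ i \<in> acl ?L" for i
      by (rule sqdists_frame_acl[OF frame]) (use in_W in auto)
    show "sqdists (q x) (\<lambda>i. q (X i)) $ i \<in> acl ?L" for i
      using linked[OF xy(1) XA] by (simp add: sqdists_def sqd_def)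
    show "gram_inv (p x) (\<lambda>i. p (X i)) $ i $ j = gram_inv (p x) (\<lambda>i. p (X i)) $ j $ i" for i j
      by (rule gram_inv_sym[OF X(2)])
    show "gram_inv (q x) (\<lambda>i. q (X i)) $ i $ j = gram_inv (q x) (\<lambda>i. q (X i)) $ j $ i" for i j
      by (rule gram_inv_sym[OF det_q])
    show "det (gram_inv (p x) (\<lambda>i. p (X i))) \<noteq> 0" by (rule det_gram_inv[OF X(2)])
  qed
  then show ?thesis using j by (simp add: sqdists_def sqd_def vec_eq_iff) metis
qed simp

text \<open>Trilateration: equal Gram matrices make the frame affinely independent in
  \<open>q\<close> too, and the products of \<open>u\<close> and \<open>w\<close> with the frame
  vectors determine their mutual inner product.\<close>

lemma sqd_determined_by_frame:
  fixes p q :: "'v \<Rightarrow> real ^ 'd"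
  assumes gen: "generic_on V p" and B: "B \<subseteq> V" "card B = CARD('d) + 1"
    and eqB: "\<And>x y. x \<in> B \<Longrightarrow> y \<in> B \<Longrightarrow> sqd q x y = sqd p x y"
    and equ: "\<And>x. x \<in> B \<Longrightarrow> sqd q u x = sqd p u x" and eqw: "\<And>x. x \<in> B \<Longrightarrow> sqd q w x = sqd p w x"
  shows "sqd q u w = sqd p u w"
proof -
  have "B \<noteq> {}" using B(2) by auto
  then obtain x where x: "x \<in> B" by blast
  obtain X where X: "bij_betw X UNIV (B - {x})" "det (frame_matrix (p x) (\<lambda>i. p (X i))) \<noteq> 0"
    by (rule full_frame[OF gen B(1) B(2) x])
  have XB: "X i \<in> B" for i using X(1) by (auto simp: bij_betw_def)
  have gram: "(q (X i) - q x) \<bullet> (q (X j) - q x) = (p (X i) - p x) \<bullet> (p (X j) - p x)" for i j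
    using XB x eqB by (simp add: inner_sqd)
  then have "(det (frame_matrix (q x) (\<lambda>i. q (X i))))\<^sup>2 = (det (frame_matrix (p x) (\<lambda>i. p (X i))))\<^sup>2"
    unfolding det_gram[symmetric] by simp
  then have det_q: "det (frame_matrix (q x) (\<lambda>i. q (X i))) \<noteq> 0" using X(2) by auto
  have N: "gram_inv (q x) (\<lambda>i. q (X i)) = gram_inv (p x) (\<lambda>i. p (X i))"
    by (simp add: gram_inv_def gram)
  have "frame_matrix (q x) (\<lambda>i. q (X i)) *v (q z - q x) = frame_matrix (p x) (\<lambda>i. p (X i)) *v (p z - p x)"
    if "z \<in> {u, w}" for z
  proof -
    have z: "sqd q z b = sqd p z b" if "b \<in> B" for b
      using \<open>z \<in> {u, w}\<close> that equ eqw by blast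
    then have "sqd q (X i) z = sqd p (X i) z" for i using XB by (metis sqd_commute)
    then show ?thesis using z x XB eqB by (simp add: vec_eq_iff frame_matrix_mult inner_sqd)
  qed
  then have "(q u - q x) \<bullet> (q w - q x) = (p u - p x) \<bullet> (p w - p x)"
    unfolding gram_inv_inner[OF det_q, of "q u - q x"] gram_inv_inner[OF X(2), of "p u - p x"] N
    by simp
  then show ?thesis using equ eqw x by (simp add: sqd_inner[of _ u w x])
qed

subsection \<open>Counting merging families and averaging over orderings\<close>

text \<open>The family of all subsets of \<open>N\<close> minus a point attains the bound. For
  \<open>s = 0\<close>, members covering \<open>N\<close> would merge to \<open>N\<close>, so some
  point lies in none. Otherwise, for a suitable \<open>x\<close>, the members avoiding
  \<open>x\<close> and the link of \<open>x\<close> satisfy the hypotheses on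
  \<open>N - {x}\<close>, the link with \<open>s\<close> and \<open>j\<close> lowered by one, and
  Pascal's rule adds the two bounds.\<close>

lemma merging_family_card_le:
  fixes F :: "'a set \<Rightarrow> bool"
  assumes "finite N" "\<not> F N" "s < j"
    and "\<And>A B. B \<subseteq> N \<Longrightarrow> F B \<Longrightarrow> A \<subseteq> B \<Longrightarrow> F A"
    and "\<And>A B. A \<subseteq> N \<Longrightarrow> B \<subseteq> N \<Longrightarrow> F A \<Longrightarrow> F B \<Longrightarrow> s \<le> card (A \<inter> B) \<Longrightarrow> F (A \<union> B)"
  shows "card {A. A \<subseteq> N \<and> card A = j \<and> F A} \<le> (card N - 1) choose j"
  using assms
proof (induction "card N" arbitrary: N F s j rule: less_induct)
  case less
  note fin = less.prems(1) and nF = less.prems(2) and sj = less.prems(3)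
    and down = less.prems(4) and merge = less.prems(5)
  show ?case
  proof (cases "card N \<le> j")
    case True
    have "{A. A \<subseteq> N \<and> card A = j \<and> F A} = {}"
    proof (rule ccontr)
      assume "{A. A \<subseteq> N \<and> card A = j \<and> F A} \<noteq> {}"
      then obtain A where A: "A \<subseteq> N" "card A = j" "F A" by blast
      then have "A = N" using True fin by (intro card_seteq) auto
      then show False using A nF by simp
    qed
    then show ?thesis by (simp only: card.empty)
  next
    case False
    then have card_N: "j < card N" by simp
    show ?thesis
    proof (cases s)
      case 0
      have "\<exists>x\<in>N. \<forall>A\<subseteq>N. F A \<longrightarrow> x \<notin> A"
      proof (rule ccontr)
        assume "\<not> ?thesis"
        then have cov: "\<exists>A\<subseteq>N. F A \<and> x \<in> A" if "x \<in> N" for x using that by blast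
        have "\<exists>A\<subseteq>N. F A \<and> M \<subseteq> A" if "finite M" "M \<subseteq> N" for M
          using that
        proof (induction M rule: finite_induct)
          case empty
          have "N \<noteq> {}" using card_N by auto
          then obtain x where "x \<in> N" by blast
          from cov[OF this] show ?case by blast
        next
          case (insert x M)
          then obtain A where "A \<subseteq> N" "F A" "M \<subseteq> A" by blast
          moreover have "x \<in> N" using insert.prems by simp
          from cov[OF this] obtain B where "B \<subseteq> N" "F B" "x \<in> B" by blast
          ultimately show ?case using merge[of A B] 0 by (intro exI[of _ "A \<union> B"]) auto
        qed
        from this[OF fin order.refl] show False using nF by (metis subset_antisym)
      qed
      then obtain x where x: "x \<in> N" "\<And>A. A \<subseteq> N \<Longrightarrow> F A \<Longrightarrow> x \<notin> A" by blast
      then have "{A. A \<subseteq> N \<and> card A = j \<and> F A} \<subseteq> {A. A \<subseteq> N - {x} \<and> card A = j}" by blast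
      then have "card {A. A \<subseteq> N \<and> card A = j \<and> F A} \<le> card {A. A \<subseteq> N - {x} \<and> card A = j}"
        using fin by (intro card_mono) auto
      also have "\<dots> = (card N - 1) choose j"
        using fin x(1) by (simp add: n_subsets card_Diff_singleton)
      finally show ?thesis .
    next
      case (Suc s')
      \<comment> \<open>Otherwise two sets \<open>N - {x}\<close> and \<open>N - {y}\<close>,
        sharing |N| - 2 >= s points, would merge to \<open>N\<close>.\<close>
      have "\<exists>x\<in>N. \<not> F (N - {x})"
      proof (rule ccontr)
        assume all: "\<not> (\<exists>x\<in>N. \<not> F (N - {x}))"
        have "1 < card N" using card_N sj by simp
        then obtain x y where xy: "x \<in> N" "y \<in> N" "x \<noteq> y"
          using card_le_Suc0_iff_eq[OF fin] by (metis One_nat_def not_le)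
        have "(N - {x}) \<inter> (N - {y}) = N - {x, y}" by blast
        then have "card ((N - {x}) \<inter> (N - {y})) = card N - 2"
          using xy fin by (simp add: card_Diff_subset)
        then have "F ((N - {x}) \<union> (N - {y}))"
          using all xy card_N sj by (intro merge) auto
        moreover have "(N - {x}) \<union> (N - {y}) = N" using xy by blast
        ultimately show False using nF by simp
      qed
      then obtain x where x: "x \<in> N" "\<not> F (N - {x})" by blast
      let ?M = "N - {x}"
      have card_M: "card ?M = card N - 1" "card ?M < card N"
        using x(1) fin card_N by (simp_all add: card_Diff_singleton)
      have del: "card {A. A \<subseteq> ?M \<and> card A = j \<and> F A} \<le> (card ?M - 1) choose j"
      proof (rule less.hyps[of ?M F s j])
        show "F A" if "B \<subseteq> ?M" "F B" "A \<subseteq> B" for A B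
          by (rule down[of B A]) (use that in auto)
        show "F (A \<union> B)" if "A \<subseteq> ?M" "B \<subseteq> ?M" "F A" "F B" "s \<le> card (A \<inter> B)" for A B
          by (rule merge) (use that in auto)
      qed (use card_M x sj fin in auto)
      have link: "card {A. A \<subseteq> ?M \<and> card A = j - 1 \<and> F (insert x A)} \<le> (card ?M - 1) choose (j - 1)"
      proof (rule less.hyps[of ?M "\<lambda>A. F (insert x A)" s' "j - 1"])
        show "\<not> F (insert x (N - {x}))" using nF x(1) by (simp add: insert_absorb)
        show "s' < j - 1" using Suc sj by simp
        show "F (insert x A)" if "B \<subseteq> N - {x}" "F (insert x B)" "A \<subseteq> B" for A B
          using that x(1) by (intro down[of "insert x B" "insert x A"]) auto
        show "F (insert x (A \<union> B))" if "A \<subseteq> N - {x}" "B \<subseteq> N - {x}" "F (insert x A)" "F (insert x B)"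
          "s' \<le> card (A \<inter> B)" for A B
        proof -
          have "insert x A \<inter> insert x B = insert x (A \<inter> B)" by blast
          moreover have "x \<notin> A \<inter> B" "finite (A \<inter> B)"
            using that(1) fin finite_subset[of "A \<inter> B" N] by auto
          ultimately have "s \<le> card (insert x A \<inter> insert x B)" using that(5) Suc by simp
          then have "F (insert x A \<union> insert x B)" using that x(1) by (intro merge) auto
          then show ?thesis by (simp add: insert_commute)
        qed
      qed (use card_M fin in auto)
      have "{A. A \<subseteq> N \<and> card A = j \<and> F A} \<subseteq> {A. A \<subseteq> ?M \<and> card A = j \<and> F A} \<union>
          insert x ` {A. A \<subseteq> ?M \<and> card A = j - 1 \<and> F (insert x A)}" (is "_ \<subseteq> ?D \<union> insert x ` ?L")
      proof
        fix A assume A: "A \<in> {A. A \<subseteq> N \<and> card A = j \<and> F A}"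
        show "A \<in> ?D \<union> insert x ` ?L"
        proof (cases "x \<in> A")
          case True
          then have "insert x (A - {x}) = A" by blast
          moreover have "finite A" using A fin finite_subset by blast
          ultimately have "A - {x} \<in> ?L" using A True by (auto simp: card_Diff_singleton)
          with \<open>insert x (A - {x}) = A\<close> show ?thesis by blast
        qed (use A in auto)
      qed
      then have "card {A. A \<subseteq> N \<and> card A = j \<and> F A} \<le> card (?D \<union> insert x ` ?L)"
        using fin by (intro card_mono) auto
      also have "\<dots> \<le> card ?D + card ?L"
        using card_Un_le[of ?D "insert x ` ?L"] card_image_le[of ?L "insert x"] fin by fastforce
      also have "\<dots> \<le> ((card ?M - 1) choose j) + ((card ?M - 1) choose (j - 1))"
        using del link by linarith
      also have "\<dots> = (card N - 1) choose j"
      proof -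
        obtain m where m: "card N - 1 = Suc m" using card_N sj by (cases "card N - 1") auto
        obtain i where i: "j = Suc i" using sj by (cases j) auto
        show ?thesis using m i card_M by (simp add: choose_reduce_nat)
      qed
      finally show ?thesis .
    qed
  qed
qed

text \<open>\<open>order_wt m w\<close> is the probability that, in a random ordering of \<open>m + 1\<close> elements, the elements
  preceding a given one form a given set of size \<open>w\<close>.\<close>

definition order_wt :: "nat \<Rightarrow> nat \<Rightarrow> real" where
  "order_wt m w = fact w * fact (m - w) / fact (m + 1)"

text \<open>One more element either follows or precedes the given one.\<close>

lemma order_wt_Suc:
  assumes "w \<le> m"
  shows "order_wt (Suc m) w + order_wt (Suc m) (Suc w) = order_wt m w"
proof -
  have "fact w * fact (Suc m - w) + fact (Suc w) * fact (m - w) = (real m + 2) * (fact w * fact (m - w))"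
    using assms by (simp add: Suc_diff_le of_nat_diff algebra_simps)
  then show ?thesis unfolding order_wt_def
    by (simp add: add_divide_distrib[symmetric] divide_simps)
qed

text \<open>The position of the given element is uniform among \<open>m + 1\<close> places.\<close>

lemma order_wt_choose:
  assumes "w \<le> m"
  shows "of_nat (m choose w) * order_wt m w = 1 / (real m + 1)"
proof -
  have "of_nat (fact w * fact (m - w) * (m choose w)) = (of_nat (fact m) :: real)"
    using binomial_fact_lemma[OF assms] by simp
  then have "of_nat (m choose w) * (fact w * fact (m - w)) = (fact m :: real)"
    by (simp add: mult_ac)
  then have "of_nat (m choose w) * order_wt m w = fact m / fact (m + 1)"
    unfolding order_wt_def by (metis times_divide_eq_right)
  then show ?thesis by (simp add: add.commute)
qed

lemma order_wt_nonneg: "0 \<le> order_wt m w"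
  by (simp add: order_wt_def)

lemma Pow_insert_sum:
  assumes "finite X" "z \<notin> X"
  shows "(\<Sum>W\<in>Pow (insert z X). f W) = (\<Sum>W\<in>Pow X. f W + f (insert z W))"
proof -
  have "Pow X \<inter> insert z ` Pow X = {}" using assms(2) by blast
  then have "(\<Sum>W\<in>Pow (insert z X). f W) = (\<Sum>W\<in>Pow X. f W) + (\<Sum>W\<in>insert z ` Pow X. f W)"
    unfolding Pow_insert using assms(1) by (intro sum.union_disjoint) auto
  also have "(\<Sum>W\<in>insert z ` Pow X. f W) = (\<Sum>W\<in>Pow X. f (insert z W))"
    using assms(2) by (intro sum.reindex_cong[of "insert z"]) (auto simp: inj_on_def)
  finally show ?thesis by (simp add: sum.distrib)
qed

text \<open>A random ordering restricted to the given element and \<open>N\<close> is again uniform;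
  the elements of \<open>Z\<close> are summed out one by one.\<close>

lemma order_wt_restrict:
  assumes "finite Z" "finite N" "Z \<inter> N = {}"
  shows "(\<Sum>W\<in>Pow (Z \<union> N). order_wt (card (Z \<union> N)) (card W) * f (W \<inter> N)) =
    (\<Sum>A\<in>Pow N. order_wt (card N) (card A) * f A)"
  using assms(1,3)
proof (induction Z rule: finite_induct)
  case empty
  show ?case by (intro sum.cong) (auto simp: Int_absorb2)
next
  case (insert z Z)
  let ?X = "Z \<union> N"
  have X: "finite ?X" "z \<notin> ?X" using insert assms(2) by auto
  have "(\<Sum>W\<in>Pow (insert z Z \<union> N). order_wt (card (insert z Z \<union> N)) (card W) * f (W \<inter> N)) =
      (\<Sum>W\<in>Pow ?X. order_wt (Suc (card ?X)) (card W) * f (W \<inter> N) +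
        order_wt (Suc (card ?X)) (card (insert z W)) * f (insert z W \<inter> N))"
    using X by (simp add: Pow_insert_sum)
  also have "\<dots> = (\<Sum>W\<in>Pow ?X. order_wt (card ?X) (card W) * f (W \<inter> N))"
  proof (rule sum.cong[OF refl])
    fix W assume W: "W \<in> Pow ?X"
    then have "finite W" "z \<notin> W" using X finite_subset by auto
    moreover have "insert z W \<inter> N = W \<inter> N" using insert.prems by blast
    moreover have "card W \<le> card ?X" using W X by (intro card_mono) auto
    ultimately show "order_wt (Suc (card ?X)) (card W) * f (W \<inter> N) +
        order_wt (Suc (card ?X)) (card (insert z W)) * f (insert z W \<inter> N) =
        order_wt (card ?X) (card W) * f (W \<inter> N)"
      by (simp add: order_wt_Suc flip: distrib_right)
  qed
  also have "\<dots> = (\<Sum>A\<in>Pow N. order_wt (card N) (card A) * f A)"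
    using insert.IH insert.prems by blast
  finally show ?case .
qed

text \<open>Averaging the telescoping sum of \<open>r\<close> along an ordering of \<open>V\<close> over all orderings.\<close>

lemma order_wt_telescope:
  fixes r :: "'a set \<Rightarrow> real"
  assumes "finite V"
  shows "(\<Sum>v\<in>V. \<Sum>W\<in>Pow (V - {v}). order_wt (card V - 1) (card W) * (r (insert v W) - r W)) = r V - r {}"
proof (cases "V = {}")
  case False
  define n where "n = card V"
  have n: "n > 0" using assms False by (auto simp: n_def card_gt_0_iff)
  \<comment> \<open>The probability that \<open>W\<close> is an initial segment. A proper nonempty
    \<open>W\<close> gets this weight with sign plus through its last element and with sign minus
    through the element following it.\<close>
  define c where "c W = fact (card W) * fact (n - card W) / (fact n :: real)" for W :: "'a set"
  have card_ins: "card (insert v W) = Suc (card W)" if "W \<subseteq> V - {v}" for v W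
  proof -
    have "finite W" using that assms by (meson finite_Diff finite_subset)
    then show ?thesis using that by (subst card_insert_disjoint) auto
  qed
  have "(\<Sum>v\<in>V. \<Sum>W\<in>Pow (V - {v}). order_wt (n - 1) (card W) * r (insert v W)) =
      (\<Sum>(v, W)\<in>(SIGMA v:V. Pow (V - {v})). order_wt (n - 1) (card W) * r (insert v W))"
    using assms by (intro sum.Sigma) auto
  also have "\<dots> = (\<Sum>(W, v)\<in>(SIGMA W:Pow V. W). order_wt (n - 1) (card W - 1) * r W)"
    using assms
    by (intro sum.reindex_bij_witness[of _ "\<lambda>(W, v). (v, W - {v})" "\<lambda>(v, W). (insert v W, v)"])
      (auto simp: insert_absorb card_ins)
  also have "\<dots> = (\<Sum>W\<in>Pow V. \<Sum>v\<in>W. order_wt (n - 1) (card W - 1) * r W)"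
    using assms by (intro sum.Sigma[symmetric]) (auto intro: finite_subset)
  also have "\<dots> = (\<Sum>W\<in>Pow V - {{}}. c W * r W)"
  proof (rule sum.mono_neutral_cong_right)
    fix W assume W: "W \<in> Pow V - {{}}"
    then have "finite W" "W \<noteq> {}" using assms finite_subset by auto
    moreover have "card W \<le> n" using W assms by (auto simp: n_def intro: card_mono)
    ultimately obtain w where w: "card W = Suc w" "w < n" by (cases "card W") auto
    obtain k where k: "n = Suc k" using n by (cases n) auto
    show "(\<Sum>v\<in>W. order_wt (n - 1) (card W - 1) * r W) = c W * r W"
      using w k by (simp add: c_def order_wt_def)
  qed (use assms in auto)
  finally have 1: "(\<Sum>v\<in>V. \<Sum>W\<in>Pow (V - {v}). order_wt (n - 1) (card W) * r (insert v W)) =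
      (\<Sum>W\<in>Pow V - {{}}. c W * r W)" .
  have "(\<Sum>v\<in>V. \<Sum>W\<in>Pow (V - {v}). order_wt (n - 1) (card W) * r W) =
      (\<Sum>(v, W)\<in>(SIGMA v:V. Pow (V - {v})). order_wt (n - 1) (card W) * r W)"
    using assms by (intro sum.Sigma) auto
  also have "\<dots> = (\<Sum>(W, v)\<in>(SIGMA W:Pow V. V - W). order_wt (n - 1) (card W) * r W)"
    by (intro sum.reindex_bij_witness[of _ "\<lambda>(W, v). (v, W)" "\<lambda>(v, W). (W, v)"]) auto
  also have "\<dots> = (\<Sum>W\<in>Pow V. \<Sum>v\<in>V - W. order_wt (n - 1) (card W) * r W)"
    using assms by (intro sum.Sigma[symmetric]) auto
  also have "\<dots> = (\<Sum>W\<in>Pow V - {V}. c W * r W)"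
  proof (rule sum.mono_neutral_cong_right)
    fix W assume W: "W \<in> Pow V - {V}"
    then have fin: "finite W" using assms finite_subset by auto
    have "card W < n" using W assms unfolding n_def by (intro psubset_card_mono) auto
    moreover have "card (V - W) = n - card W" using W fin by (simp add: n_def card_Diff_subset)
    moreover obtain k where k: "n = Suc k" using n by (cases n) auto
    ultimately show "(\<Sum>v\<in>V - W. order_wt (n - 1) (card W) * r W) = c W * r W"
      by (simp add: c_def order_wt_def Suc_diff_le less_Suc_eq_le)
  qed (use assms in auto)
  finally have 2: "(\<Sum>v\<in>V. \<Sum>W\<in>Pow (V - {v}). order_wt (n - 1) (card W) * r W) =
      (\<Sum>W\<in>Pow V - {V}. c W * r W)" .
  have "(\<Sum>W\<in>Pow V - {{}}. c W * r W) = (\<Sum>W\<in>Pow V. c W * r W) - r {}"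
    using assms by (subst sum_diff1) (auto simp: c_def)
  moreover have "(\<Sum>W\<in>Pow V - {V}. c W * r W) = (\<Sum>W\<in>Pow V. c W * r W) - r V"
    using assms by (subst sum_diff1) (auto simp: c_def n_def)
  ultimately show ?thesis
    using 1 2 unfolding n_def by (simp add: right_diff_distrib sum_subtractf)
qed simp

section \<open>The expected contribution of one vertex\<close>

lemma sum_min_atMost:
  assumes "d \<le> D"
  shows "(\<Sum>j\<le>D. real (min d j)) = real d * (real D + 1) - real d * (real d + 1) / 2"
  using assms
proof (induction D rule: dec_induct)
  case base
  have "(\<Sum>j\<le>d. real (min d j)) = (\<Sum>j\<le>d. real j)" by (intro sum.cong) auto
  also have "\<dots> = real d * (real d + 1) / 2"
    by (induction d) (auto simp: field_simps)
  finally show ?case by (simp add: field_simps)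
next
  case (step D)
  then show ?case by (simp add: field_simps)
qed

lemma sum_tail_atMost:
  assumes "d \<le> D"
  shows "(\<Sum>j\<le>D. if d < j then real j else 0) = (real D * (real D + 1) - real d * (real d + 1)) / 2"
  using assms
proof (induction D rule: dec_induct)
  case base
  then show ?case by (simp add: sum.neutral)
next
  case (step D)
  then show ?case by (simp add: field_simps)
qed

text \<open>The sum is sorted by the size \<open>j\<close> of \<open>A\<close>. For
  \<open>d < j\<close>, the merging bound leaves at least (D - 1) choose (j - 1) of the
  \<open>j\<close>-sets outside \<open>F\<close>, a fraction j / D of all of them.\<close>

lemma order_wt_vertex_sum:
  fixes F :: "'a set \<Rightarrow> bool"
  assumes "finite N" "d \<ge> 1" "d * (d + 1) \<le> card N" "\<not> F N"
    and "\<And>A B. B \<subseteq> N \<Longrightarrow> F B \<Longrightarrow> A \<subseteq> B \<Longrightarrow> F A"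
    and "\<And>A B. A \<subseteq> N \<Longrightarrow> B \<subseteq> N \<Longrightarrow> F A \<Longrightarrow> F B \<Longrightarrow> d \<le> card (A \<inter> B) \<Longrightarrow> F (A \<union> B)"
  shows "real d \<le> (\<Sum>A\<in>Pow N. order_wt (card N) (card A) *
    (real (min d (card A)) + of_bool (d < card A \<and> \<not> F A)))"
proof -
  define D where "D = card N"
  have "1 * (d + 1) \<le> d * (d + 1)" using assms(2) by (intro mult_right_mono) auto
  then have "d + 1 \<le> D" using assms(3) unfolding D_def by (metis le_trans mult_1)
  then have dD: "d < D" by simp
  let ?lev = "\<lambda>j. {A \<in> Pow N. card A = j}"
  let ?f = "\<lambda>A. order_wt D (card A) * (real (min d (card A)) + of_bool (d < card A \<and> \<not> F A))"
  have levels: "(\<Sum>A\<in>Pow N. ?f A) = (\<Sum>j\<le>D. \<Sum>A\<in>?lev j. ?f A)"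
    using assms(1) by (intro sum.group[symmetric]) (auto simp: D_def intro: card_mono)
  have level_ge: "(real (min d j) + (if d < j then real j / real D else 0)) / (real D + 1)
      \<le> (\<Sum>A\<in>?lev j. ?f A)" if j: "j \<in> {..D}" for j
  proof -
    have fin_lev: "finite (?lev j)" using assms(1) by auto
    have card_lev: "card (?lev j) = D choose j"
      using n_subsets[OF assms(1), of j] by (simp add: D_def Pow_def)
    have "(\<Sum>A\<in>?lev j. ?f A) =
        (\<Sum>A\<in>?lev j. order_wt D j * real (min d j)) + (\<Sum>A\<in>?lev j. order_wt D j * of_bool (d < j \<and> \<not> F A))"
      unfolding sum.distrib[symmetric] by (intro sum.cong) (auto simp: distrib_left)
    also have "(\<Sum>A\<in>?lev j. order_wt D j * real (min d j)) =
        real (min d j) * (real (D choose j) * order_wt D j)"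
      by (simp only: sum_constant card_lev mult_ac)
    also have "real (min d j) * (real (D choose j) * order_wt D j) = real (min d j) / (real D + 1)"
      using j by (simp add: order_wt_choose)
    finally have eq: "(\<Sum>A\<in>?lev j. ?f A) = real (min d j) / (real D + 1) +
        (\<Sum>A\<in>?lev j. order_wt D j * of_bool (d < j \<and> \<not> F A))" .
    have "(if d < j then real j / real D else 0) / (real D + 1) \<le>
        (\<Sum>A\<in>?lev j. order_wt D j * of_bool (d < j \<and> \<not> F A))"
    proof (cases "d < j")
      case True
      have "card {A. A \<subseteq> N \<and> card A = j \<and> F A} \<le> (D - 1) choose j"
        unfolding D_def by (rule merging_family_card_le[OF assms(1,4) True assms(5,6)])
      moreover have "{A \<in> ?lev j. \<not> F A} = ?lev j - {A. A \<subseteq> N \<and> card A = j \<and> F A}" by auto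
      moreover have "{A. A \<subseteq> N \<and> card A = j \<and> F A} \<subseteq> ?lev j" by auto
      ultimately have "(D choose j) \<le> card {A \<in> ?lev j. \<not> F A} + ((D - 1) choose j)"
        using card_lev fin_lev card_Diff_subset[of "{A. A \<subseteq> N \<and> card A = j \<and> F A}" "?lev j"]
        by (simp add: finite_subset)
      moreover have "(D choose j) = ((D - 1) choose (j - 1)) + ((D - 1) choose j)"
        using True dD by (intro choose_reduce_nat) auto
      ultimately have ge: "((D - 1) choose (j - 1)) \<le> card {A \<in> ?lev j. \<not> F A}" by linarith
      have "j * (D choose j) = D * ((D - 1) choose (j - 1))"
        using True by (intro times_binomial_minus1_eq) auto
      then have "real j * real (D choose j) = real D * real ((D - 1) choose (j - 1))"
        by (metis of_nat_mult)
      then have "real ((D - 1) choose (j - 1)) = real j / real D * real (D choose j)"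
        using dD by (simp add: field_simps)
      then have "real ((D - 1) choose (j - 1)) * order_wt D j = real j / real D * (1 / (real D + 1))"
        using order_wt_choose[of j D] j by (simp add: mult.assoc)
      then have "real j / real D / (real D + 1) = real ((D - 1) choose (j - 1)) * order_wt D j"
        by simp
      also have "\<dots> \<le> real (card {A \<in> ?lev j. \<not> F A}) * order_wt D j"
        using ge order_wt_nonneg by (intro mult_right_mono) auto
      also have "\<dots> = (\<Sum>A\<in>{A \<in> ?lev j. \<not> F A}. order_wt D j)" by simp
      also have "\<dots> = (\<Sum>A\<in>?lev j. order_wt D j * of_bool (d < j \<and> \<not> F A))"
        using True fin_lev by (intro sum.mono_neutral_cong_left) auto
      finally show ?thesis using True by simp
    qed (simp add: sum_nonneg order_wt_nonneg)
    then show ?thesis unfolding eq add_divide_distrib by (rule add_left_mono)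
  qed
  have "(\<Sum>j\<le>D. (real (min d j) + (if d < j then real j / real D else 0)) / (real D + 1))
      \<le> (\<Sum>A\<in>Pow N. ?f A)"
    unfolding levels by (rule sum_mono[OF level_ge])
  moreover have "(\<Sum>j\<le>D. (real (min d j) + (if d < j then real j / real D else 0)) / (real D + 1)) =
      ((\<Sum>j\<le>D. real (min d j)) + (\<Sum>j\<le>D. if d < j then real j else 0) / real D) / (real D + 1)"
    by (simp add: sum_divide_distrib add_divide_distrib sum.distrib if_distrib[of "\<lambda>x. x / _"] cong: if_cong)
  moreover have "real d \<le> \<dots>"
  proof -
    \<comment> \<open>After multiplication by 2 D, the inequality still needed reads d (d + 1) (D +
      1) <= D (D + 1).\<close>
    have le: "real d * (real d + 1) \<le> real D"
      using assms(3) unfolding D_def by (metis of_nat_1 of_nat_add of_nat_le_iff of_nat_mult)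
    have "real d * (real d + 1) * (real D + 1) \<le> real D * (real D + 1)"
      using le by (intro mult_right_mono) auto
    then have "real d * (real d + 1) / 2 \<le> (real D * (real D + 1) - real d * (real d + 1)) / 2 / real D"
      using dD by (simp add: field_simps)
    then have "real d * (real D + 1) \<le> (real d * (real D + 1) - real d * (real d + 1) / 2) +
        (real D * (real D + 1) - real d * (real d + 1)) / 2 / real D" by linarith
    then show ?thesis
      using dD by (simp add: sum_min_atMost sum_tail_atMost pos_le_divide_eq)
  qed
  ultimately show ?thesis unfolding D_def by linarith
qed

subsection \<open>Globally linked pairs and connectivity\<close>

text \<open>Connectivity is phrased through cuts of an arbitrary relation, so that it applies to the
  globally linked pairs and to subsets of \<open>V\<close> without building a graph.\<close>

definition inseparable :: "nat \<Rightarrow> 'v set \<Rightarrow> ('v \<Rightarrow> 'v \<Rightarrow> bool) \<Rightarrow> bool" where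
  "inseparable k V adj \<longleftrightarrow> k < card V \<and>
     (\<forall>S X Y. S \<subseteq> V \<longrightarrow> card S < k \<longrightarrow> X \<noteq> {} \<longrightarrow> Y \<noteq> {} \<longrightarrow> X \<union> Y = V - S \<longrightarrow> X \<inter> Y = {} \<longrightarrow>
        (\<exists>x\<in>X. \<exists>y\<in>Y. adj x y))"

definition globally_linked ::
    "'v set \<Rightarrow> ('v \<Rightarrow> 'v \<Rightarrow> bool) \<Rightarrow> ('v \<Rightarrow> real ^ 'd) \<Rightarrow> 'v \<Rightarrow> 'v \<Rightarrow> bool" where
  "globally_linked V adj p u v \<longleftrightarrow> u \<in> V \<and> v \<in> V \<and> u \<noteq> v \<and>
     (\<forall>q :: 'v \<Rightarrow> real ^ 'd. (\<forall>a\<in>V. \<forall>b\<in>V. adj a b \<longrightarrow> sqd q a b = sqd p a b) \<longrightarrow> sqd q u v = sqd p u v)"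

definition clique :: "('v \<Rightarrow> 'v \<Rightarrow> bool) \<Rightarrow> 'v set \<Rightarrow> bool" where
  "clique adj A \<longleftrightarrow> (\<forall>x\<in>A. \<forall>y\<in>A. x \<noteq> y \<longrightarrow> adj x y)"

lemma inseparableD:
  assumes "inseparable k V adj" "S \<subseteq> V" "card S < k" "X \<noteq> {}" "Y \<noteq> {}" "X \<union> Y = V - S" "X \<inter> Y = {}"
  shows "\<exists>x\<in>X. \<exists>y\<in>Y. adj x y"
  using assms(1)[unfolded inseparable_def, THEN conjunct2, rule_format, OF assms(2-7)] .

text \<open>Fewer than \<open>k\<close> neighbours would cut \<open>v\<close> off from the remaining
  vertices, which exist because \<open>k < card V\<close>.\<close>

lemma inseparable_degree:
  assumes "inseparable k V adj" "finite V" "v \<in> V"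
  shows "k \<le> card {u \<in> V - {v}. adj v u}"
proof (rule ccontr)
  let ?S = "{u \<in> V - {v}. adj v u}"
  assume "\<not> k \<le> card ?S"
  then have S: "card ?S < k" by simp
  have "card (insert v ?S) \<le> k" using S assms(2) by (simp add: card_insert_if)
  then have "V \<noteq> insert v ?S" using assms(1) by (auto simp: inseparable_def)
  then have "V - ?S - {v} \<noteq> {}" using assms(3) by blast
  then have "\<exists>x\<in>{v}. \<exists>y\<in>V - ?S - {v}. adj x y"
    using S assms(3) by (intro inseparableD[OF assms(1), of ?S]) auto
  then show False by blast
qed

text \<open>In a separation of \<open>V - {v}\<close>, \<open>v\<close> may be put on either side.
  Inseparability of \<open>V\<close> then gives it a neighbour on each side, and these two are
  adjacent by the clique hypothesis.\<close>

lemma inseparable_delete_simplicial: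
  assumes ins: "inseparable k V adj" and fin: "finite V" and v: "v \<in> V" and card: "k + 1 < card V"
    and sym: "\<And>x y. adj x y \<Longrightarrow> adj y x" and clique: "clique adj {u \<in> V - {v}. adj v u}"
  shows "inseparable k (V - {v}) adj"
  unfolding inseparable_def
proof (intro conjI allI impI)
  show "k < card (V - {v})" using card v fin by (simp add: card_Diff_singleton)
  fix S X Y
  assume S: "S \<subseteq> V - {v}" "card S < k" and XY: "X \<noteq> {}" "Y \<noteq> {}" "X \<union> Y = V - {v} - S" "X \<inter> Y = {}"
  show "\<exists>x\<in>X. \<exists>y\<in>Y. adj x y"
  proof (rule ccontr)
    assume none: "\<not> ?thesis"
    have sep: "\<exists>x\<in>X'. \<exists>y\<in>Y'. adj x y"
      if "X' \<noteq> {}" "Y' \<noteq> {}" "X' \<union> Y' = V - S" "X' \<inter> Y' = {}" for X' Y'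
      using S that by (intro inseparableD[OF ins, of S]) auto
    have "\<exists>x\<in>insert v X. \<exists>y\<in>Y. adj x y" using XY S v by (intro sep) auto
    then obtain y where y: "y \<in> Y" "adj v y" using none by auto
    have "\<exists>x\<in>X. \<exists>y\<in>insert v Y. adj x y" using XY S v by (intro sep) auto
    then obtain x where x: "x \<in> X" "adj v x" using none sym by auto
    have "x \<noteq> y" "x \<in> V - {v}" "y \<in> V - {v}" using x y XY by auto
    then have "adj x y" using clique x y by (auto simp: clique_def)
    then show False using none x y by blast
  qed
qed

lemma inseparable_complete:
  assumes "inseparable k V adj" "finite V" "card V = k + 1" "u \<in> V" "v \<in> V" "u \<noteq> v"
  shows "adj u v"
proof -
  have "card (V - {u, v}) = k - 1" "k > 0"
    using assms card_Diff_subset[of "{u, v}" V] card_mono[of V "{u, v}"] by auto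
  then have "\<exists>x\<in>{u}. \<exists>y\<in>{v}. adj x y"
    using assms(4-6) by (intro inseparableD[OF assms(1), of "V - {u, v}"]) auto
  then show ?thesis by simp
qed

lemma exists_subset_card:
  assumes "finite A" "m \<le> card A" "B \<subseteq> A" "card B \<le> m"
  obtains C where "B \<subseteq> C" "C \<subseteq> A" "card C = m"
  using exists_subset_between[of B m A] assms by blast

text \<open>The relation \<open>adj\<close> stands for an edge set already enlarged by its globally
  linked pairs, so showing that the distance of a non-edge is forced is a contradiction.\<close>

locale closed_framework =
  fixes V :: "'v set" and p :: "'v \<Rightarrow> real ^ 'd" and adj :: "'v \<Rightarrow> 'v \<Rightarrow> bool"
  assumes fin: "finite V" and generic: "generic_on V p"
    and adj_in: "\<And>u v. adj u v \<Longrightarrow> u \<in> V \<and> v \<in> V \<and> u \<noteq> v"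
    and adj_sym: "\<And>u v. adj u v \<Longrightarrow> adj v u"
    and closed: "\<And>u v. u \<in> V \<Longrightarrow> v \<in> V \<Longrightarrow> u \<noteq> v \<Longrightarrow>
      (\<And>q :: 'v \<Rightarrow> real ^ 'd. (\<And>a b. adj a b \<Longrightarrow> sqd q a b = sqd p a b) \<Longrightarrow> sqd q u v = sqd p u v) \<Longrightarrow>
      adj u v"
begin

definition nbrs :: "'v \<Rightarrow> 'v set" where
  "nbrs v = {u. adj v u}"

definition edges_in :: "'v set \<Rightarrow> ('v \<times> 'v) set" where
  "edges_in W = {(x, y). x \<in> W \<and> y \<in> W \<and> adj x y}"

definition edge_rk :: "'v set \<Rightarrow> nat" where
  "edge_rk W = rk ((\<lambda>(x, y). sqd p x y) ` edges_in W)"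

lemma nbrs_subset: "nbrs v \<subseteq> V - {v}"
  using adj_in by (auto simp: nbrs_def)

lemma finite_nbrs: "finite (nbrs v)"
  using fin nbrs_subset finite_subset by blast

lemma finite_edges_in: "W \<subseteq> V \<Longrightarrow> finite (edges_in W)"
  by (rule finite_subset[of _ "W \<times> W"]) (auto simp: edges_in_def fin finite_subset)

text \<open>Together with \<open>v\<close>, d common vertices form a frame whose inner distances and
  distances to \<open>x\<close> and \<open>y\<close> are all fixed, and trilateration fixes the
  distance of \<open>x\<close> and \<open>y\<close>. Adjacency to \<open>v\<close> is what saves one
  common vertex.\<close>

lemma clique_merge:
  assumes A: "A \<subseteq> nbrs v" "clique adj A" and B: "B \<subseteq> nbrs v" "clique adj B"
    and card: "CARD('d) \<le> card (A \<inter> B)"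
  shows "clique adj (A \<union> B)"
proof -
  have cross: "adj x y" if xy: "x \<in> A" "y \<in> B" "x \<noteq> y" for x y
  proof (rule closed)
    show "x \<in> V" "y \<in> V" "x \<noteq> y" using xy A B nbrs_subset by auto
    fix q :: "'v \<Rightarrow> real ^ 'd" assume q: "\<And>a b. adj a b \<Longrightarrow> sqd q a b = sqd p a b"
    have "finite (A \<inter> B)" using A finite_nbrs finite_subset by blast
    then obtain C where C: "C \<subseteq> A \<inter> B" "card C = CARD('d)"
      using card exists_subset_card[of "A \<inter> B" "CARD('d)" "{}"] by auto
    have finC: "finite C" using C(2) by (intro card_ge_0_finite) simp
    have vC: "v \<notin> C" using C A nbrs_subset by blast
    have "v \<in> V" using xy A adj_in by (auto simp: nbrs_def)
    have eq: "sqd q a b = sqd p a b" if "adj a b \<or> a = b" for a b using that q by auto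
    show "sqd q x y = sqd p x y"
    proof (rule sqd_determined_by_frame[OF generic])
      show "insert v C \<subseteq> V" using C A nbrs_subset \<open>v \<in> V\<close> by blast
      show "card (insert v C) = CARD('d) + 1" using finC vC C(2) by simp
      have nb: "adj v c" "adj c v" if "c \<in> A \<union> B" for c
        using that A B adj_sym by (auto simp: nbrs_def)
      show "sqd q a b = sqd p a b" if "a \<in> insert v C" "b \<in> insert v C" for a b
        using that nb C A(2) by (intro eq) (auto simp: clique_def subset_iff)
      show "sqd q x c = sqd p x c" if "c \<in> insert v C" for c
        using that nb C A(2) xy by (intro eq) (auto simp: clique_def subset_iff)
      show "sqd q y c = sqd p y c" if "c \<in> insert v C" for c
        using that nb C B(2) xy by (intro eq) (auto simp: clique_def subset_iff)
    qed
  qed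
  show ?thesis unfolding clique_def
  proof (intro ballI impI)
    fix x y assume "x \<in> A \<union> B" "y \<in> A \<union> B" "x \<noteq> y"
    then show "adj x y" using A(2) B(2) cross adj_sym unfolding clique_def by blast
  qed
qed

lemma edge_rk_insert:
  assumes v: "v \<in> V" and W: "W \<subseteq> V - {v}"
  defines "A \<equiv> W \<inter> nbrs v"
  shows "edge_rk W + min CARD('d) (card A) + of_bool (CARD('d) < card A \<and> \<not> clique adj A)
    \<le> edge_rk (insert v W)"
proof -
  let ?len = "\<lambda>(x, y). sqd p x y"
  define S where "S = ?len ` edges_in W"
  have finA: "finite A" unfolding A_def using finite_nbrs by blast
  have A: "A \<subseteq> W" "\<And>a. a \<in> A \<Longrightarrow> adj v a" by (auto simp: A_def nbrs_def)
  have finS: "finite S" unfolding S_def using W by (intro finite_imageI finite_edges_in) auto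
  have S: "S \<subseteq> acl (coords p W)" unfolding S_def edges_in_def by (auto intro: sqd_acl)
  have mono: "rk (S \<union> sqd p v ` B) \<le> edge_rk (insert v W)" if "B \<subseteq> A" for B
    unfolding edge_rk_def
  proof (rule rk_mono)
    have "S \<union> sqd p v ` B \<subseteq> ?len ` edges_in (insert v W)"
      using A that by (force simp: S_def edges_in_def)
    then show "S \<union> sqd p v ` B \<subseteq> acl (?len ` edges_in (insert v W))"
      using subset_acl by (rule order.trans)
    show "finite (S \<union> sqd p v ` B)" using finS finA finite_subset[OF that] by auto
    show "finite (?len ` edges_in (insert v W))" using v W by (intro finite_imageI finite_edges_in) auto
  qed
  have small: "edge_rk W + card B \<le> edge_rk (insert v W)" if B: "B \<subseteq> A" "card B \<le> CARD('d)" for B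
  proof -
    have finB: "finite B" using finA finite_subset[OF B(1)] by auto
    have "alg_ind (coords p W) (sqd p v) B"
      using new_vertex_sqd_ind[OF generic v W _ finB B(2)] B(1) A(1) by auto
    then have "alg_ind S (sqd p v) B" using S by (rule alg_ind_base_mono)
    then have "rk S + card B \<le> rk (S \<union> sqd p v ` B)" by (rule rk_alg_ind[OF finB finS])
    then show ?thesis using mono[OF B(1)] by (simp add: edge_rk_def S_def)
  qed
  show ?thesis
  proof (cases "CARD('d) < card A \<and> \<not> clique adj A")
    case False
    obtain B where "B \<subseteq> A" "card B = min CARD('d) (card A)"
      using exists_subset_card[OF finA, of "min CARD('d) (card A)" "{}"] by auto
    then show ?thesis using small[of B] False by auto
  next
    case True
    then obtain x y where xy: "x \<in> A" "y \<in> A" "x \<noteq> y" "\<not> adj x y" by (auto simp: clique_def)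
    have sub: "\<exists>C. {a, b} \<subseteq> C \<and> C \<subseteq> A \<and> card C = CARD('d) + 1" if "a \<in> A" "b \<in> A" for a b
    proof -
      have "card {a, b} \<le> CARD('d) + 1" by (cases "a = b") auto
      moreover have "CARD('d) + 1 \<le> card A" "{a, b} \<subseteq> A" using True that by auto
      ultimately obtain C where "{a, b} \<subseteq> C" "C \<subseteq> A" "card C = CARD('d) + 1"
        using exists_subset_card[OF finA] by metis
      then show ?thesis by blast
    qed
    \<comment> \<open>The transcendental pair need not be the non-adjacent one. If all pairs in
      \<open>A\<close> were algebraic over \<open>S\<close>, their lengths in every equivalent
      \<open>q\<close> would be too, and \<open>x\<close> and \<open>y\<close> would be
      linked.\<close>
    have "\<exists>a\<in>A. \<exists>b\<in>A. sqd p a b \<notin> acl S"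
    proof (rule ccontr)
      assume "\<not> ?thesis"
      then have linked: "sqd p a b \<in> acl S" if "a \<in> A" "b \<in> A" for a b using that by blast
      have "adj x y"
      proof (rule closed)
        show "x \<in> V" "y \<in> V" "x \<noteq> y" using xy A W by auto
        fix q :: "'v \<Rightarrow> real ^ 'd" assume q: "\<And>a b. adj a b \<Longrightarrow> sqd q a b = sqd p a b"
        obtain C where C: "{x, y} \<subseteq> C" "C \<subseteq> A" "card C = CARD('d) + 1"
          using sub[OF xy(1,2)] by blast
        show "sqd q x y = sqd p x y"
        proof (rule globally_linked_neighbours[OF generic v W _ C(3)])
          show "sqd q a b \<in> acl (coords p W)" if "a \<in> C" "b \<in> C" for a b
          proof -
            have "sqd q a b \<in> acl (?len ` edges_in W)"
            proof (rule linked_equivalent[OF generic])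
              show "edges_in W \<subseteq> V \<times> V" using W by (auto simp: edges_in_def)
              show "a \<in> V" "b \<in> V" using that C A(1) W by auto
              show "sqd p a b \<in> acl (?len ` edges_in W)"
                using linked[of a b] that C(2) unfolding S_def by blast
              show "sqd q x y = sqd p x y" if "(x, y) \<in> edges_in W" for x y
                using that by (intro q) (simp add: edges_in_def)
            qed
            then show ?thesis using acl_subset[OF S] unfolding S_def by blast
          qed
          show "sqd q v a = sqd p v a" if "a \<in> C" for a using that C A q by blast
        qed (use C A in auto)
      qed
      then show False using xy by simp
    qed
    then obtain a b where ab: "a \<in> A" "b \<in> A" "sqd p a b \<notin> acl S" by blast
    then have "a \<noteq> b" by auto
    obtain C where C: "{a, b} \<subseteq> C" "C \<subseteq> A" "card C = CARD('d) + 1"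
      using sub[OF ab(1,2)] by blast
    have "rk S + CARD('d) + 1 \<le> rk (S \<union> sqd p v ` C)"
      using C A(1) \<open>a \<noteq> b\<close> ab
      by (intro new_vertex_rk[OF generic v W _ C(3) _ _ _ finS S]) auto
    then show ?thesis using mono[OF C(2)] True by (simp add: edge_rk_def S_def)
  qed
qed

text \<open>Squared distances are polynomials in the coordinates relative to one fixed vertex
  \<open>w\<close>.\<close>

lemma edge_rk_le:
  assumes "V \<noteq> {}"
  shows "edge_rk V \<le> CARD('d) * (card V - 1)"
proof -
  obtain w where w: "w \<in> V" using assms by blast
  define C where "C = (\<lambda>(u, i). p u $ i - p w $ i) ` ((V - {w}) \<times> UNIV)"
  have finC: "finite C" using fin by (simp add: C_def)
  have C: "p u $ i - p w $ i \<in> acl C" if "u \<in> V" for u i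
  proof (cases "u = w")
    case False
    then show ?thesis using that by (intro acl_base) (force simp: C_def)
  qed simp
  have "edge_rk V \<le> card C"
    unfolding edge_rk_def
  proof (rule rk_le_card)
    show "(\<lambda>(x, y). sqd p x y) ` edges_in V \<subseteq> acl C"
    proof
      fix s assume "s \<in> (\<lambda>(x, y). sqd p x y) ` edges_in V"
      then obtain x y where xy: "x \<in> V" "y \<in> V" "s = sqd p x y" by (auto simp: edges_in_def)
      have "(p x - p y) $ i \<in> acl C" for i
        using acl_diff[OF C[OF xy(1), of i] C[OF xy(2), of i]] by simp
      then show "s \<in> acl C" unfolding xy(3) sqd_def by (intro acl_inner)
    qed
  qed (use finC finite_edges_in in auto)
  also have "\<dots> \<le> card ((V - {w}) \<times> (UNIV :: 'd set))"
    unfolding C_def using fin by (intro card_image_le) auto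
  also have "\<dots> = CARD('d) * (card V - 1)"
    using w fin by (simp add: card_cartesian_product card_Diff_singleton mult.commute)
  finally show ?thesis .
qed

lemma exists_simplicial:
  assumes ne: "V \<noteq> {}" and deg: "\<And>v. v \<in> V \<Longrightarrow> CARD('d) * (CARD('d) + 1) \<le> card (nbrs v)"
  obtains v where "v \<in> V" "clique adj (nbrs v)"
proof -
  define d where "d = CARD('d)"
  have d: "d \<ge> 1" unfolding d_def by (simp add: Suc_le_eq)
  have "\<exists>v\<in>V. clique adj (nbrs v)"
  proof (rule ccontr)
    assume "\<not> ?thesis"
    then have non: "\<not> clique adj (nbrs v)" if "v \<in> V" for v using that by blast
    define n where "n = card V"
    have n: "n > 0" using fin ne by (auto simp: n_def card_gt_0_iff)
    define f where "f A = real (min d (card A)) + of_bool (d < card A \<and> \<not> clique adj A)" for A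
    have "real d \<le> (\<Sum>W\<in>Pow (V - {v}). order_wt (n - 1) (card W) *
        (real (edge_rk (insert v W)) - real (edge_rk W)))" if v: "v \<in> V" for v
    proof -
      have "real d \<le> (\<Sum>A\<in>Pow (nbrs v). order_wt (card (nbrs v)) (card A) * f A)"
        unfolding f_def
      proof (rule order_wt_vertex_sum)
        show "clique adj A" if "clique adj B" "A \<subseteq> B" for A B
          using that unfolding clique_def by blast
        show "clique adj (A \<union> B)"
          if "A \<subseteq> nbrs v" "B \<subseteq> nbrs v" "clique adj A" "clique adj B" "d \<le> card (A \<inter> B)" for A B
          using that clique_merge unfolding d_def by blast
      qed (use finite_nbrs d deg[OF v] non[OF v] in \<open>auto simp: d_def\<close>)
      \<comment> \<open>Only earlier neighbours enter \<open>f\<close>, so averaging over the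
        neighbourhood agrees with averaging over all other vertices.\<close>
      also have "\<dots> = (\<Sum>W\<in>Pow (V - {v}). order_wt (n - 1) (card W) * f (W \<inter> nbrs v))"
      proof -
        have "V - {v} - nbrs v \<union> nbrs v = V - {v}" using nbrs_subset by blast
        moreover have "card (V - {v}) = n - 1" using v fin by (simp add: n_def card_Diff_singleton)
        moreover have "(V - {v} - nbrs v) \<inter> nbrs v = {}" by blast
        from order_wt_restrict[OF _ finite_nbrs this, of f]
        have "(\<Sum>W\<in>Pow (V - {v} - nbrs v \<union> nbrs v).
            order_wt (card (V - {v} - nbrs v \<union> nbrs v)) (card W) * f (W \<inter> nbrs v)) =
          (\<Sum>A\<in>Pow (nbrs v). order_wt (card (nbrs v)) (card A) * f A)"
          using fin by blast
        ultimately show ?thesis by (simp only:)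
      qed
      also have "\<dots> \<le> (\<Sum>W\<in>Pow (V - {v}). order_wt (n - 1) (card W) *
          (real (edge_rk (insert v W)) - real (edge_rk W)))"
      proof (intro sum_mono mult_left_mono order_wt_nonneg)
        fix W assume "W \<in> Pow (V - {v})"
        then have "edge_rk W + min d (card (W \<inter> nbrs v)) +
            of_bool (d < card (W \<inter> nbrs v) \<and> \<not> clique adj (W \<inter> nbrs v)) \<le> edge_rk (insert v W)"
          unfolding d_def by (intro edge_rk_insert[OF v]) auto
        then show "f (W \<inter> nbrs v) \<le> real (edge_rk (insert v W)) - real (edge_rk W)"
          unfolding f_def by (auto simp flip: of_nat_add split: if_splits)
      qed
      finally show ?thesis .
    qed
    then have "(\<Sum>v\<in>V. real d) \<le> (\<Sum>v\<in>V. \<Sum>W\<in>Pow (V - {v}). order_wt (n - 1) (card W) *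
        (real (edge_rk (insert v W)) - real (edge_rk W)))" by (rule sum_mono)
    also have "\<dots> = real (edge_rk V) - real (edge_rk {})"
      unfolding n_def by (rule order_wt_telescope[OF fin])
    also have "\<dots> \<le> real (edge_rk V)" by simp
    also have "\<dots> \<le> real (d * (n - 1))"
      using edge_rk_le[OF ne] by (simp only: of_nat_le_iff d_def n_def)
    finally have "real (n * d) \<le> real (d * (n - 1))" by (simp add: n_def)
    then have "n * d \<le> d * (n - 1)" by (simp only: of_nat_le_iff)
    then show False using d n by (simp add: mult.commute)
  qed
  then show thesis using that by blast
qed

end

text \<open>One enlargement suffices: a framework preserving the original edge lengths already
  preserves all globally linked ones.\<close>

lemma closed_framework_globally_linked:
  fixes p :: "'v \<Rightarrow> real ^ 'd"
  assumes "finite V" "generic_on V p"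
  shows "closed_framework V p (globally_linked V adj p)"
proof
  show "globally_linked V adj p u v"
    if "u \<in> V" "v \<in> V" "u \<noteq> v"
      and "\<And>q :: 'v \<Rightarrow> real ^ 'd. (\<And>a b. globally_linked V adj p a b \<Longrightarrow> sqd q a b = sqd p a b) \<Longrightarrow> sqd q u v = sqd p u v"
    for u v
    unfolding globally_linked_def using that(1-3)
  proof (intro conjI allI impI)
    fix q :: "'v \<Rightarrow> real ^ 'd" assume q: "\<forall>a\<in>V. \<forall>b\<in>V. adj a b \<longrightarrow> sqd q a b = sqd p a b"
    show "sqd q u v = sqd p u v"
    proof (rule that(4))
      fix a b assume "globally_linked V adj p a b"
      with q show "sqd q a b = sqd p a b" unfolding globally_linked_def by blast
    qed
  qed
  show "globally_linked V adj p v u" if uv: "globally_linked V adj p u v" for u v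
    unfolding globally_linked_def
  proof (intro conjI allI impI)
    show "v \<in> V" "u \<in> V" "v \<noteq> u" using uv by (auto simp: globally_linked_def)
    fix q :: "'v \<Rightarrow> real ^ 'd" assume "\<forall>a\<in>V. \<forall>b\<in>V. adj a b \<longrightarrow> sqd q a b = sqd p a b"
    with uv have "sqd q u v = sqd p u v" unfolding globally_linked_def by blast
    then show "sqd q v u = sqd p v u" by (metis sqd_commute)
  qed
  show "u \<in> V \<and> v \<in> V \<and> u \<noteq> v" if "globally_linked V adj p u v" for u v
    using that by (simp add: globally_linked_def)
qed (fact assms)+

text \<open>Adjacency varies in the induction because \<open>v\<close> is deleted from the graph of
  globally linked pairs; in the original graph its neighbourhood need not be a clique. The lengths
  of the enlarged graph agree in \<open>p\<close> and \<open>q\<close>, so the induction hypothesis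
  applies to the rest.\<close>

theorem inseparable_globally_rigid:
  fixes p q :: "'v \<Rightarrow> real ^ 'd"
  assumes "finite V" "generic_on V p" "inseparable (CARD('d) * (CARD('d) + 1)) V adj"
    and "\<And>a b. a \<in> V \<Longrightarrow> b \<in> V \<Longrightarrow> adj a b \<Longrightarrow> sqd q a b = sqd p a b"
    and "u \<in> V" "w \<in> V"
  shows "sqd q u w = sqd p u w"
  using assms
proof (induction "card V" arbitrary: V adj q u w rule: less_induct)
  case less
  note fin = less.prems(1) and gen = less.prems(2) and ins = less.prems(3) and equiv = less.prems(4)
  let ?k = "CARD('d) * (CARD('d) + 1)"
  let ?gl = "globally_linked V adj p"
  interpret closed_framework V p ?gl by (rule closed_framework_globally_linked[OF fin gen])
  have gl: "sqd q a b = sqd p a b" if "?gl a b" for a b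
    using that equiv unfolding globally_linked_def by blast
  have ins_gl: "inseparable ?k V ?gl"
    unfolding inseparable_def
  proof (intro conjI allI impI)
    show "?k < card V" using ins by (simp add: inseparable_def)
    fix S X Y assume *: "S \<subseteq> V" "card S < ?k" "X \<noteq> {}" "Y \<noteq> {}" "X \<union> Y = V - S" "X \<inter> Y = {}"
    from inseparableD[OF ins this] obtain x y where "x \<in> X" "y \<in> Y" "adj x y" by blast
    moreover from this * have "x \<in> V" "y \<in> V" "x \<noteq> y" by auto
    ultimately have "?gl x y" by (auto simp: globally_linked_def)
    with \<open>x \<in> X\<close> \<open>y \<in> Y\<close> show "\<exists>x\<in>X. \<exists>y\<in>Y. ?gl x y" by blast
  qed
  have nbrs: "nbrs v = {u \<in> V - {v}. ?gl v u}" for v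
    using adj_in by (auto simp: nbrs_def)
  have deg: "?k \<le> card (nbrs v)" if "v \<in> V" for v
    unfolding nbrs by (rule inseparable_degree[OF ins_gl fin that])
  have "V \<noteq> {}" using less.prems(5) by blast
  then obtain v where v: "v \<in> V" "clique ?gl (nbrs v)" using exists_simplicial deg by blast
  show ?case
  proof (cases "card V = ?k + 1")
    case True
    show ?thesis
    proof (cases "u = w")
      case False
      then show ?thesis
        using inseparable_complete[OF ins_gl fin True less.prems(5,6)] gl by blast
    qed simp
  next
    case False
    then have card: "?k + 1 < card V" using ins by (simp add: inseparable_def)
    have "inseparable ?k (V - {v}) ?gl"
      using v card adj_sym unfolding nbrs by (intro inseparable_delete_simplicial[OF ins_gl fin]) auto
    moreover have "card (V - {v}) < card V" using v fin by (intro psubset_card_mono) auto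
    ultimately have rest: "sqd q a b = sqd p a b" if "a \<in> V - {v}" "b \<in> V - {v}" for a b
      using less.hyps[of "V - {v}" ?gl q a b] fin generic_on_subset[OF gen] gl that by auto
    \<comment> \<open>At least d + 1 neighbours attach \<open>v\<close> to the remaining vertices,
      whose distances are already known to agree, and trilateration places \<open>v\<close>.\<close>
    have "CARD('d) + 1 \<le> ?k" by simp
    then have "CARD('d) + 1 \<le> card (nbrs v)" using deg[OF v(1)] by linarith
    then obtain B where B: "B \<subseteq> nbrs v" "card B = CARD('d) + 1"
      using exists_subset_card[OF finite_nbrs, of "CARD('d) + 1" v "{}"] by auto
    have BV: "B \<subseteq> V - {v}" using B nbrs_subset by blast
    have vB: "sqd q v x = sqd p v x" if "x \<in> B" for x
      using that B gl by (auto simp: nbrs_def)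
    have all: "sqd q z x = sqd p z x" if "z \<in> V" "x \<in> B" for z x
      using that vB rest BV by (cases "z = v") auto
    show ?thesis
      by (rule sqd_determined_by_frame[OF gen _ B(2)]) (use BV all less.prems in auto)
  qed
qed

text \<open>Without an arc from \<open>X\<close> to \<open>Y\<close>, a walk starting in
  \<open>X\<close> never leaves it.\<close>

lemma k_connected_inseparable:
  assumes "pair_graph G" "k_connected k G"
  shows "inseparable k (pverts G) (\<lambda>u v. (u, v) \<in> parcs G)"
  unfolding inseparable_def
proof (intro conjI allI impI)
  interpret pair_graph G by fact
  show "k < card (pverts G)" using assms(2) by (simp add: k_connected_def)
  fix S X Y
  assume S: "S \<subseteq> pverts G" "card S < k"
    and XY: "X \<noteq> {}" "Y \<noteq> {}" "X \<union> Y = pverts G - S" "X \<inter> Y = {}"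
  let ?H = "induce_subgraph (with_proj G) (pverts G - S)"
  obtain x y where xy: "x \<in> X" "y \<in> Y" using XY by blast
  have "Digraph_Component.connected ?H" using assms(2) S by (simp add: k_connected_def)
  then have "(x, y) \<in> rtrancl_on (verts ?H) ((arcs_ends ?H)\<^sup>s)"
    using xy XY unfolding connected_conv by auto
  show "\<exists>x\<in>X. \<exists>y\<in>Y. (x, y) \<in> parcs G"
  proof (rule ccontr)
    assume none: "\<not> ?thesis"
    from \<open>(x, y) \<in> rtrancl_on (verts ?H) ((arcs_ends ?H)\<^sup>s)\<close> have "y \<in> X"
    proof (induction rule: rtrancl_on_induct)
      case (step a b)
      then have "b \<in> X \<union> Y" "(a, b) \<in> parcs G \<or> (b, a) \<in> parcs G"
        using XY(3) by (auto simp: symcl_def arcs_ends_conv)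
      moreover have "(b, a) \<in> parcs G \<Longrightarrow> (a, b) \<in> parcs G"
        using pair_sym_arcs by (auto simp: symmetric_def dest: symD)
      ultimately show ?case using step none by blast
    qed (use xy in auto)
    then show False using xy XY by blast
  qed
qed

theorem theorem1p2:
  fixes G :: "'v pair_pre_digraph"
  assumes "pair_graph G"
    and "k_connected (CARD('d::finite) * (CARD('d) + 1)) G"
  shows "globally_rigid_graph TYPE('d) G"
proof -
  interpret pair_graph G by fact
  \<comment> \<open>The definition asks for one generic framework; the argument below works for
    any.\<close>
  obtain p :: "'v \<Rightarrow> real ^ 'd" where p: "generic_framework G p"
    using exists_generic_framework pair_finite_verts by blast
  have gen: "generic_on (pverts G) p"
    using p by (simp add: generic_framework_def generic_on_def coord_def)
  have norm_sqd: "norm (r u - r v) = norm (s u - s v) \<longleftrightarrow> sqd s u v = sqd r u v"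
    for r s :: "'v \<Rightarrow> real ^ 'd" and u v
    by (auto simp: sqd_def norm_eq_sqrt_inner)
  have "globally_rigid_framework G p"
    unfolding globally_rigid_framework_def congruent_frameworks_def
  proof (intro allI impI ballI)
    fix q u v assume q: "equivalent_frameworks G p q" and uv: "u \<in> pverts G" "v \<in> pverts G"
    have "sqd q u v = sqd p u v"
      by (rule inseparable_globally_rigid[OF pair_finite_verts gen k_connected_inseparable[OF assms]])
        (use q uv in \<open>auto simp: equivalent_frameworks_def norm_sqd\<close>)
    then show "norm (p u - p v) = norm (q u - q v)" by (simp add: norm_sqd)
  qed
  with p show ?thesis unfolding globally_rigid_graph_def by blast
qed

end
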